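(* Let $q$ range over (a coordinate chart of) the $n$-dimensional configuration manifold $Q$. Let $M(q)=M(q)^\top\in\mathbb{R}^{n\times n}$ be a smooth positive definite inertia tensor, $V(q)$ a smooth potential, and consider the mechanical system in canonical Hamiltonian form $$\dot q=\partial_pH,\qquad \dot p=-\partial_qH+\tau,\qquad H(q,p)=\tfrac12 p^\top M(q)^{-1}p+V(q),$$ with input $\tau\in T_q^*Q$, so that $p=M(q)\dot q$. Let $\eta=J(q)\dot q$ be a differential task, with $J(q)\in\mathbb{R}^{m\times n}$ smooth in $q$, $m\le n$, and $\operatorname{rank}J(q)=m$. Let $Z(q)\in\mathbb{R}^{(n-m)\times n}$ be smooth in $q$, of full row rank, with $JZ^\top=0$, and put $$N=(ZMZ^\top)^{-1}ZM,\quad \bar J=\begin{bmatrix}J\\N\end{bmatrix},\quad J_M^{\#}=M^{-1}J^\top(JM^{-1}J^\top)^{-1},\quad \nu=N\dot q,$$ $$\bar\Lambda=(\bar JM^{-1}\bar J^\top)^{-1}=\operatorname{blockdiag}(\Lambda_t,\Lambda_\nu),\qquad \Lambda_t\in\mathbb{R}^{m\times m},\ \Lambda_\nu\in\mathbb{R}^{(n-m)\times(n-m)}.$$ Consider the change of coordinates $$(q,p)\mapsto z=\Phi(q,p)=(q,\pi_e),\qquad \pi_e=\bar J(q)^{-\top}p=\begin{pmatrix}\pi\\ \pi_\nu\end{pmatrix},\quad \pi\in\mathbb{R}^m,\ \pi_\nu\in\mathbb{R}^{n-m}.$$ Then $\begin{bmatrix}J_M^{\#}&Z^\top\end{bmatrix}=\bar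 J^{-1}$, and in the variables $(q,\pi,\pi_\nu)$ the system is the port-Hamiltonian system $$\begin{pmatrix}\dot q\\ \dot\pi\\ \dot\pi_\nu\end{pmatrix}=\begin{pmatrix}0&J_M^{\#}&Z^\top\\ -(J_M^{\#})^\top&G_{11}&G_{12}\\ -Z&-G_{12}^\top&G_{22}\end{pmatrix}\begin{pmatrix}\partial_q\bar H\\ \partial_\pi\bar H\\ \partial_{\pi_\nu}\bar H\end{pmatrix}+\begin{pmatrix}0\\ \sigma\\ 0\end{pmatrix}+\begin{pmatrix}0\\0\\ \tau_0\end{pmatrix},$$ with outputs $y=\partial_\pi\bar H=\eta$ and $y_\nu=\partial_{\pi_\nu}\bar H=\nu$, inputs $\sigma=(J_M^{\#})^\top\tau$ and $\tau_0=Z\tau$, and Hamiltonian $$\bar H(z)=H(\Phi^{-1}(z))=\tfrac12\pi^\top\Lambda_t^{-1}(q)\pi+\tfrac12\pi_\nu^\top\Lambda_\nu^{-1}(q)\pi_\nu+V(q).$$ Here $$G_{11}=-G_{11}^\top=A_tJ_M^{\#}-(J_M^{\#})^\top A_t^\top,\quad G_{12}=A_tZ^\top-(J_M^{\#})^\top A_n^\top,\quad G_{22}=-G_{22}^\top=A_nZ^\top-ZA_n^\top,$$ $$A_t=\big(\partial_q (J_M^{\#})^\top\big)\bar J^\top\pi_e+(J_M^{\#})^\top\big(\partial_q\bar J^\top\big)\pi_e,\qquad A_n=(\partial_qZ)\bar J^\top\pi_e+Z\big(\partial_q\bar J^\top\big)\pi_e .$$ Furthermore, let $\dot q=v+\nu_{\ker}$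 be the unique decomposition with $\nu_{\ker}\in\operatorname{Ker}(J)$ and $v\in\operatorname{Ker}^{\perp_M}(J)$, and let $\tau=\tau_{\ker}+\tau_F$ be the unique decomposition with $\tau_{\ker}\in\operatorname{Ker}(JM^{-1})$ and $\tau_F\in\operatorname{Im}(J^\top)$. Then: (1) The null-space port variables $\nu$ and $\tau_0$ are exactly the components $\nu_{\ker}$ and $\tau_{\ker}$ of these decompositions, expressed in coordinates with respect to the columns of $Z^\top$ (a basis of $\operatorname{Ker}(J)$) and the columns of $N^\top$ (a basis of $\operatorname{Ker}(JM^{-1})$) respectively; that is, $\nu_{\ker}=Z^\top\nu$ and $\tau_{\ker}=N^\top\tau_0$. (2) The task port variables $\eta\in\mathcal X$ and $\sigma\in\mathcal X^*$ are isomorphic to $v\in\operatorname{Ker}^{\perp_M}(J)$ and $\tau_F\in\operatorname{Im}(J^\top)$, through $v=J_M^{\#}\eta$ and $\tau_F=J^\top\sigma$, and $\tau_F^\top v=\sigma^\top\eta$, i.e. their pairing is the mechanical power at the task port.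
   Context: Vectors and covectors are both written as columns, so $\beta^\top w$ is the application of a covector $\beta$ to a vector $w$. Gradients $\partial_x f$ of scalar functions are columns. The task space is an $m$-dimensional vector space $\mathcal X$, identified with $\mathbb{R}^m$, with dual $\mathcal X^*$. $\bar J^{-\top}$ denotes $(\bar J^{-1})^\top$. The dependence of $M,J,N,Z,\bar J,J_M^{\#},\Lambda_t,\Lambda_\nu$ on $q$ is often suppressed. $\bar J(q)$ is invertible and $\bar\Lambda(q)$ is block-diagonal by the choice of $N$. $\operatorname{Ker}^{\perp_M}(J)=\{w\in T_qQ: w^\top M s=0\ \forall s\in\operatorname{Ker}(J)\}$ is the $M$-orthogonal complement of $\operatorname{Ker}(J)$. For every $q$ one has $T_qQ=\operatorname{Ker}(J)\oplus\operatorname{Ker}^{\perp_M}(J)$ and $T_q^*Q=\operatorname{Ker}(JM^{-1})\oplus\operatorname{Im}(J^\top)$. Derivative notation: for a matrix-valued function $A(q)\in\mathbb{R}^{k\times r}$ and a vector $w\in\mathbb{R}^r$, $(\partial_qA)w$ is the $k\times n$ matrix with entries $[(\partial_qA)w]_{ij}=\sum_{l}\frac{\partial A_{il}}{\partial q_j}(q)\,w_l$, the vector $w$ being held fixed under differentiation. In $A_t$ and $A_n$ it is applied to $(J_M^{\#})^\top$ and $Z$ with $w=\bar J(q)^\top\pi_e$, and to $\bar J^\top$ with $w=\pi_e$.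
   Formalization: A_t and A_n are taken as (∂_q(J_M^#)^T)J̄^Tπ_e and (∂_qZ)J̄^Tπ_e only; the printed second summands are dropped, since with them A_t=A_n=0 and all G blocks vanish, which is false, e.g. for M=I, V=0, τ=0, J=[1 0], Z=[0 e^{q1}]. *)

theory Defs
  imports
    "HOL-Analysis.Derivative"
    "Jordan_Normal_Form.Gauss_Jordan_Elimination"
    "Jordan_Normal_Form.Matrix_Kernel"
    "Jordan_Normal_Form.DL_Rank"
begin

unbundle no inner_syntax
unbundle no vec_syntax

text \<open>
  Vectors and matrices are those of Jordan_Normal_Form, since their dimensions are natural numbers
  and may be 0: for m = n the matrix Z has no rows. The price is that calculus in
  \<^term>\<open>carrier_vec n\<close> has to be set up through partial derivatives.
\<close>

definition open_vec :: "nat \<Rightarrow> real vec set \<Rightarrow> bool" where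
  "open_vec n U \<longleftrightarrow> U \<subseteq> carrier_vec n \<and>
     (\<forall>x\<in>U. \<exists>e>0. \<forall>y\<in>carrier_vec n. (\<forall>i<n. \<bar>y $ i - x $ i\<bar> < e) \<longrightarrow> y \<in> U)"

definition continuous_on_vec :: "nat \<Rightarrow> real vec set \<Rightarrow> (real vec \<Rightarrow> real) \<Rightarrow> bool" where
  "continuous_on_vec n U f \<longleftrightarrow>
     (\<forall>x\<in>U. \<forall>e>0. \<exists>d>0. \<forall>y\<in>U. (\<forall>i<n. \<bar>y $ i - x $ i\<bar> < d) \<longrightarrow> \<bar>f y - f x\<bar> < e)"

definition partial_deriv :: "nat \<Rightarrow> (real vec \<Rightarrow> real) \<Rightarrow> real vec \<Rightarrow> real" where
  "partial_deriv i f x = deriv (\<lambda>s. f (x + s \<cdot>\<^sub>v unit_vec (dim_vec x) i)) 0"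

definition grad :: "(real vec \<Rightarrow> real) \<Rightarrow> real vec \<Rightarrow> real vec" where
  "grad f x = vec (dim_vec x) (\<lambda>i. partial_deriv i f x)"

primrec C_k :: "nat \<Rightarrow> nat \<Rightarrow> real vec set \<Rightarrow> (real vec \<Rightarrow> real) \<Rightarrow> bool" where
  "C_k 0 n U f \<longleftrightarrow> continuous_on_vec n U f"
| "C_k (Suc k) n U f \<longleftrightarrow> continuous_on_vec n U f \<and>
     (\<forall>i<n. (\<forall>x\<in>U. (\<lambda>s. f (x + s \<cdot>\<^sub>v unit_vec n i)) differentiable (at 0)) \<and>
            C_k k n U (partial_deriv i f))"

definition smooth_vec :: "nat \<Rightarrow> real vec set \<Rightarrow> (real vec \<Rightarrow> real) \<Rightarrow> bool" where
  "smooth_vec n U f \<longleftrightarrow> (\<forall>k. C_k k n U f)"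

definition smooth_mat :: "nat \<Rightarrow> nat \<Rightarrow> nat \<Rightarrow> real vec set \<Rightarrow> (real vec \<Rightarrow> real mat) \<Rightarrow> bool" where
  "smooth_mat k r n U A \<longleftrightarrow> (\<forall>x\<in>U. A x \<in> carrier_mat k r) \<and>
     (\<forall>i<k. \<forall>j<r. smooth_vec n U (\<lambda>x. A x $$ (i, j)))"

definition has_vec_deriv :: "(real \<Rightarrow> real vec) \<Rightarrow> real vec \<Rightarrow> real \<Rightarrow> bool" where
  "has_vec_deriv c c' t \<longleftrightarrow> dim_vec (c t) = dim_vec c' \<and>
     (\<forall>i<dim_vec c'. ((\<lambda>s. c s $ i) has_real_derivative c' $ i) (at t))"

text \<open>The matrix written \<open>(\<partial>\<^sub>q A) w\<close>: the vector \<open>w\<close> is a constant for the differentiation.\<close>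

definition deriv_mat_vec :: "(real vec \<Rightarrow> real mat) \<Rightarrow> real vec \<Rightarrow> real vec \<Rightarrow> real mat" where
  "deriv_mat_vec A w q = mat (dim_row (A q)) (dim_vec q)
     (\<lambda>(i, j). \<Sum>l<dim_vec w. partial_deriv j (\<lambda>x. A x $$ (i, l)) q * w $ l)"

definition minv :: "real mat \<Rightarrow> real mat" where
  "minv A = the (mat_inverse A)"

definition append_cols :: "real mat \<Rightarrow> real mat \<Rightarrow> real mat" (infixr \<open>@\<^sub>c\<close> 66) where
  "A @\<^sub>c B = four_block_mat A B (0\<^sub>m 0 (dim_col A)) (0\<^sub>m 0 (dim_col B))"

definition sym_pos_def :: "nat \<Rightarrow> real mat \<Rightarrow> bool" where
  "sym_pos_def n A \<longleftrightarrow> A \<in> carrier_mat n n \<and> A\<^sup>T = A \<and>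
     (\<forall>x\<in>carrier_vec n. x \<noteq> 0\<^sub>v n \<longrightarrow> x \<bullet> (A *\<^sub>v x) > 0)"

definition mat_range :: "real mat \<Rightarrow> real vec set" where
  "mat_range A = (\<lambda>x. A *\<^sub>v x) ` carrier_vec (dim_col A)"

definition ker_perp :: "real mat \<Rightarrow> real mat \<Rightarrow> real vec set" where
  "ker_perp M J = {w \<in> carrier_vec (dim_col J). \<forall>s\<in>mat_kernel J. w \<bullet> (M *\<^sub>v s) = 0}"

definition cols_basis :: "real mat \<Rightarrow> real vec set \<Rightarrow> bool" where
  "cols_basis A S \<longleftrightarrow> distinct (cols A) \<and>
     vectorspace.basis class_ring ((module_vec TYPE(real) (dim_row A))\<lparr>carrier := S\<rparr>) (set (cols A))"

definition Nmat :: "(real vec \<Rightarrow> real mat) \<Rightarrow> (real vec \<Rightarrow> real mat) \<Rightarrow> real vec \<Rightarrow> real mat" where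
  "Nmat M Z q = minv (Z q * M q * (Z q)\<^sup>T) * Z q * M q"

definition Jbar :: "(real vec \<Rightarrow> real mat) \<Rightarrow> (real vec \<Rightarrow> real mat) \<Rightarrow> (real vec \<Rightarrow> real mat) \<Rightarrow>
    real vec \<Rightarrow> real mat" where
  "Jbar M J Z q = J q @\<^sub>r Nmat M Z q"

definition Jsharp :: "(real vec \<Rightarrow> real mat) \<Rightarrow> (real vec \<Rightarrow> real mat) \<Rightarrow> real vec \<Rightarrow> real mat" where
  "Jsharp M J q = minv (M q) * (J q)\<^sup>T * minv (J q * minv (M q) * (J q)\<^sup>T)"

definition Lambda_bar :: "(real vec \<Rightarrow> real mat) \<Rightarrow> (real vec \<Rightarrow> real mat) \<Rightarrow> (real vec \<Rightarrow> real mat) \<Rightarrow>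
    real vec \<Rightarrow> real mat" where
  "Lambda_bar M J Z q = minv (Jbar M J Z q * minv (M q) * (Jbar M J Z q)\<^sup>T)"

definition Lambda_t :: "(real vec \<Rightarrow> real mat) \<Rightarrow> (real vec \<Rightarrow> real mat) \<Rightarrow> (real vec \<Rightarrow> real mat) \<Rightarrow>
    real vec \<Rightarrow> real mat" where
  "Lambda_t M J Z q =
     (case split_block (Lambda_bar M J Z q) (dim_row (J q)) (dim_row (J q)) of (A, B, C, D) \<Rightarrow> A)"

definition Lambda_nu :: "(real vec \<Rightarrow> real mat) \<Rightarrow> (real vec \<Rightarrow> real mat) \<Rightarrow> (real vec \<Rightarrow> real mat) \<Rightarrow>
    real vec \<Rightarrow> real mat" where
  "Lambda_nu M J Z q =
     (case split_block (Lambda_bar M J Z q) (dim_row (J q)) (dim_row (J q)) of (A, B, C, D) \<Rightarrow> D)"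

definition Ham :: "(real vec \<Rightarrow> real mat) \<Rightarrow> (real vec \<Rightarrow> real) \<Rightarrow> real vec \<times> real vec \<Rightarrow> real" where
  "Ham M V = (\<lambda>(q, p). 1 / 2 * (p \<bullet> (minv (M q) *\<^sub>v p)) + V q)"

definition Phi :: "(real vec \<Rightarrow> real mat) \<Rightarrow> (real vec \<Rightarrow> real mat) \<Rightarrow> (real vec \<Rightarrow> real mat) \<Rightarrow>
    real vec \<times> real vec \<Rightarrow> real vec \<times> real vec" where
  "Phi M J Z = (\<lambda>(q, p). (q, (minv (Jbar M J Z q))\<^sup>T *\<^sub>v p))"

definition Hbar :: "nat \<Rightarrow> real vec set \<Rightarrow> (real vec \<Rightarrow> real mat) \<Rightarrow> (real vec \<Rightarrow> real) \<Rightarrow>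
    (real vec \<Rightarrow> real mat) \<Rightarrow> (real vec \<Rightarrow> real mat) \<Rightarrow> real vec \<times> real vec \<Rightarrow> real" where
  "Hbar n U M V J Z z = Ham M V (inv_into (U \<times> carrier_vec n) (Phi M J Z) z)"

text \<open>
  Erratum. The source adds to the two matrices below the summands
  \<open>(J\<^sub>M\<^sup>#)\<^sup>T (\<partial>\<^sub>q Jbar\<^sup>T) \<pi>\<^sub>e\<close> and \<open>Z (\<partial>\<^sub>q Jbar\<^sup>T) \<pi>\<^sub>e\<close> respectively. With them both matrices vanish
  identically, by the product rule applied to \<open>(J\<^sub>M\<^sup>#)\<^sup>T Jbar\<^sup>T = [I 0]\<close> and \<open>Z Jbar\<^sup>T = [0 I]\<close>, and then
  so do all the gyroscopic blocks, which is wrong in general (take n = 2, m = 1, M = I, V = 0,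
  J = [1 0], Z = [0 exp q1]). The summands are therefore left out: \<open>A\<^sub>t\<close> and \<open>A\<^sub>n\<close> are the derivatives
  of \<open>\<pi>\<close> and \<open>\<pi>\<^sub>\<nu>\<close> with respect to \<open>q\<close> at constant momentum \<open>p = Jbar\<^sup>T \<pi>\<^sub>e\<close>.
\<close>

definition A_t :: "(real vec \<Rightarrow> real mat) \<Rightarrow> (real vec \<Rightarrow> real mat) \<Rightarrow> (real vec \<Rightarrow> real mat) \<Rightarrow>
    real vec \<Rightarrow> real vec \<Rightarrow> real mat" where
  "A_t M J Z q e = deriv_mat_vec (\<lambda>x. (Jsharp M J x)\<^sup>T) ((Jbar M J Z q)\<^sup>T *\<^sub>v e) q"

definition A_n :: "(real vec \<Rightarrow> real mat) \<Rightarrow> (real vec \<Rightarrow> real mat) \<Rightarrow> (real vec \<Rightarrow> real mat) \<Rightarrow>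
    real vec \<Rightarrow> real vec \<Rightarrow> real mat" where
  "A_n M J Z q e = deriv_mat_vec Z ((Jbar M J Z q)\<^sup>T *\<^sub>v e) q"

definition G11 :: "(real vec \<Rightarrow> real mat) \<Rightarrow> (real vec \<Rightarrow> real mat) \<Rightarrow> (real vec \<Rightarrow> real mat) \<Rightarrow>
    real vec \<Rightarrow> real vec \<Rightarrow> real mat" where
  "G11 M J Z q e = A_t M J Z q e * Jsharp M J q - (Jsharp M J q)\<^sup>T * (A_t M J Z q e)\<^sup>T"

definition G12 :: "(real vec \<Rightarrow> real mat) \<Rightarrow> (real vec \<Rightarrow> real mat) \<Rightarrow> (real vec \<Rightarrow> real mat) \<Rightarrow>
    real vec \<Rightarrow> real vec \<Rightarrow> real mat" where
  "G12 M J Z q e = A_t M J Z q e * (Z q)\<^sup>T - (Jsharp M J q)\<^sup>T * (A_n M J Z q e)\<^sup>T"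

definition G22 :: "(real vec \<Rightarrow> real mat) \<Rightarrow> (real vec \<Rightarrow> real mat) \<Rightarrow> (real vec \<Rightarrow> real mat) \<Rightarrow>
    real vec \<Rightarrow> real vec \<Rightarrow> real mat" where
  "G22 M J Z q e = A_n M J Z q e * (Z q)\<^sup>T - Z q * (A_n M J Z q e)\<^sup>T"

definition struct_mat :: "(real vec \<Rightarrow> real mat) \<Rightarrow> (real vec \<Rightarrow> real mat) \<Rightarrow> (real vec \<Rightarrow> real mat) \<Rightarrow>
    real vec \<Rightarrow> real vec \<Rightarrow> real mat" where
  "struct_mat M J Z q e =
     (0\<^sub>m (dim_vec q) (dim_vec q) @\<^sub>c Jsharp M J q @\<^sub>c (Z q)\<^sup>T)
     @\<^sub>r (- (Jsharp M J q)\<^sup>T @\<^sub>c G11 M J Z q e @\<^sub>c G12 M J Z q e)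
     @\<^sub>r (- Z q @\<^sub>c - (G12 M J Z q e)\<^sup>T @\<^sub>c G22 M J Z q e)"

definition ham_solution :: "(real vec \<Rightarrow> real mat) \<Rightarrow> (real vec \<Rightarrow> real) \<Rightarrow> real set \<Rightarrow>
    (real \<Rightarrow> real vec) \<Rightarrow> (real \<Rightarrow> real vec) \<Rightarrow> (real \<Rightarrow> real vec) \<Rightarrow> bool" where
  "ham_solution M V T q p \<tau> \<longleftrightarrow> (\<forall>t\<in>T.
     has_vec_deriv q (grad (\<lambda>y. Ham M V (q t, y)) (p t)) t \<and>
     has_vec_deriv p (- grad (\<lambda>x. Ham M V (x, p t)) (q t) + \<tau> t) t)"

definition ph_solution :: "(real vec \<Rightarrow> real mat) \<Rightarrow> (real vec \<Rightarrow> real mat) \<Rightarrow> (real vec \<Rightarrow> real mat) \<Rightarrow>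
    (real vec \<times> real vec \<Rightarrow> real) \<Rightarrow> real set \<Rightarrow> (real \<Rightarrow> real vec) \<Rightarrow> (real \<Rightarrow> real vec) \<Rightarrow>
    (real \<Rightarrow> real vec) \<Rightarrow> (real \<Rightarrow> real vec) \<Rightarrow> (real \<Rightarrow> real vec) \<Rightarrow> bool" where
  "ph_solution M J Z K T q \<pi> \<pi>\<^sub>\<nu> \<sigma> \<tau>\<^sub>0 \<longleftrightarrow> (\<forall>t\<in>T.
     has_vec_deriv (\<lambda>s. q s @\<^sub>v \<pi> s @\<^sub>v \<pi>\<^sub>\<nu> s)
       (struct_mat M J Z (q t) (\<pi> t @\<^sub>v \<pi>\<^sub>\<nu> t) *\<^sub>v
          (grad (\<lambda>x. K (x, \<pi> t @\<^sub>v \<pi>\<^sub>\<nu> t)) (q t)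
           @\<^sub>v grad (\<lambda>x. K (q t, x @\<^sub>v \<pi>\<^sub>\<nu> t)) (\<pi> t)
           @\<^sub>v grad (\<lambda>x. K (q t, \<pi> t @\<^sub>v x)) (\<pi>\<^sub>\<nu> t))
        + (0\<^sub>v (dim_vec (q t)) @\<^sub>v \<sigma> t @\<^sub>v 0\<^sub>v (dim_vec (\<pi>\<^sub>\<nu> t)))
        + (0\<^sub>v (dim_vec (q t)) @\<^sub>v 0\<^sub>v (dim_vec (\<pi> t)) @\<^sub>v \<tau>\<^sub>0 t)) t)"

end

(*
  The product W = [J# Z^T] is a right inverse of Jbar, because J J# = 1, J Z^T = 0, N J# = 0 and
  N Z^T = 1; since both are square, it is the inverse. The dynamics rests on two derivatives of
  pi_e = W(q)^T p. Along a solution, pi_e' = A q' + W^T p', where A = (A_t, A_n) is the derivative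
  of W^T p with respect to q at constant p. Differentiating H(q, p) = Hbar(q, W(q)^T p) with
  respect to q at constant p gives d_q H = d_q Hbar + A^T (eta, nu). Substituting the second
  identity and q' = W (eta, nu) into the first yields the gyroscopic blocks
  A W - W^T A^T, and the converse holds because W is invertible.
*)
theory Submission
  imports Defs
begin

section \<open>Linear algebra\<close>

text \<open>Invertibility of \<open>W\<close> settles the converse only after \<open>p\<close> is
  known to be differentiable, and a port-Hamiltonian solution asserts this for \<open>q\<close>,
  \<open>\<pi>\<close> and \<open>\<pi>\<^sub>\<nu>\<close> alone. So \<open>p\<close> is rebuilt as
  \<open>J^T \<pi> + N^T \<pi>\<^sub>\<nu>\<close>, which is differentiable by the product rule;
  uniqueness of derivatives then fixes both blocks of \<open>W^T p'\<close>, hence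
  \<open>p'\<close>. This is why \<open>N\<close>, and with it the inverse of
  \<open>Z M Z^T\<close>, has to be differentiable as well. Differentiability passes from the smooth
  data to all inverses through Cramer's rule. The gradient identity compares two derivatives along
  the same coordinate line: one with \<open>p\<close> frozen, one with the new momenta frozen. In
  both, the energy is a sum of quadratic forms with coefficients \<open>J M^-1 J^T\<close> and
  \<open>(Z M Z^T)^-1\<close>. The derivatives of these coefficients are never evaluated: they occur
  identically on both sides, and only the motion of the momenta, governed by \<open>A_t\<close> and
  \<open>A_n\<close>, survives in the difference.\<close>

lemma minv_eqI:
  assumes A: "A \<in> carrier_mat n n" and B: "B \<in> carrier_mat n n" and AB: "A * B = 1\<^sub>m n"
  shows "minv A = B"
proof -
  have BA: "B * A = 1\<^sub>m n"
    using mat_mult_left_right_inverse[OF A B AB] .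
  \<comment> \<open>Being a unit of the matrix ring excludes the outcome \<open>None\<close> of
    \<open>mat_inverse\<close>, so the \<open>the\<close> in \<open>minv\<close> has a definite
    value.\<close>
  have "A \<in> Units (ring_mat TYPE(real) n ())"
    using A B AB BA by (auto simp: Units_def ring_mat_simps)
  with mat_inverse(1)[OF A, where b = "()"] obtain C where C: "mat_inverse A = Some C"
    by (cases "mat_inverse A") auto
  note C' = mat_inverse(2)[OF A C]
  have "C = C * (A * B)" using C' AB by auto
  also have "\<dots> = (C * A) * B" using C' A B by (intro assoc_mult_mat[symmetric]) auto
  also have "\<dots> = B" using C' B by simp
  finally show ?thesis by (simp add: minv_def C)
qed

text \<open>Invertibility is asked for as injectivity, the form in which positive definiteness
  delivers it; a trivial kernel makes the determinant nonzero.\<close>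

lemma minv_inverse:
  assumes A: "A \<in> carrier_mat n n"
    and inj: "\<And>x. x \<in> carrier_vec n \<Longrightarrow> A *\<^sub>v x = 0\<^sub>v n \<Longrightarrow> x = 0\<^sub>v n"
  shows "minv A \<in> carrier_mat n n" "A * minv A = 1\<^sub>m n" "minv A * A = 1\<^sub>m n"
proof -
  have "det A \<noteq> 0"
    using det_0_iff_vec_prod_zero[OF A] inj by blast
  from det_non_zero_imp_unit[OF A this, where b = "()"]
  obtain B where B: "B \<in> carrier_mat n n" "A * B = 1\<^sub>m n" "B * A = 1\<^sub>m n"
    by (auto simp: Units_def ring_mat_simps)
  have "minv A = B" by (rule minv_eqI[OF A B(1,2)])
  then show "minv A \<in> carrier_mat n n" "A * minv A = 1\<^sub>m n" "minv A * A = 1\<^sub>m n"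
    using B by auto
qed

lemma invertible_matI:
  assumes "A \<in> carrier_mat n n" "B \<in> carrier_mat n n" "A * B = 1\<^sub>m n" "B * A = 1\<^sub>m n"
  shows "invertible_mat A"
  using assms unfolding invertible_mat_def inverts_mat_def by auto

lemma scalar_prod_self_eq_0:
  fixes x :: "real vec"
  assumes x: "x \<in> carrier_vec n" and 0: "x \<bullet> x = 0"
  shows "x = 0\<^sub>v n"
proof -
  have "(\<Sum>i<n. x $ i * x $ i) = 0"
    using 0 x by (simp add: scalar_prod_def atLeast0LessThan)
  then have "\<forall>i<n. x $ i = 0"
    by (subst (asm) sum_nonneg_eq_0_iff) auto
  then show ?thesis using x by (intro eq_vecI) auto
qed

lemma sym_pos_def_inj:
  assumes "sym_pos_def n A" "x \<in> carrier_vec n" "A *\<^sub>v x = 0\<^sub>v n"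
  shows "x = 0\<^sub>v n"
proof (rule ccontr)
  assume "x \<noteq> 0\<^sub>v n"
  then have "x \<bullet> (A *\<^sub>v x) > 0" using assms by (auto simp: sym_pos_def_def)
  then show False using assms by simp
qed

lemma sym_pos_def_inverse:
  assumes A: "sym_pos_def n A"
  shows "minv A \<in> carrier_mat n n" "A * minv A = 1\<^sub>m n" "minv A * A = 1\<^sub>m n"
  using minv_inverse[OF _ sym_pos_def_inj[OF A]] A by (auto simp: sym_pos_def_def)

text \<open>With \<open>y = minv A *\<^sub>v x\<close> the form of \<open>minv A\<close> at
  \<open>x\<close> is the form of \<open>A\<close> at \<open>y\<close>. Symmetry is uniqueness of
  the inverse, because the transpose of \<open>minv A\<close> is also a right inverse of
  \<open>A\<close>.\<close>

lemma sym_pos_def_minv: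
  assumes A: "sym_pos_def n A"
  shows "sym_pos_def n (minv A)"
proof -
  note I = sym_pos_def_inverse[OF A]
  have Ac: "A \<in> carrier_mat n n" and At: "A\<^sup>T = A" using A by (auto simp: sym_pos_def_def)
  have "A * (minv A)\<^sup>T = 1\<^sub>m n"
    using transpose_mult[OF I(1) Ac] At I(3) by simp
  then have sym: "(minv A)\<^sup>T = minv A"
    using minv_eqI[OF Ac, of "(minv A)\<^sup>T"] I(1) by simp
  have "x \<bullet> (minv A *\<^sub>v x) > 0" if x: "x \<in> carrier_vec n" "x \<noteq> 0\<^sub>v n" for x
  proof -
    define y where "y = minv A *\<^sub>v x"
    have y: "y \<in> carrier_vec n" using I(1) x(1) by (simp add: y_def)
    have Ay: "A *\<^sub>v y = x"
      unfolding y_def using assoc_mult_mat_vec[OF Ac I(1) x(1)] I(2) x(1) by simp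
    then have "y \<noteq> 0\<^sub>v n" using x(2) Ac by auto
    then have "y \<bullet> (A *\<^sub>v y) > 0" using A y by (simp add: sym_pos_def_def)
    then show ?thesis using Ay comm_scalar_prod[OF y x(1)] by (simp add: y_def)
  qed
  then show ?thesis using I(1) sym by (simp add: sym_pos_def_def)
qed

text \<open>The form at \<open>x\<close> is the form of \<open>A\<close> at \<open>B^T x\<close>. It
  serves twice: for \<open>J M^-1 J^T\<close> and for \<open>Z M Z^T\<close>, where injectivity of
  \<open>B^T\<close> comes from full row rank.\<close>

lemma sym_pos_def_congruence:
  assumes A: "sym_pos_def n A" and B: "B \<in> carrier_mat k n"
    and inj: "\<And>x. x \<in> carrier_vec k \<Longrightarrow> B\<^sup>T *\<^sub>v x = 0\<^sub>v n \<Longrightarrow> x = 0\<^sub>v k"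
  shows "sym_pos_def k (B * A * B\<^sup>T)"
proof -
  have Ac: "A \<in> carrier_mat n n" and At: "A\<^sup>T = A" using A by (auto simp: sym_pos_def_def)
  have BA: "B * A \<in> carrier_mat k n" and BT: "B\<^sup>T \<in> carrier_mat n k" using B Ac by auto
  have "(B * A * B\<^sup>T)\<^sup>T = B * (A * B\<^sup>T)"
    using transpose_mult[OF BA BT] transpose_mult[OF B Ac] At by simp
  then have sym: "(B * A * B\<^sup>T)\<^sup>T = B * A * B\<^sup>T"
    using assoc_mult_mat[OF B Ac BT] by simp
  have "x \<bullet> (B * A * B\<^sup>T *\<^sub>v x) > 0" if x: "x \<in> carrier_vec k" "x \<noteq> 0\<^sub>v k" for x
  proof -
    define y where "y = B\<^sup>T *\<^sub>v x"
    have y: "y \<in> carrier_vec n" using BT x(1) by (simp add: y_def)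
    have "y \<noteq> 0\<^sub>v n" using inj x by (auto simp: y_def)
    then have "0 < y \<bullet> (A *\<^sub>v y)" using A y by (simp add: sym_pos_def_def)
    also have "\<dots> = x \<bullet> (B *\<^sub>v (A *\<^sub>v y))"
      unfolding y_def using transpose_vec_mult_scalar[OF B _ x(1), of "A *\<^sub>v y"] Ac y
      by (simp add: y_def)
    also have "B *\<^sub>v (A *\<^sub>v y) = B * A * B\<^sup>T *\<^sub>v x"
      using assoc_mult_mat_vec[OF BA BT x(1)] assoc_mult_mat_vec[OF B Ac y] by (simp add: y_def)
    finally show ?thesis .
  qed
  then show ?thesis using sym BA BT by (auto simp: sym_pos_def_def)
qed

section \<open>Full row rank and bases of kernels\<close>

lemma full_row_rank_surj:
  fixes A :: "real mat"
  assumes A: "A \<in> carrier_mat m n" and rk: "vec_space.rank m A = m" and y: "y \<in> carrier_vec m"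
  shows "\<exists>x\<in>carrier_vec n. A *\<^sub>v x = y"
proof -
  interpret vec_space "TYPE(real)" m .
  have sub: "set (cols A) \<subseteq> carrier_vec m" using cols_dim[of A] A by simp
  \<comment> \<open>The rank is the size of a maximal independent set of columns; with
    \<open>m\<close> elements in an \<open>m\<close>-dimensional space such a set is a basis, so the
    columns span.\<close>
  obtain S where S: "finite S" "maximal S (\<lambda>T. T \<subseteq> set (cols A) \<and> lin_indpt T)"
    using maximal_exists_superset[of "set (cols A)" "\<lambda>T. T \<subseteq> set (cols A) \<and> lin_indpt T" "{}"]
    by (auto simp: lin_dep_def)
  have "card S = m" using rank_card_indpt[OF A S(2)] rk by simp
  moreover have li: "S \<subseteq> set (cols A)" "lin_indpt S" using S(2) by (auto simp: maximal_def)
  ultimately have "basis S"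
    using dim_li_is_basis[of S] S(1) sub dim_is_n by auto
  then have "span S = carrier_vec m" by (auto simp: basis_def)
  then have "y \<in> span (set (cols A))"
    using y span_is_monotone[OF li(1)] by auto
  then show ?thesis
    using col_space_eq[OF A] A unfolding col_space_def by auto
qed

text \<open>A vector \<open>y\<close> in the kernel of the transpose is orthogonal to the range of
  \<open>A\<close>. By surjectivity \<open>y\<close> lies in that range, so it is orthogonal to
  itself.\<close>

lemma full_row_rank_transpose_inj:
  fixes A :: "real mat"
  assumes A: "A \<in> carrier_mat m n" and rk: "vec_space.rank m A = m"
    and y: "y \<in> carrier_vec m" and 0: "A\<^sup>T *\<^sub>v y = 0\<^sub>v n"
  shows "y = 0\<^sub>v m"
proof -
  obtain x where x: "x \<in> carrier_vec n" "A *\<^sub>v x = y"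
    using full_row_rank_surj[OF A rk y] by blast
  have "y \<bullet> y = (A\<^sup>T *\<^sub>v y) \<bullet> x" using transpose_vec_mult_scalar[OF A x(1) y] x(2) by simp
  then have "y \<bullet> y = 0" using 0 x(1) by simp
  then show ?thesis using scalar_prod_self_eq_0[OF y] by simp
qed

lemma mult_unit_vec:
  fixes A :: "real mat"
  assumes "A \<in> carrier_mat n k" "i < k"
  shows "A *\<^sub>v unit_vec k i = col A i"
  using assms by (intro eq_vecI) auto

text \<open>The image condition gives spanning and injectivity gives independence. Distinctness of
  the columns is proved separately, because \<open>set (cols A)\<close> would merge equal columns
  and the coordinates would no longer be indexed by the basis.\<close>

lemma cols_basis_kernelI:
  fixes A K :: "real mat"
  assumes A: "A \<in> carrier_mat n k" and K: "K \<in> carrier_mat r n"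
    and ker: "mat_kernel K = (\<lambda>x. A *\<^sub>v x) ` carrier_vec k"
    and inj: "\<And>x. x \<in> carrier_vec k \<Longrightarrow> A *\<^sub>v x = 0\<^sub>v n \<Longrightarrow> x = 0\<^sub>v k"
  shows "cols_basis A (mat_kernel K)"
proof -
  interpret ker: kernel r n K by unfold_locales (rule K)
  have dist: "distinct (cols A)"
    unfolding distinct_conv_nth
  proof (intro allI impI)
    fix i j assume ij: "i < length (cols A)" "j < length (cols A)" "i \<noteq> j"
    show "cols A ! i \<noteq> cols A ! j"
    proof
      assume eq: "cols A ! i = cols A ! j"
      have i: "i < k" "j < k" using ij A by auto
      \<comment> \<open>Equal columns \<open>i\<close> and \<open>j\<close> make \<open>A\<close>
        annihilate this vector, whose entry at \<open>i\<close> is 1.\<close>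
      let ?d = "unit_vec k i - unit_vec k j :: real vec"
      have "A *\<^sub>v ?d = A *\<^sub>v unit_vec k i - A *\<^sub>v unit_vec k j"
        using A by (intro mult_minus_distrib_mat_vec) auto
      also have "\<dots> = 0\<^sub>v n"
        using eq i A by (simp add: mult_unit_vec)
      finally have "?d = 0\<^sub>v k" by (intro inj) auto
      then have "?d $ i = 0" using i by simp
      then show False using i ij by simp
    qed
  qed
  have sub: "set (cols A) \<subseteq> mat_kernel K"
  proof
    fix c assume "c \<in> set (cols A)"
    then obtain i where i: "i < k" "c = col A i" using A by (auto simp: in_set_conv_nth)
    then have "c = A *\<^sub>v unit_vec k i" using A by (simp add: mult_unit_vec)
    then show "c \<in> mat_kernel K" unfolding ker by auto
  qed
  \<comment> \<open>Independence and span are first obtained in the ambient space and then carried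
    over to the kernel as a space of its own.\<close>
  have "ker.NC.lin_indpt (set (cols A))"
    using ker.NC.lin_depE[OF A _ dist] inj by metis
  then have li: "ker.lin_indpt (set (cols A))" using ker.lindep_same[OF sub] by simp
  have "ker.NC.span (set (cols A)) = mat_kernel K"
    using ker.NC.col_space_eq[OF A] A unfolding ker.NC.col_space_def ker by auto
  then have "ker.span (set (cols A)) = mat_kernel K" using ker.span_same[OF sub] by simp
  then have "ker.basis (set (cols A))" using li sub unfolding ker.Ker.basis_def by auto
  then show ?thesis using dist A by (simp add: cols_basis_def)
qed

lemma mult_mat_zero_vec:
  fixes A :: "real mat"
  assumes "A \<in> carrier_mat k r"
  shows "A *\<^sub>v 0\<^sub>v r = 0\<^sub>v k"
  using assms by (intro eq_vecI) auto

lemma zero_mat_mult_vec: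
  fixes x :: "real vec"
  assumes "x \<in> carrier_vec r"
  shows "0\<^sub>m k r *\<^sub>v x = 0\<^sub>v k"
  using assms by (intro eq_vecI) auto

section \<open>Block matrices and stacked vectors\<close>

lemma append_cols_carrier [simp, intro]:
  "A \<in> carrier_mat n k \<Longrightarrow> B \<in> carrier_mat n l \<Longrightarrow> A @\<^sub>c B \<in> carrier_mat n (k + l)"
  unfolding append_cols_def by auto

lemma transpose_append_cols:
  assumes "A \<in> carrier_mat n k" "B \<in> carrier_mat n l"
  shows "(A @\<^sub>c B)\<^sup>T = A\<^sup>T @\<^sub>r B\<^sup>T"
  using assms unfolding append_cols_def append_rows_def
  by (subst transpose_four_block_mat[of _ n k _ l _ 0]) auto

lemma transpose_append_rows:
  assumes "A \<in> carrier_mat k n" "B \<in> carrier_mat l n"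
  shows "(A @\<^sub>r B)\<^sup>T = A\<^sup>T @\<^sub>c B\<^sup>T"
  using assms unfolding append_cols_def append_rows_def
  by (subst transpose_four_block_mat[of _ k n _ 0 _ l]) auto

lemma append_rows_mult_append_cols:
  assumes "A \<in> carrier_mat k n" "B \<in> carrier_mat l n" "C \<in> carrier_mat n r" "D \<in> carrier_mat n s"
  shows "(A @\<^sub>r B) * (C @\<^sub>c D) = four_block_mat (A * C) (A * D) (B * C) (B * D)"
  using assms unfolding append_cols_def append_rows_def
  by (subst mult_four_block_mat[of _ k n _ 0 _ l _ _ r _ s]) auto

lemma append_rows_mult:
  fixes A :: "real mat"
  assumes "A \<in> carrier_mat k n" "B \<in> carrier_mat l n" "C \<in> carrier_mat n r"
  shows "(A @\<^sub>r B) * C = A * C @\<^sub>r B * C"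
proof (rule eq_matI)
  fix i j assume "i < dim_row (A * C @\<^sub>r B * C)" "j < dim_col (A * C @\<^sub>r B * C)"
  then have ij: "i < k + l" "j < r" using assms by (auto simp: append_rows_def)
  have "row (A @\<^sub>r B) i = (if i < k then row A i else row B (i - k))"
    using assms ij by (intro eq_vecI) (auto simp: append_rows_def)
  then show "((A @\<^sub>r B) * C) $$ (i, j) = (A * C @\<^sub>r B * C) $$ (i, j)"
    using assms ij by (auto simp: append_rows_def)
qed (use assms in \<open>auto simp: append_rows_def\<close>)

lemma append_cols_mult_vec:
  fixes A :: "real mat"
  assumes "A \<in> carrier_mat n k" "B \<in> carrier_mat n l" "x \<in> carrier_vec k" "y \<in> carrier_vec l"
  shows "(A @\<^sub>c B) *\<^sub>v (x @\<^sub>v y) = A *\<^sub>v x + B *\<^sub>v y"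
proof (rule eq_vecI)
  fix i assume "i < dim_vec (A *\<^sub>v x + B *\<^sub>v y)"
  then have i: "i < n" using assms by simp
  have "row (A @\<^sub>c B) i = row A i @\<^sub>v row B i"
    using assms i by (intro eq_vecI) (auto simp: append_cols_def)
  moreover have "(row A i @\<^sub>v row B i) \<bullet> (x @\<^sub>v y) = row A i \<bullet> x + row B i \<bullet> y"
    by (rule scalar_prod_append[of _ k _ l]) (use assms i in auto)
  moreover have "i < dim_row (A @\<^sub>c B)" using i assms by (simp add: append_cols_def)
  ultimately show "((A @\<^sub>c B) *\<^sub>v (x @\<^sub>v y)) $ i = (A *\<^sub>v x + B *\<^sub>v y) $ i"
    using assms i by simp
qed (use assms in \<open>simp add: append_cols_def\<close>)

lemma minv_block_diag:
  assumes A: "A \<in> carrier_mat k k" "A' \<in> carrier_mat k k" "A * A' = 1\<^sub>m k"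
    and B: "B \<in> carrier_mat l l" "B' \<in> carrier_mat l l" "B * B' = 1\<^sub>m l"
  shows "minv (four_block_mat A (0\<^sub>m k l) (0\<^sub>m l k) B) = four_block_mat A' (0\<^sub>m k l) (0\<^sub>m l k) B'"
proof (rule minv_eqI[of _ "k + l"])
  show "four_block_mat A (0\<^sub>m k l) (0\<^sub>m l k) B * four_block_mat A' (0\<^sub>m k l) (0\<^sub>m l k) B' = 1\<^sub>m (k + l)"
    using A B by (subst mult_four_block_mat[of _ k k _ l _ l _ _ k _ l]) auto
qed (use A B in auto)

lemma mult_vec_assoc_eq:
  fixes A B C :: "real mat"
  assumes "A \<in> carrier_mat k l" "B \<in> carrier_mat l r" "x \<in> carrier_vec r" "A * B = C"
  shows "A *\<^sub>v (B *\<^sub>v x) = C *\<^sub>v x"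
  using assoc_mult_mat_vec[OF assms(1-3)] assms(4) by simp

lemma append_cols3_mult_vec:
  fixes A :: "real mat"
  assumes "A \<in> carrier_mat r k" "B \<in> carrier_mat r l" "C \<in> carrier_mat r j"
    and "x \<in> carrier_vec k" "y \<in> carrier_vec l" "z \<in> carrier_vec j"
  shows "(A @\<^sub>c B @\<^sub>c C) *\<^sub>v (x @\<^sub>v y @\<^sub>v z) = A *\<^sub>v x + (B *\<^sub>v y + C *\<^sub>v z)"
  using append_cols_mult_vec[of A r k "B @\<^sub>c C" "l + j" x "y @\<^sub>v z"] append_cols_mult_vec[of B r l C j y z] assms
  by simp

text \<open>Both diagonal gyroscopic blocks have the shape \<open>C - C^T\<close>, with
  \<open>C = A_t Js\<close> for \<open>G11\<close> and \<open>C = A_n Z^T\<close> for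
  \<open>G22\<close>.\<close>

lemma skew_symmetric_diff:
  fixes A :: "real mat"
  assumes "A \<in> carrier_mat k l" "B \<in> carrier_mat l k"
  shows "A * B - B\<^sup>T * A\<^sup>T = - (A * B - B\<^sup>T * A\<^sup>T)\<^sup>T"
proof -
  have AB: "A * B \<in> carrier_mat k k" using assms by (rule mult_carrier_mat)
  have tr: "(A * B)\<^sup>T = B\<^sup>T * A\<^sup>T" by (rule transpose_mult[OF assms])
  have "C - C\<^sup>T = - (C - C\<^sup>T)\<^sup>T" if "C \<in> carrier_mat k k" for C :: "real mat"
    using that by (intro eq_matI) auto
  from this[OF AB] show ?thesis unfolding tr .
qed

text \<open>Cancellation pattern of the task row: \<open>u\<close> is \<open>Js^T\<close> applied to
  the position gradient of \<open>Hbar\<close>, \<open>a\<close> and \<open>a'\<close> are the two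
  parts of \<open>A_t q'\<close>, \<open>b\<close> and \<open>b'\<close> are \<open>Js^T\<close>
  applied to the two terms by which the position gradients of \<open>Ham\<close> and
  \<open>Hbar\<close> differ, and \<open>s\<close> is the input.\<close>

lemma gyroscopic_sum_task:
  fixes u :: "real vec"
  assumes "u \<in> carrier_vec k" "a \<in> carrier_vec k" "a' \<in> carrier_vec k" "b \<in> carrier_vec k"
    "b' \<in> carrier_vec k" "s \<in> carrier_vec k"
  shows "- u + ((a - b) + (a' - b')) + s = (a + a') + (- (u + (b + b')) + s)"
  using assms by (intro eq_vecI) auto

text \<open>The null-space row differs from the task row in the term \<open>- (b - a)\<close>,
  because \<open>G12\<close> enters it transposed and negated.\<close>

lemma gyroscopic_sum_null:
  fixes u :: "real vec"
  assumes "u \<in> carrier_vec k" "a \<in> carrier_vec k" "a' \<in> carrier_vec k" "b \<in> carrier_vec k"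
    "b' \<in> carrier_vec k" "s \<in> carrier_vec k"
  shows "- u + (- (b - a) + (a' - b')) + s = (a + a') + (- (u + (b + b')) + s)"
  using assms by (intro eq_vecI) auto

lemma mult_mat_vec_residual:
  fixes A :: "real mat"
  assumes A: "A \<in> carrier_mat k n" and u: "u \<in> carrier_vec n" and f: "f \<in> carrier_vec n"
  shows "A *\<^sub>v (- u + f) = - (A *\<^sub>v u) + A *\<^sub>v f"
proof -
  have "A *\<^sub>v (- u) = - (A *\<^sub>v u)" using A u by (intro eq_vecI) auto
  then show ?thesis
    using mult_add_distrib_mat_vec[OF A _ f, of "- u"] u by simp
qed

lemma add_vec_left_cancel:
  fixes a b c :: "real vec"
  assumes "a \<in> carrier_vec k" "b \<in> carrier_vec k" "c \<in> carrier_vec k" "a + b = a + c"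
  shows "b = c"
proof (rule eq_vecI)
  fix i assume "i < dim_vec c"
  then have i: "i < k" using assms(3) by simp
  have "(a + b) $ i = (a + c) $ i" using assms(4) by simp
  then show "b $ i = c $ i" using i assms(1-3) by simp
qed (use assms in simp)

section \<open>Differentiation along curves\<close>

text \<open>
  The derivative of \<open>f\<close> at \<open>x\<close> is encoded by its action on curves through \<open>x\<close>: this is the only form
  in which it is needed, it inherits the algebraic rules from those for functions of one real variable,
  and it applies to subsets of \<^term>\<open>carrier_vec n\<close>, which is not a type.
\<close>

definition has_curve_grad ::
    "nat \<Rightarrow> real vec set \<Rightarrow> (real vec \<Rightarrow> real) \<Rightarrow> (nat \<Rightarrow> real) \<Rightarrow> real vec \<Rightarrow> bool" where
  "has_curve_grad n U f g x \<longleftrightarrow> (\<forall>c c' t. c t = x \<longrightarrow> has_vec_deriv c c' t \<longrightarrow>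
     (\<forall>\<^sub>F s in nhds t. c s \<in> U) \<longrightarrow>
     ((\<lambda>s. f (c s)) has_real_derivative (\<Sum>i<n. g i * c' $ i)) (at t))"

definition curve_diff :: "nat \<Rightarrow> real vec set \<Rightarrow> (real vec \<Rightarrow> real) \<Rightarrow> real vec \<Rightarrow> bool" where
  "curve_diff n U f x \<longleftrightarrow> (\<exists>g. has_curve_grad n U f g x)"

lemma has_curve_gradD:
  assumes "has_curve_grad n U f g (c t)" "has_vec_deriv c c' t" "\<forall>\<^sub>F s in nhds t. c s \<in> U"
  shows "((\<lambda>s. f (c s)) has_real_derivative (\<Sum>i<n. g i * c' $ i)) (at t)"
  using assms unfolding has_curve_grad_def by blast

text \<open>Test curves stay in \<open>U\<close> near the base time, so only values on
  \<open>U\<close> count. This permits replacing a matrix entry by an algebraic formula that is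
  valid only where the dimensions are known, namely on \<open>U\<close>.\<close>

lemma curve_diff_cong:
  assumes "\<And>y. y \<in> U \<Longrightarrow> f y = f' y"
  shows "curve_diff n U f x \<longleftrightarrow> curve_diff n U f' x"
proof -
  have "has_curve_grad n U f g x \<longleftrightarrow> has_curve_grad n U f' g x" for g
    unfolding has_curve_grad_def
  proof (intro iff_allI imp_cong refl)
    fix c c' and t :: real assume ev: "\<forall>\<^sub>F s in nhds t. c s \<in> U"
    show "((\<lambda>s. f (c s)) has_real_derivative (\<Sum>i<n. g i * c' $ i)) (at t) \<longleftrightarrow>
        ((\<lambda>s. f' (c s)) has_real_derivative (\<Sum>i<n. g i * c' $ i)) (at t)"
      by (intro DERIV_cong_ev refl eventually_mono[OF ev] assms)
  qed
  then show ?thesis by (simp add: curve_diff_def)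
qed

lemma curve_diff_const: "curve_diff n U (\<lambda>_. a) x"
proof -
  have "has_curve_grad n U (\<lambda>_. a) (\<lambda>_. 0) x" by (simp add: has_curve_grad_def)
  then show ?thesis unfolding curve_diff_def by blast
qed

lemma curve_diff_add:
  assumes "curve_diff n U f x" "curve_diff n U h x"
  shows "curve_diff n U (\<lambda>y. f y + h y) x"
proof -
  obtain a b where ab: "has_curve_grad n U f a x" "has_curve_grad n U h b x"
    using assms unfolding curve_diff_def by blast
  have "has_curve_grad n U (\<lambda>y. f y + h y) (\<lambda>i. a i + b i) x"
    unfolding has_curve_grad_def distrib_right sum.distrib
    by (intro allI impI DERIV_add has_curve_gradD) (use ab in simp_all)
  then show ?thesis unfolding curve_diff_def by blast
qed

lemma curve_diff_mult:
  assumes "curve_diff n U f x" "curve_diff n U h x"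
  shows "curve_diff n U (\<lambda>y. f y * h y) x"
proof -
  obtain a b where ab: "has_curve_grad n U f a x" "has_curve_grad n U h b x"
    using assms unfolding curve_diff_def by blast
  have "has_curve_grad n U (\<lambda>y. f y * h y) (\<lambda>i. a i * h x + b i * f x) x"
    unfolding has_curve_grad_def
  proof (intro allI impI)
    fix c c' t assume *: "c t = x" "has_vec_deriv c c' t" "\<forall>\<^sub>F s in nhds t. c s \<in> U"
    have "((\<lambda>s. f (c s) * h (c s)) has_real_derivative
        (\<Sum>i<n. a i * c' $ i) * h (c t) + (\<Sum>i<n. b i * c' $ i) * f (c t)) (at t)"
      using ab * by (intro DERIV_mult has_curve_gradD) auto
    moreover have "(\<Sum>i<n. a i * c' $ i) * h (c t) + (\<Sum>i<n. b i * c' $ i) * f (c t) =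
        (\<Sum>i<n. (a i * h x + b i * f x) * c' $ i)"
      by (simp add: * sum_distrib_right sum_distrib_left sum.distrib algebra_simps)
    ultimately show "((\<lambda>s. f (c s) * h (c s)) has_real_derivative
        (\<Sum>i<n. (a i * h x + b i * f x) * c' $ i)) (at t)" by simp
  qed
  then show ?thesis unfolding curve_diff_def by blast
qed

lemma curve_diff_inverse:
  assumes "curve_diff n U f x" "f x \<noteq> 0"
  shows "curve_diff n U (\<lambda>y. inverse (f y)) x"
proof -
  obtain a where a: "has_curve_grad n U f a x"
    using assms unfolding curve_diff_def by blast
  let ?d = "- (inverse (f x) * inverse (f x))"
  have "has_curve_grad n U (\<lambda>y. inverse (f y)) (\<lambda>i. ?d * a i) x"
    unfolding has_curve_grad_def
  proof (intro allI impI)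
    fix c c' t assume *: "c t = x" "has_vec_deriv c c' t" "\<forall>\<^sub>F s in nhds t. c s \<in> U"
    have "((\<lambda>s. inverse (f (c s))) has_real_derivative
        - (inverse (f (c t)) * (\<Sum>i<n. a i * c' $ i) * inverse (f (c t)))) (at t)"
      using a * assms(2) by (intro DERIV_inverse' has_curve_gradD) auto
    moreover have "- (inverse (f (c t)) * (\<Sum>i<n. a i * c' $ i) * inverse (f (c t))) =
        (\<Sum>i<n. ?d * a i * c' $ i)"
      by (simp add: * sum_distrib_left mult_ac sum_negf)
    ultimately show "((\<lambda>s. inverse (f (c s))) has_real_derivative
        (\<Sum>i<n. ?d * a i * c' $ i)) (at t)" by simp
  qed
  then show ?thesis unfolding curve_diff_def by blast
qed

lemma curve_diff_sum:
  "(\<And>k. k \<in> K \<Longrightarrow> curve_diff n U (f k) x) \<Longrightarrow> curve_diff n U (\<lambda>y. \<Sum>k\<in>K. f k y) x"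
  by (induction K rule: infinite_finite_induct) (auto intro: curve_diff_const curve_diff_add)

lemma curve_diff_prod:
  "(\<And>k. k \<in> K \<Longrightarrow> curve_diff n U (f k) x) \<Longrightarrow> curve_diff n U (\<lambda>y. \<Prod>k\<in>K. f k y) x"
  by (induction K rule: infinite_finite_induct) (auto intro: curve_diff_const curve_diff_mult)

section \<open>From continuous partial derivatives to a chain rule\<close>

lemma open_vec_line:
  assumes U: "open_vec n U" and x: "x \<in> U" and i: "i < n"
  shows "\<forall>\<^sub>F s in nhds 0. x + s \<cdot>\<^sub>v unit_vec n i \<in> U"
proof -
  obtain e where e: "e > 0" "\<And>y. y \<in> carrier_vec n \<Longrightarrow> (\<And>j. j < n \<Longrightarrow> \<bar>y $ j - x $ j\<bar> < e) \<Longrightarrow> y \<in> U"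
    using U x unfolding open_vec_def by metis
  have xc: "x \<in> carrier_vec n" using U x unfolding open_vec_def by blast
  show ?thesis
    unfolding eventually_nhds_metric
  proof (intro exI[of _ e] conjI allI impI e)
    fix s :: real assume "dist s 0 < e"
    then have "\<bar>s\<bar> < e" by simp
    then show "\<bar>(x + s \<cdot>\<^sub>v unit_vec n i) $ j - x $ j\<bar> < e" if "j < n" for j
      using xc that i e(1) by auto
  qed (use xc in auto)
qed

lemma has_vec_deriv_line:
  assumes "x \<in> carrier_vec n" "i < n"
  shows "has_vec_deriv (\<lambda>s. x + s \<cdot>\<^sub>v unit_vec n i) (unit_vec n i) 0"
  using assms by (auto simp: has_vec_deriv_def intro!: derivative_eq_intros)

lemma has_curve_grad_line:
  assumes U: "open_vec n U" and x: "x \<in> U" and i: "i < n" and g: "has_curve_grad n U f g x"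
  shows "((\<lambda>s. f (x + s \<cdot>\<^sub>v unit_vec n i)) has_real_derivative g i) (at 0)"
proof -
  have xc: "x \<in> carrier_vec n" using U x unfolding open_vec_def by blast
  then have x0: "x + 0 \<cdot>\<^sub>v unit_vec n i = x" by auto
  have "(\<Sum>j<n. g j * unit_vec n i $ j) = (\<Sum>j<n. if j = i then g i else 0)"
    using i by (intro sum.cong) auto
  also have "\<dots> = g i" using i by simp
  finally have "(\<Sum>j<n. g j * unit_vec n i $ j) = g i" .
  with has_curve_gradD[of n U f g "\<lambda>s. x + s \<cdot>\<^sub>v unit_vec n i" 0 "unit_vec n i"] show ?thesis
    using g has_vec_deriv_line[OF xc i] open_vec_line[OF U x i] x0 by simp
qed

text \<open>Coordinate lines are among the test curves, so the coefficients of any curve gradient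
  are forced to be the partial derivatives.\<close>

lemma curve_diff_partial:
  assumes U: "open_vec n U" and x: "x \<in> U" and f: "curve_diff n U f x"
  shows "has_curve_grad n U f (\<lambda>i. partial_deriv i f x) x"
proof -
  obtain g where g: "has_curve_grad n U f g x"
    using f unfolding curve_diff_def by blast
  have "dim_vec x = n" using U x unfolding open_vec_def by auto
  then have "partial_deriv i f x = g i" if "i < n" for i
    using DERIV_imp_deriv[OF has_curve_grad_line[OF U x that g]] by (simp add: partial_deriv_def)
  then have "(\<Sum>i<n. partial_deriv i f x * c' $ i) = (\<Sum>i<n. g i * c' $ i)" for c' :: "real vec"
    by (intro sum.cong) auto
  then show ?thesis using g unfolding has_curve_grad_def by (simp only:)
qed

text \<open>The conditions \<open>\<bar>r\<bar> \<le> \<bar>d\<bar>\<close> and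
  \<open>r * d \<ge> 0\<close> place \<open>r\<close> on the closed segment between 0 and
  \<open>d\<close> for either sign of \<open>d\<close>, so one statement covers steps in both
  directions.\<close>

lemma partial_mean_value:
  fixes d :: real
  assumes w: "w \<in> carrier_vec n"
    and diff: "\<And>y. y \<in> U \<Longrightarrow> (\<lambda>s. f (y + s \<cdot>\<^sub>v unit_vec n k)) differentiable (at 0)"
    and seg: "\<And>r. \<bar>r\<bar> \<le> \<bar>d\<bar> \<Longrightarrow> r * d \<ge> 0 \<Longrightarrow> w + r \<cdot>\<^sub>v unit_vec n k \<in> U"
  shows "\<exists>r. \<bar>r\<bar> \<le> \<bar>d\<bar> \<and> r * d \<ge> 0 \<and>
    f (w + d \<cdot>\<^sub>v unit_vec n k) - f w = partial_deriv k f (w + r \<cdot>\<^sub>v unit_vec n k) * d"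
proof -
  define \<phi> where "\<phi> h = f (w + h \<cdot>\<^sub>v unit_vec n k)" for h
  define \<phi>' where "\<phi>' h = partial_deriv k f (w + h \<cdot>\<^sub>v unit_vec n k)" for h
  have der: "(\<phi> has_real_derivative \<phi>' h) (at h)" if h: "\<bar>h\<bar> \<le> \<bar>d\<bar>" "h * d \<ge> 0" for h
  proof -
    have "(\<lambda>s. f (w + h \<cdot>\<^sub>v unit_vec n k + s \<cdot>\<^sub>v unit_vec n k)) differentiable (at 0)"
      by (rule diff[OF seg[OF h]])
    then have "((\<lambda>s. f (w + h \<cdot>\<^sub>v unit_vec n k + s \<cdot>\<^sub>v unit_vec n k)) has_real_derivative \<phi>' h) (at 0)"
      using w by (simp add: \<phi>'_def partial_deriv_def DERIV_deriv_iff_real_differentiable)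
    \<comment> \<open>\<open>partial_deriv\<close> differentiates at parameter 0 of a line based at
      the point itself; this translation turns it into the derivative of \<open>\<phi>\<close> at
      \<open>h\<close>.\<close>
    moreover have "w + h \<cdot>\<^sub>v unit_vec n k + s \<cdot>\<^sub>v unit_vec n k = w + (h + s) \<cdot>\<^sub>v unit_vec n k" for s
      using w by (intro eq_vecI) (auto simp: algebra_simps)
    ultimately have "((\<lambda>s. \<phi> (h + s)) has_real_derivative \<phi>' h) (at 0)"
      by (simp add: \<phi>_def)
    then show ?thesis using DERIV_at_within_shift[of \<phi> "\<phi>' h" h 0 UNIV] by simp
  qed
  have "w + 0 \<cdot>\<^sub>v unit_vec n k = w" using w by auto
  then have w0: "\<phi> 0 = f w" by (simp add: \<phi>_def)
  consider "d > 0" | "d = 0" | "d < 0" by linarith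
  then have "\<exists>r. \<bar>r\<bar> \<le> \<bar>d\<bar> \<and> r * d \<ge> 0 \<and> \<phi> d - \<phi> 0 = \<phi>' r * d"
  proof cases
    case 1
    have "\<exists>z>0. z < d \<and> \<phi> d - \<phi> 0 = (d - 0) * \<phi>' z"
      using 1 by (intro MVT2 der) auto
    then obtain z where "0 < z" "z < d" "\<phi> d - \<phi> 0 = (d - 0) * \<phi>' z" by blast
    then show ?thesis using 1 by (intro exI[of _ z]) auto
  next
    case 2
    then show ?thesis by (intro exI[of _ 0]) auto
  next
    case 3
    have "\<exists>z>d. z < 0 \<and> \<phi> 0 - \<phi> d = (0 - d) * \<phi>' z"
      using 3 by (intro MVT2 der) (auto simp: mult_nonpos_nonpos)
    then obtain z where "z > d" "z < 0" "\<phi> 0 - \<phi> d = (0 - d) * \<phi>' z" by blast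
    then show ?thesis using 3 by (intro exI[of _ z]) (auto simp: mult_nonpos_nonpos algebra_simps)
  qed
  then show ?thesis using w0 by (simp add: \<phi>_def \<phi>'_def)
qed

text \<open>Moving from \<open>x\<close> to \<open>y\<close> one coordinate at a time, with the mean value theorem on each edge.\<close>

lemma partial_telescope:
  assumes x: "x \<in> carrier_vec n" and y: "y \<in> carrier_vec n"
    and box: "\<And>z. z \<in> carrier_vec n \<Longrightarrow> (\<And>i. i < n \<Longrightarrow> \<bar>z $ i - x $ i\<bar> \<le> \<bar>y $ i - x $ i\<bar>) \<Longrightarrow> z \<in> U"
    and diff: "\<And>k z. k < n \<Longrightarrow> z \<in> U \<Longrightarrow> (\<lambda>s. f (z + s \<cdot>\<^sub>v unit_vec n k)) differentiable (at 0)"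
  shows "\<exists>\<xi>. (\<forall>k<n. \<xi> k \<in> U \<and> (\<forall>i<n. \<bar>\<xi> k $ i - x $ i\<bar> \<le> \<bar>y $ i - x $ i\<bar>)) \<and>
    f y - f x = (\<Sum>k<n. partial_deriv k f (\<xi> k) * (y $ k - x $ k))"
proof -
  define w where "w k = vec n (\<lambda>i. if i < k then y $ i else x $ i)" for k
  have w0: "w 0 = x" and wn: "w n = y" using x y by (auto simp: w_def)
  have "\<exists>z. z \<in> U \<and> (\<forall>i<n. \<bar>z $ i - x $ i\<bar> \<le> \<bar>y $ i - x $ i\<bar>) \<and>
      f (w (Suc k)) - f (w k) = partial_deriv k f z * (y $ k - x $ k)" if k: "k < n" for k
  proof -
    let ?d = "y $ k - x $ k"
    \<comment> \<open>Coordinate \<open>k\<close> of \<open>w k\<close> still equals that of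
      \<open>x\<close>, so the step changes it by exactly \<open>r\<close>; every other coordinate
      agrees with \<open>x\<close> or with \<open>y\<close>. Thus the edge stays in the box.\<close>
    have near: "\<bar>(w k + r \<cdot>\<^sub>v unit_vec n k) $ i - x $ i\<bar> \<le> \<bar>y $ i - x $ i\<bar>"
      if "\<bar>r\<bar> \<le> \<bar>?d\<bar>" "i < n" for r i
      using that k by (auto simp: w_def)
    have step: "w k + ?d \<cdot>\<^sub>v unit_vec n k = w (Suc k)"
      using k by (intro eq_vecI) (auto simp: w_def less_Suc_eq)
    have "\<exists>r. \<bar>r\<bar> \<le> \<bar>?d\<bar> \<and> r * ?d \<ge> 0 \<and>
        f (w k + ?d \<cdot>\<^sub>v unit_vec n k) - f (w k) = partial_deriv k f (w k + r \<cdot>\<^sub>v unit_vec n k) * ?d"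
      by (rule partial_mean_value[where U = U]) (use k diff box near in \<open>auto simp: w_def\<close>)
    then obtain r where r: "\<bar>r\<bar> \<le> \<bar>?d\<bar>"
        "f (w (Suc k)) - f (w k) = partial_deriv k f (w k + r \<cdot>\<^sub>v unit_vec n k) * ?d"
      using step by auto
    then show ?thesis
      by (intro exI[of _ "w k + r \<cdot>\<^sub>v unit_vec n k"]) (use near box in \<open>auto simp: w_def\<close>)
  qed
  then obtain \<xi> where \<xi>: "\<And>k. k < n \<Longrightarrow> \<xi> k \<in> U \<and> (\<forall>i<n. \<bar>\<xi> k $ i - x $ i\<bar> \<le> \<bar>y $ i - x $ i\<bar>) \<and>
      f (w (Suc k)) - f (w k) = partial_deriv k f (\<xi> k) * (y $ k - x $ k)"
    by metis
  have "f y - f x = (\<Sum>k<n. f (w (Suc k)) - f (w k))"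
    using sum_lessThan_telescope[of "\<lambda>k. f (w k)" n] w0 wn by simp
  also have "\<dots> = (\<Sum>k<n. partial_deriv k f (\<xi> k) * (y $ k - x $ k))"
    using \<xi> by (intro sum.cong) auto
  finally show ?thesis using \<xi> by blast
qed

text \<open>By telescoping, the difference quotient of \<open>f\<close> along the curve is a sum of
  partial derivatives at intermediate points times difference quotients of the coordinates. The
  intermediate points are squeezed towards \<open>x\<close> by the curve, so continuity of the
  partial derivatives gives the limit.\<close>

lemma C1_curve_diff:
  assumes U: "open_vec n U" and x: "x \<in> U" and f: "C_k 1 n U f"
  shows "curve_diff n U f x"
proof -
  have sub: "U \<subseteq> carrier_vec n" using U unfolding open_vec_def by blast
  obtain e where e: "e > 0" "\<And>y. y \<in> carrier_vec n \<Longrightarrow> (\<And>j. j < n \<Longrightarrow> \<bar>y $ j - x $ j\<bar> < e) \<Longrightarrow> y \<in> U"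
    using U x unfolding open_vec_def by metis
  have diff: "\<And>k z. k < n \<Longrightarrow> z \<in> U \<Longrightarrow> (\<lambda>s. f (z + s \<cdot>\<^sub>v unit_vec n k)) differentiable (at 0)"
    and cont: "\<And>k. k < n \<Longrightarrow> continuous_on_vec n U (partial_deriv k f)"
    using f by auto
  have "has_curve_grad n U f (\<lambda>i. partial_deriv i f x) x"
    unfolding has_curve_grad_def
  proof (intro allI impI)
    fix c c' and t :: real
    assume c: "c t = x" "has_vec_deriv c c' t" "\<forall>\<^sub>F s in nhds t. c s \<in> U"
    have dc: "((\<lambda>s. c s $ i) has_real_derivative c' $ i) (at t)" if "i < n" for i
      using c(1,2) that sub x by (auto simp: has_vec_deriv_def)
    have near: "\<forall>\<^sub>F s in at t. \<forall>i\<in>{..<n}. \<bar>c s $ i - x $ i\<bar> < d" if "d > 0" for d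
    proof (intro eventually_ball_finite ballI)
      fix i assume "i \<in> {..<n}"
      then have "((\<lambda>s. c s $ i) \<longlongrightarrow> x $ i) (at t)"
        using DERIV_isCont[OF dc[of i]] c(1) by (auto simp: isCont_def)
      from tendstoD[OF this \<open>d > 0\<close>] show "\<forall>\<^sub>F s in at t. \<bar>c s $ i - x $ i\<bar> < d"
        by (simp add: dist_real_def)
    qed auto
    have cU: "\<forall>\<^sub>F s in at t. c s \<in> U" using c(3) by (simp add: eventually_nhds_conv_at)
    define P where "P s \<xi> \<longleftrightarrow> (\<forall>k<n. \<xi> k \<in> U \<and> (\<forall>i<n. \<bar>\<xi> k $ i - x $ i\<bar> \<le> \<bar>c s $ i - x $ i\<bar>)) \<and>
      f (c s) - f x = (\<Sum>k<n. partial_deriv k f (\<xi> k) * (c s $ k - x $ k))" for s \<xi>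
    \<comment> \<open>The choice is meaningful for \<open>s\<close> near \<open>t\<close>: there the
      box spanned by \<open>x\<close> and \<open>c s\<close> lies inside \<open>U\<close>, and
      intermediate points exist.\<close>
    define \<xi> where "\<xi> s = (SOME \<xi>. P s \<xi>)" for s
    have ev: "\<forall>\<^sub>F s in at t. P s (\<xi> s)"
      using near[OF e(1)] cU
    proof eventually_elim
      case (elim s)
      have "\<exists>\<xi>. P s \<xi>"
        unfolding P_def
      proof (rule partial_telescope[where U = U, OF _ _ _ diff])
        show "z \<in> U" if "z \<in> carrier_vec n" "\<And>i. i < n \<Longrightarrow> \<bar>z $ i - x $ i\<bar> \<le> \<bar>c s $ i - x $ i\<bar>" for z
          using that elim(1) by (intro e(2)) (auto intro: le_less_trans)
      qed (use x sub elim in auto)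
      then show ?case unfolding \<xi>_def by (rule someI_ex)
    qed
    have lim: "((\<lambda>s. partial_deriv k f (\<xi> s k)) \<longlongrightarrow> partial_deriv k f x) (at t)" if k: "k < n" for k
    proof (rule tendstoI)
      fix \<epsilon> :: real assume "\<epsilon> > 0"
      then obtain d where d: "d > 0"
        "\<And>y. y \<in> U \<Longrightarrow> (\<And>i. i < n \<Longrightarrow> \<bar>y $ i - x $ i\<bar> < d) \<Longrightarrow> \<bar>partial_deriv k f y - partial_deriv k f x\<bar> < \<epsilon>"
        using cont[OF k] x unfolding continuous_on_vec_def by metis
      show "\<forall>\<^sub>F s in at t. dist (partial_deriv k f (\<xi> s k)) (partial_deriv k f x) < \<epsilon>"
        using near[OF d(1)] ev
      proof eventually_elim
        case (elim s)
        then show ?case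
          using k unfolding P_def dist_real_def by (intro d(2)) (auto intro: le_less_trans)
      qed
    qed
    have "((\<lambda>s. \<Sum>k<n. partial_deriv k f (\<xi> s k) * ((c s $ k - c t $ k) / (s - t)))
        \<longlongrightarrow> (\<Sum>k<n. partial_deriv k f x * c' $ k)) (at t)"
      using dc by (intro tendsto_sum tendsto_mult lim) (auto simp: has_field_derivative_iff)
    moreover have "\<forall>\<^sub>F s in at t. (\<Sum>k<n. partial_deriv k f (\<xi> s k) * ((c s $ k - c t $ k) / (s - t))) =
        (f (c s) - f (c t)) / (s - t)"
      using ev by eventually_elim (simp add: P_def c(1) sum_divide_distrib)
    ultimately show "((\<lambda>s. f (c s)) has_real_derivative (\<Sum>k<n. partial_deriv k f x * c' $ k)) (at t)"
      unfolding has_field_derivative_iff by (rule Lim_transform_eventually)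
  qed
  then show ?thesis unfolding curve_diff_def by blast
qed

lemma smooth_vec_curve_diff:
  assumes "open_vec n U" "x \<in> U" "smooth_vec n U f"
  shows "curve_diff n U f x"
  using C1_curve_diff[OF assms(1,2)] assms(3) unfolding smooth_vec_def by blast

section \<open>Differentiability of matrix-valued functions\<close>

definition curve_diff_mat ::
    "nat \<Rightarrow> nat \<Rightarrow> nat \<Rightarrow> real vec set \<Rightarrow> (real vec \<Rightarrow> real mat) \<Rightarrow> real vec \<Rightarrow> bool" where
  "curve_diff_mat k r n U A x \<longleftrightarrow> (\<forall>y\<in>U. A y \<in> carrier_mat k r) \<and>
     (\<forall>i<k. \<forall>j<r. curve_diff n U (\<lambda>y. A y $$ (i, j)) x)"

lemma smooth_mat_curve_diff:
  assumes "open_vec n U" "x \<in> U" "smooth_mat k r n U A"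
  shows "curve_diff_mat k r n U A x"
  using assms smooth_vec_curve_diff unfolding smooth_mat_def curve_diff_mat_def by blast

lemma curve_diff_mat_transpose:
  assumes "curve_diff_mat k r n U A x"
  shows "curve_diff_mat r k n U (\<lambda>y. (A y)\<^sup>T) x"
  unfolding curve_diff_mat_def
proof (intro conjI allI impI ballI)
  fix i j assume ij: "i < r" "j < k"
  have "curve_diff n U (\<lambda>y. A y $$ (j, i)) x" using assms ij by (simp add: curve_diff_mat_def)
  then show "curve_diff n U (\<lambda>y. (A y)\<^sup>T $$ (i, j)) x"
    by (rule curve_diff_cong[THEN iffD1, rotated]) (use assms ij in \<open>auto simp: curve_diff_mat_def\<close>)
qed (use assms in \<open>auto simp: curve_diff_mat_def\<close>)

lemma curve_diff_mat_mult:
  assumes A: "curve_diff_mat k l n U A x" and B: "curve_diff_mat l r n U B x"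
  shows "curve_diff_mat k r n U (\<lambda>y. A y * B y) x"
  unfolding curve_diff_mat_def
proof (intro conjI allI impI ballI)
  fix i j assume ij: "i < k" "j < r"
  have "curve_diff n U (\<lambda>y. \<Sum>h<l. A y $$ (i, h) * B y $$ (h, j)) x"
    using A B ij by (intro curve_diff_sum curve_diff_mult) (auto simp: curve_diff_mat_def)
  then show "curve_diff n U (\<lambda>y. (A y * B y) $$ (i, j)) x"
  proof (rule curve_diff_cong[THEN iffD1, rotated])
    fix y assume "y \<in> U"
    then have "A y \<in> carrier_mat k l" "B y \<in> carrier_mat l r"
      using A B by (auto simp: curve_diff_mat_def)
    then show "(\<Sum>h<l. A y $$ (i, h) * B y $$ (h, j)) = (A y * B y) $$ (i, j)"
      using ij by (simp add: scalar_prod_def atLeast0LessThan)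
  qed
qed (use A B in \<open>auto simp: curve_diff_mat_def\<close>)

text \<open>The Leibniz formula is a polynomial in the entries.\<close>

lemma curve_diff_det:
  assumes "curve_diff_mat k k n U A x"
  shows "curve_diff n U (\<lambda>y. det (A y)) x"
proof -
  have entry: "curve_diff n U (\<lambda>y. A y $$ (i, p i)) x" if "p permutes {0..<k}" "i \<in> {0..<k}" for p i
    using assms that permutes_in_image[OF that(1), of i] by (simp add: curve_diff_mat_def)
  have "curve_diff n U (\<lambda>y. signof p * (\<Prod>i = 0..<k. A y $$ (i, p i))) x" if "p permutes {0..<k}" for p
    by (intro curve_diff_mult curve_diff_const curve_diff_prod entry that)
  then have "curve_diff n U (\<lambda>y. \<Sum>p | p permutes {0..<k}. signof p * (\<Prod>i = 0..<k. A y $$ (i, p i))) x"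
    by (intro curve_diff_sum) simp
  moreover have "(\<Sum>p | p permutes {0..<k}. signof p * (\<Prod>i = 0..<k. A y $$ (i, p i))) = det (A y)"
    if "y \<in> U" for y
    using det_def'[of "A y" k] assms that by (simp add: curve_diff_mat_def)
  ultimately show ?thesis
    by (simp only: curve_diff_cong[of U "\<lambda>y. \<Sum>p | p permutes {0..<k}. signof p * (\<Prod>i = 0..<k. A y $$ (i, p i))"
        "\<lambda>y. det (A y)" n x])
qed

text \<open>\<open>minv\<close> comes from an elimination algorithm, whose case distinctions are
  unsuited to calculus. Cramer's rule replaces it by quotients of determinants with a denominator
  that does not vanish on \<open>U\<close>.\<close>

lemma curve_diff_mat_minv:
  assumes A: "curve_diff_mat k k n U A x" and x: "x \<in> U"
    and inv: "\<And>y. y \<in> U \<Longrightarrow> minv (A y) \<in> carrier_mat k k \<and> A y * minv (A y) = 1\<^sub>m k"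
  shows "curve_diff_mat k k n U (\<lambda>y. minv (A y)) x"
  unfolding curve_diff_mat_def
proof (intro conjI allI impI ballI)
  have Ac: "A y \<in> carrier_mat k k" if "y \<in> U" for y using A that by (simp add: curve_diff_mat_def)
  have det: "det (A y) \<noteq> 0" if "y \<in> U" for y
  proof
    assume "det (A y) = 0"
    then have "det (1\<^sub>m k) = (0 :: real)" using det_mult[OF Ac[OF that], of "minv (A y)"] inv[OF that] by simp
    then show False by simp
  qed
  fix i j assume ij: "i < k" "j < k"
  \<comment> \<open>Row \<open>j\<close> and column \<open>i\<close> are deleted, in this order,
    because the adjugate is the transpose of the cofactor matrix.\<close>
  have "curve_diff_mat (k - 1) (k - 1) n U (\<lambda>y. mat_delete (A y) j i) x"
    unfolding curve_diff_mat_def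
  proof (intro conjI allI impI ballI)
    fix i' j' assume ij': "i' < k - 1" "j' < k - 1"
    \<comment> \<open>The position in \<open>A\<close> of an entry of the minor: indices from the
      deleted row or column onwards are shifted by one.\<close>
    define a b where "a = (if i' < j then i' else Suc i')" and "b = (if j' < i then j' else Suc j')"
    have ab: "a < k" "b < k" using ij' by (auto simp: a_def b_def)
    have "curve_diff n U (\<lambda>y. A y $$ (a, b)) x"
      using A ab by (simp add: curve_diff_mat_def)
    moreover have "A y $$ (a, b) = mat_delete (A y) j i $$ (i', j')" if "y \<in> U" for y
      using carrier_matD[OF Ac[OF that]] ij' by (simp add: mat_delete_def a_def b_def)
    ultimately show "curve_diff n U (\<lambda>y. mat_delete (A y) j i $$ (i', j')) x"
      by (simp only: curve_diff_cong[of U "\<lambda>y. A y $$ (a, b)" "\<lambda>y. mat_delete (A y) j i $$ (i', j')" n x])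
  qed (rule mat_delete_carrier[OF Ac])
  then have "curve_diff n U (\<lambda>y. inverse (det (A y)) * ((-1) ^ (j + i) * det (mat_delete (A y) j i))) x"
    using A x det by (intro curve_diff_mult curve_diff_const curve_diff_det curve_diff_inverse)
  then show "curve_diff n U (\<lambda>y. minv (A y) $$ (i, j)) x"
  proof (rule curve_diff_cong[THEN iffD1, rotated])
    fix y assume y: "y \<in> U"
    note I = inv[OF y] and C = adj_mat[OF Ac[OF y]]
    \<comment> \<open>Inserting \<open>A * minv A\<close> on the right and using
      \<open>adj A * A = det A\<close> expresses the adjugate through \<open>minv A\<close>.\<close>
    have "adj_mat (A y) = adj_mat (A y) * (A y * minv (A y))" using I C by simp
    also have "\<dots> = (adj_mat (A y) * A y) * minv (A y)"
      using I C Ac[OF y] by (intro assoc_mult_mat[symmetric]) auto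
    also have "\<dots> = det (A y) \<cdot>\<^sub>m minv (A y)"
      using mult_smult_assoc_mat[of "1\<^sub>m k" k k "minv (A y)" k "det (A y)"]
        left_mult_one_mat[OF conjunct1[OF I]] I by (simp add: C(3))
    finally have "adj_mat (A y) $$ (i, j) = det (A y) * minv (A y) $$ (i, j)"
      using carrier_matD[OF conjunct1[OF I]] ij by simp
    moreover have "adj_mat (A y) $$ (i, j) = (-1) ^ (j + i) * det (mat_delete (A y) j i)"
      using Ac[OF y] ij by (simp add: adj_mat_def cofactor_def)
    ultimately show "inverse (det (A y)) * ((-1) ^ (j + i) * det (mat_delete (A y) j i)) =
        minv (A y) $$ (i, j)"
      using det[OF y] by (simp add: field_simps)
  qed
qed (use inv in auto)

section \<open>Derivatives of vector-valued and matrix-valued curves\<close>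

definition has_vec_deriv_on :: "nat \<Rightarrow> (real \<Rightarrow> real vec) \<Rightarrow> real vec \<Rightarrow> real \<Rightarrow> bool" where
  "has_vec_deriv_on k c c' t \<longleftrightarrow> c' \<in> carrier_vec k \<and> (\<forall>\<^sub>F s in nhds t. c s \<in> carrier_vec k) \<and>
     (\<forall>i<k. ((\<lambda>s. c s $ i) has_real_derivative c' $ i) (at t))"

definition has_mat_deriv :: "nat \<Rightarrow> nat \<Rightarrow> (real \<Rightarrow> real mat) \<Rightarrow> real mat \<Rightarrow> real \<Rightarrow> bool" where
  "has_mat_deriv k r A A' t \<longleftrightarrow> A' \<in> carrier_mat k r \<and> (\<forall>\<^sub>F s in nhds t. A s \<in> carrier_mat k r) \<and>
     (\<forall>i<k. \<forall>j<r. ((\<lambda>s. A s $$ (i, j)) has_real_derivative A' $$ (i, j)) (at t))"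

lemma DERIV_cong_eventually:
  fixes f g :: "real \<Rightarrow> real"
  assumes "\<forall>\<^sub>F s in nhds t. f s = g s"
  shows "(f has_real_derivative D) (at t) \<longleftrightarrow> (g has_real_derivative D) (at t)"
  using assms by (intro DERIV_cong_ev refl)

text \<open>\<open>has_vec_deriv\<close> inspects the dimension only at time \<open>t\<close>. The
  variant with an explicit \<open>k\<close> also keeps the curve in \<open>carrier_vec k\<close>
  near \<open>t\<close>, which is what the componentwise rules for products, sums and stacked
  vectors rely on.\<close>

lemma has_vec_deriv_on_iff:
  assumes "\<forall>\<^sub>F s in nhds t. c s \<in> carrier_vec k"
  shows "has_vec_deriv_on k c c' t \<longleftrightarrow> has_vec_deriv c c' t"
proof -
  have ct: "dim_vec (c t) = k" using eventually_nhds_x_imp_x[OF assms] by simp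
  show ?thesis
  proof (cases "dim_vec c' = k")
    case True
    then have "c' \<in> carrier_vec k" by (rule carrier_vecI)
    then show ?thesis
      unfolding has_vec_deriv_on_def has_vec_deriv_def True ct using assms by blast
  next
    case False
    then have "c' \<notin> carrier_vec k" by auto
    then show ?thesis
      unfolding has_vec_deriv_on_def has_vec_deriv_def ct using False by blast
  qed
qed

lemma has_vec_deriv_on_const:
  "a \<in> carrier_vec k \<Longrightarrow> has_vec_deriv_on k (\<lambda>_. a) (0\<^sub>v k) t"
  by (simp add: has_vec_deriv_on_def)

lemma has_vec_deriv_on_unique:
  assumes "has_vec_deriv_on k c c' t" "has_vec_deriv_on k c c'' t"
  shows "c' = c''"
proof (rule eq_vecI)
  fix i assume "i < dim_vec c''"
  then have "i < k" using assms(2) by (auto simp: has_vec_deriv_on_def)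
  then have "((\<lambda>s. c s $ i) has_real_derivative c' $ i) (at t)"
    "((\<lambda>s. c s $ i) has_real_derivative c'' $ i) (at t)"
    using assms by (simp_all add: has_vec_deriv_on_def)
  then show "c' $ i = c'' $ i" by (rule DERIV_unique)
qed (use assms in \<open>auto simp: has_vec_deriv_on_def\<close>)

lemma has_vec_deriv_on_cong:
  assumes "has_vec_deriv_on k c c' t" "\<forall>\<^sub>F s in nhds t. c s = d s"
  shows "has_vec_deriv_on k d c' t"
  unfolding has_vec_deriv_on_def
proof (intro conjI allI impI)
  show "c' \<in> carrier_vec k" using assms(1) by (simp add: has_vec_deriv_on_def)
  have "\<forall>\<^sub>F s in nhds t. c s \<in> carrier_vec k" using assms(1) by (simp add: has_vec_deriv_on_def)
  then show "\<forall>\<^sub>F s in nhds t. d s \<in> carrier_vec k" using assms(2) by eventually_elim simp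
  fix i assume "i < k"
  then have "((\<lambda>s. c s $ i) has_real_derivative c' $ i) (at t)"
    using assms(1) by (simp add: has_vec_deriv_on_def)
  moreover have "\<forall>\<^sub>F s in nhds t. c s $ i = d s $ i" using assms(2) by eventually_elim simp
  ultimately show "((\<lambda>s. d s $ i) has_real_derivative c' $ i) (at t)"
    using DERIV_cong_eventually[of "\<lambda>s. c s $ i" "\<lambda>s. d s $ i" t] by simp
qed

lemma has_vec_deriv_on_scalar_prod:
  assumes c: "has_vec_deriv_on k c c' t" and d: "has_vec_deriv_on k d d' t"
  shows "((\<lambda>s. c s \<bullet> d s) has_real_derivative c' \<bullet> d t + c t \<bullet> d') (at t)"
proof -
  have ev: "\<forall>\<^sub>F s in nhds t. (\<Sum>i<k. c s $ i * d s $ i) = c s \<bullet> d s"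
  proof -
    have "\<forall>\<^sub>F s in nhds t. d s \<in> carrier_vec k" using d by (simp add: has_vec_deriv_on_def)
    then show ?thesis by eventually_elim (simp add: scalar_prod_def atLeast0LessThan)
  qed
  have "((\<lambda>s. \<Sum>i<k. c s $ i * d s $ i) has_real_derivative
      (\<Sum>i<k. c' $ i * d t $ i + d' $ i * c t $ i)) (at t)"
    using c d by (intro DERIV_sum DERIV_mult) (auto simp: has_vec_deriv_on_def)
  moreover have "(\<Sum>i<k. c' $ i * d t $ i + d' $ i * c t $ i) = c' \<bullet> d t + c t \<bullet> d'"
  proof -
    have "d t \<in> carrier_vec k" "d' \<in> carrier_vec k"
      using d by (auto simp: has_vec_deriv_on_def dest: eventually_nhds_x_imp_x)
    then show ?thesis by (simp add: scalar_prod_def atLeast0LessThan sum.distrib mult_ac)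
  qed
  ultimately show ?thesis
    using DERIV_cong_eventually[OF ev] by simp
qed

lemma has_mat_deriv_row:
  assumes A: "has_mat_deriv k r A A' t" and i: "i < k"
  shows "has_vec_deriv_on r (\<lambda>s. row (A s) i) (row A' i) t"
  unfolding has_vec_deriv_on_def
proof (intro conjI allI impI)
  have evA: "\<forall>\<^sub>F s in nhds t. A s \<in> carrier_mat k r" using A unfolding has_mat_deriv_def by blast
  have A': "A' \<in> carrier_mat k r" using A unfolding has_mat_deriv_def by blast
  show "row A' i \<in> carrier_vec r" using A' i by simp
  show "\<forall>\<^sub>F s in nhds t. row (A s) i \<in> carrier_vec r"
    using evA by eventually_elim (use i in simp)
  fix j assume j: "j < r"
  have "((\<lambda>s. A s $$ (i, j)) has_real_derivative A' $$ (i, j)) (at t)"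
    using A i j unfolding has_mat_deriv_def by blast
  moreover have "\<forall>\<^sub>F s in nhds t. A s $$ (i, j) = row (A s) i $ j"
    using evA by eventually_elim (use i j in simp)
  ultimately have "((\<lambda>s. row (A s) i $ j) has_real_derivative A' $$ (i, j)) (at t)"
    by (rule DERIV_cong_eventually[THEN iffD1, rotated])
  then show "((\<lambda>s. row (A s) i $ j) has_real_derivative row A' i $ j) (at t)"
    using i j carrier_matD[OF A'] by simp
qed

lemma has_mat_deriv_mult_vec:
  assumes A: "has_mat_deriv k r A A' t" and c: "has_vec_deriv_on r c c' t"
  shows "has_vec_deriv_on k (\<lambda>s. A s *\<^sub>v c s) (A' *\<^sub>v c t + A t *\<^sub>v c') t"
  unfolding has_vec_deriv_on_def
proof (intro conjI allI impI)
  have evA: "\<forall>\<^sub>F s in nhds t. A s \<in> carrier_mat k r" using A unfolding has_mat_deriv_def by blast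
  have A': "A' \<in> carrier_mat k r" using A unfolding has_mat_deriv_def by blast
  note dims = carrier_matD[OF A'] carrier_matD[OF eventually_nhds_x_imp_x[OF evA]]
  show "A' *\<^sub>v c t + A t *\<^sub>v c' \<in> carrier_vec k"
    by (rule carrier_vecI) (simp add: dims)
  show "\<forall>\<^sub>F s in nhds t. A s *\<^sub>v c s \<in> carrier_vec k"
    using evA by eventually_elim (rule carrier_vecI, simp)
  fix i assume i: "i < k"
  have "((\<lambda>s. row (A s) i \<bullet> c s) has_real_derivative row A' i \<bullet> c t + row (A t) i \<bullet> c') (at t)"
    by (rule has_vec_deriv_on_scalar_prod[OF has_mat_deriv_row[OF A i] c])
  moreover have "\<forall>\<^sub>F s in nhds t. row (A s) i \<bullet> c s = (A s *\<^sub>v c s) $ i"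
    using evA by eventually_elim (use i in simp)
  ultimately have "((\<lambda>s. (A s *\<^sub>v c s) $ i) has_real_derivative
      row A' i \<bullet> c t + row (A t) i \<bullet> c') (at t)"
    by (rule DERIV_cong_eventually[THEN iffD1, rotated])
  then show "((\<lambda>s. (A s *\<^sub>v c s) $ i) has_real_derivative (A' *\<^sub>v c t + A t *\<^sub>v c') $ i) (at t)"
    using i by (simp add: dims)
qed

text \<open>An equivalence and not just an introduction rule, so that the single equation for the
  stacked state can be both taken apart and reassembled.\<close>

lemma has_vec_deriv_append_iff:
  assumes c: "\<forall>\<^sub>F s in nhds t. c s \<in> carrier_vec k" and d: "\<forall>\<^sub>F s in nhds t. d s \<in> carrier_vec l"
    and c': "c' \<in> carrier_vec k" and d': "d' \<in> carrier_vec l"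
  shows "has_vec_deriv (\<lambda>s. c s @\<^sub>v d s) (c' @\<^sub>v d') t \<longleftrightarrow> has_vec_deriv c c' t \<and> has_vec_deriv d d' t"
proof -
  have ev: "\<forall>\<^sub>F s in nhds t. c s @\<^sub>v d s \<in> carrier_vec (k + l)"
    using c d by eventually_elim auto
  have 1: "((\<lambda>s. (c s @\<^sub>v d s) $ i) has_real_derivative x) (at t) \<longleftrightarrow>
      ((\<lambda>s. c s $ i) has_real_derivative x) (at t)" if "i < k" for i x
  proof (rule DERIV_cong_eventually)
    show "\<forall>\<^sub>F s in nhds t. (c s @\<^sub>v d s) $ i = c s $ i"
      using c by eventually_elim (use that in auto)
  qed
  have 2: "((\<lambda>s. (c s @\<^sub>v d s) $ (k + i)) has_real_derivative x) (at t) \<longleftrightarrow>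
      ((\<lambda>s. d s $ i) has_real_derivative x) (at t)" if "i < l" for i x
  proof (rule DERIV_cong_eventually)
    show "\<forall>\<^sub>F s in nhds t. (c s @\<^sub>v d s) $ (k + i) = d s $ i"
      using c d by eventually_elim (use that in auto)
  qed
  have comp_append: "i < k \<Longrightarrow> (c' @\<^sub>v d') $ i = c' $ i" "i < l \<Longrightarrow> (c' @\<^sub>v d') $ (k + i) = d' $ i" for i
    using c' d' by auto
  \<comment> \<open>The index range of the stacked vector falls into the first \<open>k\<close>
    positions and the \<open>l\<close> positions shifted by \<open>k\<close>.\<close>
  have split: "(\<forall>i<k + l. P i) \<longleftrightarrow> (\<forall>i<k. P i) \<and> (\<forall>i<l. P (k + i))" for P
  proof (intro iffI allI impI)
    fix i assume P: "(\<forall>i<k. P i) \<and> (\<forall>i<l. P (k + i))" and "i < k + l"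
    then have "i < k \<or> i - k < l \<and> k + (i - k) = i" by auto
    then show "P i" using P by metis
  qed auto
  have "has_vec_deriv (\<lambda>s. c s @\<^sub>v d s) (c' @\<^sub>v d') t \<longleftrightarrow> has_vec_deriv_on (k + l) (\<lambda>s. c s @\<^sub>v d s) (c' @\<^sub>v d') t"
    using has_vec_deriv_on_iff[OF ev] by simp
  also have "\<dots> \<longleftrightarrow> has_vec_deriv_on k c c' t \<and> has_vec_deriv_on l d d' t"
    using c d ev c' d' unfolding has_vec_deriv_on_def split
    by (simp add: 1 2 comp_append del: index_append_vec)
  finally show ?thesis using has_vec_deriv_on_iff[OF c] has_vec_deriv_on_iff[OF d] by simp
qed

lemma curve_diff_mat_chain:
  assumes U: "open_vec n U" and A: "curve_diff_mat k r n U A (c t)"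
    and c: "has_vec_deriv c c' t" and ev: "\<forall>\<^sub>F s in nhds t. c s \<in> U"
  shows "has_mat_deriv k r (\<lambda>s. A (c s))
    (mat k r (\<lambda>(i, j). \<Sum>l<n. partial_deriv l (\<lambda>x. A x $$ (i, j)) (c t) * c' $ l)) t"
  unfolding has_mat_deriv_def
proof (intro conjI allI impI)
  show "\<forall>\<^sub>F s in nhds t. A (c s) \<in> carrier_mat k r"
    using ev by eventually_elim (use A in \<open>simp add: curve_diff_mat_def\<close>)
  fix i j assume ij: "i < k" "j < r"
  have "curve_diff n U (\<lambda>x. A x $$ (i, j)) (c t)" using A ij by (simp add: curve_diff_mat_def)
  from has_curve_gradD[OF curve_diff_partial[OF U eventually_nhds_x_imp_x[OF ev] this] c ev]
  show "((\<lambda>s. A (c s) $$ (i, j)) has_real_derivative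
      mat k r (\<lambda>(i, j). \<Sum>l<n. partial_deriv l (\<lambda>x. A x $$ (i, j)) (c t) * c' $ l) $$ (i, j)) (at t)"
    using ij by simp
qed simp

lemma deriv_mat_vec_mult:
  assumes x: "x \<in> carrier_vec n" and A: "A x \<in> carrier_mat k r"
    and w: "w \<in> carrier_vec r" and c': "c' \<in> carrier_vec n"
  shows "deriv_mat_vec A w x *\<^sub>v c' =
    mat k r (\<lambda>(i, j). \<Sum>l<n. partial_deriv l (\<lambda>x. A x $$ (i, j)) x * c' $ l) *\<^sub>v w"
proof (rule eq_vecI)
  fix i assume "i < dim_vec (mat k r (\<lambda>(i, j). \<Sum>l<n. partial_deriv l (\<lambda>x. A x $$ (i, j)) x * c' $ l) *\<^sub>v w)"
  then have i: "i < k" by simp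
  let ?D = "\<lambda>l j. partial_deriv l (\<lambda>x. A x $$ (i, j)) x"
  have "(deriv_mat_vec A w x *\<^sub>v c') $ i = (\<Sum>l<n. (\<Sum>j<r. ?D l j * w $ j) * c' $ l)"
    using i x A w c' by (simp add: deriv_mat_vec_def scalar_prod_def atLeast0LessThan)
  also have "\<dots> = (\<Sum>j<r. (\<Sum>l<n. ?D l j * c' $ l) * w $ j)"
    unfolding sum_distrib_right by (subst sum.swap) (simp add: mult_ac)
  also have "\<dots> = (mat k r (\<lambda>(i, j). \<Sum>l<n. partial_deriv l (\<lambda>x. A x $$ (i, j)) x * c' $ l) *\<^sub>v w) $ i"
    using i w by (simp add: scalar_prod_def atLeast0LessThan)
  finally show "(deriv_mat_vec A w x *\<^sub>v c') $ i = \<dots>" .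
qed (use A in \<open>simp add: deriv_mat_vec_def\<close>)

text \<open>The product rule for \<open>A(c) p\<close>, with the first term in the form of
  \<open>deriv_mat_vec\<close> at the current value of \<open>p\<close>. For \<open>A = Js^T\<close>
  and \<open>A = Z\<close> it yields the derivatives of the two new momenta.\<close>

lemma curve_diff_mat_mult_vec_chain:
  assumes U: "open_vec n U" and A: "curve_diff_mat k r n U A (c t)"
    and c: "has_vec_deriv c c' t" and ev: "\<forall>\<^sub>F s in nhds t. c s \<in> U"
    and p: "has_vec_deriv_on r p p' t"
  shows "has_vec_deriv_on k (\<lambda>s. A (c s) *\<^sub>v p s)
    (deriv_mat_vec A (p t) (c t) *\<^sub>v c' + A (c t) *\<^sub>v p') t"
proof -
  have ctU: "c t \<in> U" using eventually_nhds_x_imp_x[OF ev] .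
  then have ct: "c t \<in> carrier_vec n" using U unfolding open_vec_def by blast
  have c': "c' \<in> carrier_vec n"
    using c carrier_vecD[OF ct] by (intro carrier_vecI) (simp add: has_vec_deriv_def)
  have At: "A (c t) \<in> carrier_mat k r" using A ctU unfolding curve_diff_mat_def by blast
  have "\<forall>\<^sub>F s in nhds t. p s \<in> carrier_vec r" using p unfolding has_vec_deriv_on_def by blast
  then have pt: "p t \<in> carrier_vec r" by (rule eventually_nhds_x_imp_x)
  show ?thesis
    using has_mat_deriv_mult_vec[OF curve_diff_mat_chain[OF U A c ev] p]
    unfolding deriv_mat_vec_mult[of "c t" n A k r "p t" c', OF ct At pt c'] .
qed

lemma has_vec_deriv_on_add:
  assumes c: "has_vec_deriv_on k c c' t" and d: "has_vec_deriv_on k d d' t"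
  shows "has_vec_deriv_on k (\<lambda>s. c s + d s) (c' + d') t"
  unfolding has_vec_deriv_on_def
proof (intro conjI allI impI)
  have evc: "\<forall>\<^sub>F s in nhds t. c s \<in> carrier_vec k" using c unfolding has_vec_deriv_on_def by blast
  have evd: "\<forall>\<^sub>F s in nhds t. d s \<in> carrier_vec k" using d unfolding has_vec_deriv_on_def by blast
  have c': "c' \<in> carrier_vec k" and d': "d' \<in> carrier_vec k"
    using c d unfolding has_vec_deriv_on_def by blast+
  show "c' + d' \<in> carrier_vec k" by (rule add_carrier_vec[OF c' d'])
  show "\<forall>\<^sub>F s in nhds t. c s + d s \<in> carrier_vec k"
    using evc evd by eventually_elim (rule add_carrier_vec)
  fix i assume i: "i < k"
  have "((\<lambda>s. c s $ i + d s $ i) has_real_derivative c' $ i + d' $ i) (at t)"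
    using c d i unfolding has_vec_deriv_on_def by (intro DERIV_add) simp_all
  moreover have "\<forall>\<^sub>F s in nhds t. c s $ i + d s $ i = (c s + d s) $ i"
    using evd by eventually_elim (use i in simp)
  ultimately have "((\<lambda>s. (c s + d s) $ i) has_real_derivative c' $ i + d' $ i) (at t)"
    by (rule DERIV_cong_eventually[THEN iffD1, rotated])
  then show "((\<lambda>s. (c s + d s) $ i) has_real_derivative (c' + d') $ i) (at t)"
    using i carrier_vecD[OF d'] by simp
qed

lemma has_vec_deriv_on_line:
  "x \<in> carrier_vec k \<Longrightarrow> i < k \<Longrightarrow> has_vec_deriv_on k (\<lambda>s. x + s \<cdot>\<^sub>v unit_vec k i) (unit_vec k i) 0"
  by (subst has_vec_deriv_on_iff) (auto intro!: has_vec_deriv_line)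

lemma has_mat_deriv_const:
  "A \<in> carrier_mat k r \<Longrightarrow> has_mat_deriv k r (\<lambda>_. A) (0\<^sub>m k r) t"
  by (simp add: has_mat_deriv_def)

text \<open>Symmetry makes the two terms in which \<open>c\<close> is differentiated equal, and the
  factor 1/2 absorbs the doubling.\<close>

lemma DERIV_quadratic_form:
  assumes A: "has_mat_deriv k k A A' t" and sym: "(A t)\<^sup>T = A t" and c: "has_vec_deriv_on k c c' t"
  shows "((\<lambda>s. 1 / 2 * (c s \<bullet> (A s *\<^sub>v c s))) has_real_derivative
    1 / 2 * (c t \<bullet> (A' *\<^sub>v c t)) + c' \<bullet> (A t *\<^sub>v c t)) (at t)"
proof -
  have "\<forall>\<^sub>F s in nhds t. A s \<in> carrier_mat k k" using A unfolding has_mat_deriv_def by blast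
  then have At: "A t \<in> carrier_mat k k" by (rule eventually_nhds_x_imp_x)
  have A': "A' \<in> carrier_mat k k" using A unfolding has_mat_deriv_def by blast
  have "\<forall>\<^sub>F s in nhds t. c s \<in> carrier_vec k" using c unfolding has_vec_deriv_on_def by blast
  then have ct: "c t \<in> carrier_vec k" by (rule eventually_nhds_x_imp_x)
  have c': "c' \<in> carrier_vec k" using c unfolding has_vec_deriv_on_def by blast
  have Act: "A t *\<^sub>v c t \<in> carrier_vec k" "A' *\<^sub>v c t \<in> carrier_vec k" "A t *\<^sub>v c' \<in> carrier_vec k"
    using At A' ct c' by simp_all
  have "c t \<bullet> (A t *\<^sub>v c') = c' \<bullet> (A t *\<^sub>v c t)"
    using transpose_vec_mult_scalar[OF At c' ct] sym comm_scalar_prod[OF c' Act(1)] by simp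
  then have eq: "1 / 2 * (c' \<bullet> (A t *\<^sub>v c t) + c t \<bullet> (A' *\<^sub>v c t + A t *\<^sub>v c')) =
      1 / 2 * (c t \<bullet> (A' *\<^sub>v c t)) + c' \<bullet> (A t *\<^sub>v c t)"
    using scalar_prod_add_distrib[OF ct Act(2,3)] by simp
  show ?thesis
    by (rule DERIV_cong[OF DERIV_cmult[OF has_vec_deriv_on_scalar_prod[OF c has_mat_deriv_mult_vec[OF A c]]] eq])
qed

text \<open>The constant \<open>b\<close> takes up every part of an energy that does not depend on
  the momentum being varied. The formula for \<open>f\<close> is required only on the carrier, since
  \<open>Hbar\<close> is described only there.\<close>

lemma grad_quadratic_form:
  assumes A: "A \<in> carrier_mat k k" and sym: "A\<^sup>T = A" and x: "x \<in> carrier_vec k"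
    and f: "\<And>y. y \<in> carrier_vec k \<Longrightarrow> f y = 1 / 2 * (y \<bullet> (A *\<^sub>v y)) + b"
  shows "grad f x = A *\<^sub>v x"
proof (rule eq_vecI)
  fix i assume "i < dim_vec (A *\<^sub>v x)"
  then have i: "i < k" using A by simp
  let ?c = "\<lambda>s. x + s \<cdot>\<^sub>v unit_vec k i"
  have c0: "?c 0 = x" using x by auto
  have Ax: "A *\<^sub>v x \<in> carrier_vec k" using A x by simp
  have "((\<lambda>s. 1 / 2 * (?c s \<bullet> (A *\<^sub>v ?c s))) has_real_derivative
      1 / 2 * (?c 0 \<bullet> (0\<^sub>m k k *\<^sub>v ?c 0)) + unit_vec k i \<bullet> (A *\<^sub>v ?c 0)) (at 0)"
    by (rule DERIV_quadratic_form[OF has_mat_deriv_const[OF A] sym has_vec_deriv_on_line[OF x i]])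
  moreover have "0\<^sub>m k k *\<^sub>v x = 0\<^sub>v k" using x by auto
  ultimately have "((\<lambda>s. 1 / 2 * (?c s \<bullet> (A *\<^sub>v ?c s))) has_real_derivative (A *\<^sub>v x) $ i) (at 0)"
    unfolding c0 using x Ax i scalar_prod_left_unit[OF Ax i] by simp
  then have "((\<lambda>s. 1 / 2 * (?c s \<bullet> (A *\<^sub>v ?c s)) + b) has_real_derivative (A *\<^sub>v x) $ i + 0) (at 0)"
    by (intro DERIV_add DERIV_const)
  moreover have "f (?c s) = 1 / 2 * (?c s \<bullet> (A *\<^sub>v ?c s)) + b" for s
    using x by (intro f) simp
  ultimately have "((\<lambda>s. f (?c s)) has_real_derivative (A *\<^sub>v x) $ i) (at 0)" by simp
  then show "grad f x $ i = (A *\<^sub>v x) $ i"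
    using i x by (simp add: grad_def partial_deriv_def DERIV_imp_deriv)
qed (use A x in \<open>simp add: grad_def\<close>)

lemma eventually_in_open:
  "open T \<Longrightarrow> t \<in> T \<Longrightarrow> (\<And>s. s \<in> T \<Longrightarrow> P s) \<Longrightarrow> \<forall>\<^sub>F s in nhds t. P s"
  unfolding eventually_nhds by blast

section \<open>The extended Jacobian\<close>

locale task_system =
  fixes n m :: nat
    and U :: "real vec set"
    and M J Z :: "real vec \<Rightarrow> real mat"
    and V :: "real vec \<Rightarrow> real"
  assumes mn: "m \<le> n"
    and open_U: "open_vec n U"
    and smooth_M: "smooth_mat n n n U M" and M_spd: "\<And>q. q \<in> U \<Longrightarrow> sym_pos_def n (M q)"
    and smooth_V: "smooth_vec n U V"
    and smooth_J: "smooth_mat m n n U J" and rank_J: "\<And>q. q \<in> U \<Longrightarrow> vec_space.rank m (J q) = m"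
    and smooth_Z: "smooth_mat (n - m) n n U Z"
    and rank_Z: "\<And>q. q \<in> U \<Longrightarrow> vec_space.rank (n - m) (Z q) = n - m"
    and JZT: "\<And>q. q \<in> U \<Longrightarrow> J q * (Z q)\<^sup>T = 0\<^sub>m m (n - m)"
begin

abbreviation "Mi q \<equiv> minv (M q)"
abbreviation "N \<equiv> Nmat M Z"
abbreviation "Jb \<equiv> Jbar M J Z"
abbreviation "Js \<equiv> Jsharp M J"
abbreviation "W q \<equiv> Js q @\<^sub>c (Z q)\<^sup>T"
text \<open>\<open>S\<close> is the inverse of the task inertia \<open>Lambda_t\<close>, while
  \<open>R\<close> is the null-space inertia \<open>Lambda_nu\<close> itself; hence \<open>S\<close>
  and \<open>minv (R q)\<close> are the coefficients of the kinetic energy.\<close>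

abbreviation "S q \<equiv> J q * Mi q * (J q)\<^sup>T"
abbreviation "R q \<equiv> Z q * M q * (Z q)\<^sup>T"

lemma U_carrier: "q \<in> U \<Longrightarrow> q \<in> carrier_vec n"
  using open_U unfolding open_vec_def by blast

lemma J_carrier: "q \<in> U \<Longrightarrow> J q \<in> carrier_mat m n"
  using smooth_J unfolding smooth_mat_def by blast

lemma Z_carrier: "q \<in> U \<Longrightarrow> Z q \<in> carrier_mat (n - m) n"
  using smooth_Z unfolding smooth_mat_def by blast

lemma M_carrier: "q \<in> U \<Longrightarrow> M q \<in> carrier_mat n n"
  using smooth_M unfolding smooth_mat_def by blast

lemma M_sym: "q \<in> U \<Longrightarrow> (M q)\<^sup>T = M q"
  using M_spd unfolding sym_pos_def_def by blast

lemmas Mi_carrier = sym_pos_def_inverse(1)[OF M_spd]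
lemmas M_Mi = sym_pos_def_inverse(2)[OF M_spd]

lemma Mi_sym: "q \<in> U \<Longrightarrow> (Mi q)\<^sup>T = Mi q"
  using sym_pos_def_minv[OF M_spd] unfolding sym_pos_def_def by blast

lemma JT_carrier: "q \<in> U \<Longrightarrow> (J q)\<^sup>T \<in> carrier_mat n m"
  using J_carrier by simp

lemma ZT_carrier: "q \<in> U \<Longrightarrow> (Z q)\<^sup>T \<in> carrier_mat n (n - m)"
  using Z_carrier by simp

lemma ZJT: "q \<in> U \<Longrightarrow> Z q * (J q)\<^sup>T = 0\<^sub>m (n - m) m"
  using transpose_mult[OF J_carrier ZT_carrier, of q q] JZT[of q] by simp

lemma JT_inj:
  assumes "q \<in> U" "x \<in> carrier_vec m" "(J q)\<^sup>T *\<^sub>v x = 0\<^sub>v n"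
  shows "x = 0\<^sub>v m"
  using full_row_rank_transpose_inj[OF J_carrier rank_J] assms by blast

lemma ZT_inj:
  assumes "q \<in> U" "x \<in> carrier_vec (n - m)" "(Z q)\<^sup>T *\<^sub>v x = 0\<^sub>v n"
  shows "x = 0\<^sub>v (n - m)"
  using full_row_rank_transpose_inj[OF Z_carrier rank_Z] assms by blast

lemma S_spd: "q \<in> U \<Longrightarrow> sym_pos_def m (S q)"
  using sym_pos_def_congruence[OF sym_pos_def_minv[OF M_spd] J_carrier] JT_inj by blast

lemma R_spd: "q \<in> U \<Longrightarrow> sym_pos_def (n - m) (R q)"
  using sym_pos_def_congruence[OF M_spd Z_carrier] ZT_inj by blast

lemmas Si_carrier = sym_pos_def_inverse(1)[OF S_spd]
lemmas S_Si = sym_pos_def_inverse(2)[OF S_spd]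
lemmas Si_S = sym_pos_def_inverse(3)[OF S_spd]
lemmas Ri_carrier = sym_pos_def_inverse(1)[OF R_spd]
lemmas R_Ri = sym_pos_def_inverse(2)[OF R_spd]
lemmas Ri_R = sym_pos_def_inverse(3)[OF R_spd]

lemma S_carrier: "q \<in> U \<Longrightarrow> S q \<in> carrier_mat m m"
  using S_spd unfolding sym_pos_def_def by blast

lemma R_carrier: "q \<in> U \<Longrightarrow> R q \<in> carrier_mat (n - m) (n - m)"
  using R_spd unfolding sym_pos_def_def by blast

lemma S_sym: "q \<in> U \<Longrightarrow> (S q)\<^sup>T = S q"
  using S_spd unfolding sym_pos_def_def by blast

lemma Ri_sym: "q \<in> U \<Longrightarrow> (minv (R q))\<^sup>T = minv (R q)"
  using sym_pos_def_minv[OF R_spd] unfolding sym_pos_def_def by blast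

lemma Js_carrier: "q \<in> U \<Longrightarrow> Js q \<in> carrier_mat n m"
  unfolding Jsharp_def using Mi_carrier JT_carrier Si_carrier by (meson mult_carrier_mat)

lemma N_carrier: "q \<in> U \<Longrightarrow> N q \<in> carrier_mat (n - m) n"
  unfolding Nmat_def using M_carrier Z_carrier Ri_carrier by (meson mult_carrier_mat)

lemma W_carrier: "q \<in> U \<Longrightarrow> W q \<in> carrier_mat n n"
  using append_cols_carrier[OF Js_carrier ZT_carrier] mn by fastforce

lemma Jb_carrier: "q \<in> U \<Longrightarrow> Jb q \<in> carrier_mat n n"
  unfolding Jbar_def using carrier_append_rows[OF J_carrier N_carrier] mn by fastforce

lemma J_Js:
  assumes q: "q \<in> U"
  shows "J q * Js q = 1\<^sub>m m"
proof -
  have "J q * Js q = S q * minv (S q)"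
    unfolding Jsharp_def
    using assoc_mult_mat[OF mult_carrier_mat[OF J_carrier Mi_carrier] JT_carrier Si_carrier, OF q q q q]
      assoc_mult_mat[OF J_carrier Mi_carrier mult_carrier_mat[OF JT_carrier Si_carrier], OF q q q q]
      assoc_mult_mat[OF Mi_carrier JT_carrier Si_carrier, OF q q q] by simp
  then show ?thesis using S_Si[OF q] by simp
qed

lemma N_ZT:
  assumes q: "q \<in> U"
  shows "N q * (Z q)\<^sup>T = 1\<^sub>m (n - m)"
proof -
  have "N q * (Z q)\<^sup>T = minv (R q) * R q"
    unfolding Nmat_def
    using assoc_mult_mat[OF mult_carrier_mat[OF Ri_carrier Z_carrier] M_carrier ZT_carrier, OF q q q q]
      assoc_mult_mat[OF Ri_carrier Z_carrier mult_carrier_mat[OF M_carrier ZT_carrier], OF q q q q]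
      assoc_mult_mat[OF Z_carrier M_carrier ZT_carrier, OF q q q] by simp
  then show ?thesis using Ri_R[OF q] by simp
qed

text \<open>The factor \<open>M\<close> at the end of \<open>N\<close> cancels. All products with
  \<open>N M^-1\<close> thereby reduce to products with \<open>Z\<close>, where
  \<open>Z J^T = 0\<close> and \<open>Z N^T = 1\<close> apply.\<close>

lemma N_Mi:
  assumes q: "q \<in> U"
  shows "N q * Mi q = minv (R q) * Z q"
  unfolding Nmat_def
  using assoc_mult_mat[OF mult_carrier_mat[OF Ri_carrier Z_carrier] M_carrier Mi_carrier, OF q q q q]
    M_Mi[OF q] right_mult_one_mat[OF mult_carrier_mat[OF Ri_carrier Z_carrier], OF q q] by simp

lemma N_Mi_JT:
  assumes q: "q \<in> U"
  shows "N q * Mi q * (J q)\<^sup>T = 0\<^sub>m (n - m) m"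
  unfolding N_Mi[OF q]
  using assoc_mult_mat[OF Ri_carrier Z_carrier JT_carrier, OF q q q] ZJT[OF q]
    right_mult_zero_mat[OF Ri_carrier, OF q] by simp

lemma N_Js:
  assumes q: "q \<in> U"
  shows "N q * Js q = 0\<^sub>m (n - m) m"
proof -
  have "N q * Js q = N q * Mi q * (J q)\<^sup>T * minv (S q)"
    unfolding Jsharp_def
    using assoc_mult_mat[OF N_carrier Mi_carrier mult_carrier_mat[OF JT_carrier Si_carrier], OF q q q q]
      assoc_mult_mat[OF mult_carrier_mat[OF N_carrier Mi_carrier] JT_carrier Si_carrier, OF q q q q]
      assoc_mult_mat[OF Mi_carrier JT_carrier Si_carrier, OF q q q] by simp
  then show ?thesis using N_Mi_JT[OF q] left_mult_zero_mat[OF Si_carrier[OF q]] by simp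
qed

lemma Jb_W:
  assumes q: "q \<in> U"
  shows "Jb q * W q = 1\<^sub>m n"
  unfolding Jbar_def
  using append_rows_mult_append_cols[OF J_carrier N_carrier Js_carrier ZT_carrier, OF q q q q]
    J_Js[OF q] JZT[OF q] N_Js[OF q] N_ZT[OF q] mn by simp

lemma minv_Jb: "q \<in> U \<Longrightarrow> minv (Jb q) = W q"
  using minv_eqI[OF Jb_carrier W_carrier Jb_W] by blast

lemma W_Jb: "q \<in> U \<Longrightarrow> W q * Jb q = 1\<^sub>m n"
  using mat_mult_left_right_inverse[OF Jb_carrier W_carrier Jb_W] by blast

lemma W_transpose_mult:
  assumes q: "q \<in> U" and p: "p \<in> carrier_vec n"
  shows "(W q)\<^sup>T *\<^sub>v p = (Js q)\<^sup>T *\<^sub>v p @\<^sub>v Z q *\<^sub>v p"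
  using transpose_append_cols[OF Js_carrier ZT_carrier, OF q q]
    mat_mult_append[of "(Js q)\<^sup>T" m n "Z q" "n - m" p] Js_carrier[OF q] Z_carrier[OF q] p by simp

lemma Jb_transpose_mult:
  assumes q: "q \<in> U" and "x \<in> carrier_vec m" "y \<in> carrier_vec (n - m)"
  shows "(Jb q)\<^sup>T *\<^sub>v (x @\<^sub>v y) = (J q)\<^sup>T *\<^sub>v x + (N q)\<^sup>T *\<^sub>v y"
  unfolding Jbar_def
  using transpose_append_rows[OF J_carrier N_carrier, OF q q]
    append_cols_mult_vec[of "(J q)\<^sup>T" n m "(N q)\<^sup>T" "n - m" x y] J_carrier[OF q] N_carrier[OF q] assms
  by simp

lemma Jb_mult:
  assumes q: "q \<in> U" and "x \<in> carrier_vec n"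
  shows "Jb q *\<^sub>v x = J q *\<^sub>v x @\<^sub>v N q *\<^sub>v x"
  unfolding Jbar_def using mat_mult_append[OF J_carrier N_carrier, OF q q] assms by simp

lemma W_mult:
  assumes q: "q \<in> U" and "x \<in> carrier_vec m" "y \<in> carrier_vec (n - m)"
  shows "W q *\<^sub>v (x @\<^sub>v y) = Js q *\<^sub>v x + (Z q)\<^sup>T *\<^sub>v y"
  using append_cols_mult_vec[OF Js_carrier ZT_carrier, OF q q] assms by simp

lemma W_Jb_transpose:
  assumes q: "q \<in> U" and e: "e \<in> carrier_vec n"
  shows "(W q)\<^sup>T *\<^sub>v ((Jb q)\<^sup>T *\<^sub>v e) = e"
proof -
  have "(W q)\<^sup>T * (Jb q)\<^sup>T = 1\<^sub>m n"
    using transpose_mult[OF Jb_carrier W_carrier, OF q q] Jb_W[OF q] by simp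
  then show ?thesis
    using assoc_mult_mat_vec[of "(W q)\<^sup>T" n n "(Jb q)\<^sup>T" n e] W_carrier[OF q] Jb_carrier[OF q] e by simp
qed

lemma Jb_W_transpose:
  assumes q: "q \<in> U" and p: "p \<in> carrier_vec n"
  shows "(Jb q)\<^sup>T *\<^sub>v ((W q)\<^sup>T *\<^sub>v p) = p"
proof -
  have "(Jb q)\<^sup>T * (W q)\<^sup>T = 1\<^sub>m n"
    using transpose_mult[OF W_carrier Jb_carrier, OF q q] W_Jb[OF q] by simp
  then show ?thesis
    using assoc_mult_mat_vec[of "(Jb q)\<^sup>T" n n "(W q)\<^sup>T" n p] W_carrier[OF q] Jb_carrier[OF q] p by simp
qed

text \<open>The identity \<open>W Jb = 1\<close> read in blocks: a velocity is the sum of its lifted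
  task part and its null-space part.\<close>

lemma velocity_split:
  assumes q: "q \<in> U" and v: "v \<in> carrier_vec n"
  shows "Js q *\<^sub>v (J q *\<^sub>v v) + (Z q)\<^sup>T *\<^sub>v (N q *\<^sub>v v) = v"
proof -
  have "Js q *\<^sub>v (J q *\<^sub>v v) + (Z q)\<^sup>T *\<^sub>v (N q *\<^sub>v v) = W q *\<^sub>v (Jb q *\<^sub>v v)"
    using W_mult[OF q] Jb_mult[OF q v] J_carrier[OF q] N_carrier[OF q] v by simp
  also have "\<dots> = v"
    using assoc_mult_mat_vec[OF W_carrier Jb_carrier v, OF q q] W_Jb[OF q] v by simp
  finally show ?thesis .
qed

text \<open>The transposed identity \<open>Jb^T W^T = 1\<close>, dual to the splitting of
  velocities. It also recovers any vector from its images under \<open>Js^T\<close> and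
  \<open>Z\<close>.\<close>

lemma force_split:
  assumes q: "q \<in> U" and f: "f \<in> carrier_vec n"
  shows "(J q)\<^sup>T *\<^sub>v ((Js q)\<^sup>T *\<^sub>v f) + (N q)\<^sup>T *\<^sub>v (Z q *\<^sub>v f) = f"
  using Jb_W_transpose[OF q f] W_transpose_mult[OF q f] Jb_transpose_mult[OF q]
    Js_carrier[OF q] Z_carrier[OF q] f by simp

section \<open>The block-diagonal inertia\<close>

lemma Jb_Mi_Jb:
  assumes q: "q \<in> U"
  shows "Jb q * Mi q * (Jb q)\<^sup>T = four_block_mat (S q) (0\<^sub>m m (n - m)) (0\<^sub>m (n - m) m) (minv (R q))"
proof -
  have NT: "(N q)\<^sup>T \<in> carrier_mat n (n - m)" using N_carrier[OF q] by simp
  have JM: "J q * Mi q \<in> carrier_mat m n" and NM: "N q * Mi q \<in> carrier_mat (n - m) n"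
    using mult_carrier_mat[OF J_carrier Mi_carrier] mult_carrier_mat[OF N_carrier Mi_carrier] q by auto
  have "N q * Mi q * (N q)\<^sup>T = minv (R q) * (Z q * (N q)\<^sup>T)"
    unfolding N_Mi[OF q] using assoc_mult_mat[OF Ri_carrier Z_carrier NT, OF q q] .
  also have "Z q * (N q)\<^sup>T = 1\<^sub>m (n - m)"
    using transpose_mult[OF N_carrier ZT_carrier, OF q q] N_ZT[OF q] by simp
  finally have NN: "N q * Mi q * (N q)\<^sup>T = minv (R q)" using right_mult_one_mat[OF Ri_carrier[OF q]] by simp
  \<comment> \<open>By symmetry of \<open>M^-1\<close> the upper right block is the transpose of the
    lower left one, which vanishes by \<open>Z J^T = 0\<close>.\<close>
  have "(N q * Mi q * (J q)\<^sup>T)\<^sup>T = J q * (Mi q * (N q)\<^sup>T)"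
    using transpose_mult[OF NM JT_carrier[OF q]] transpose_mult[OF N_carrier Mi_carrier, OF q q] Mi_sym[OF q]
    by simp
  then have JN: "J q * Mi q * (N q)\<^sup>T = 0\<^sub>m m (n - m)"
    using N_Mi_JT[OF q] assoc_mult_mat[OF J_carrier Mi_carrier NT, OF q q] by simp
  show ?thesis
    unfolding Jbar_def append_rows_mult[OF J_carrier[OF q] N_carrier[OF q] Mi_carrier[OF q]]
      transpose_append_rows[OF J_carrier[OF q] N_carrier[OF q]]
      append_rows_mult_append_cols[OF JM NM JT_carrier[OF q] NT] NN JN N_Mi_JT[OF q] ..
qed

lemma Lambda_bar_eq:
  assumes q: "q \<in> U"
  shows "Lambda_bar M J Z q = four_block_mat (minv (S q)) (0\<^sub>m m (n - m)) (0\<^sub>m (n - m) m) (R q)"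
  unfolding Lambda_bar_def Jb_Mi_Jb[OF q]
  by (rule minv_block_diag[OF S_carrier Si_carrier S_Si Ri_carrier R_carrier Ri_R]) (rule q)+

lemma Lambda_t_eq: "q \<in> U \<Longrightarrow> Lambda_t M J Z q = minv (S q)"
  and Lambda_nu_eq: "q \<in> U \<Longrightarrow> Lambda_nu M J Z q = R q"
  unfolding Lambda_t_def Lambda_nu_def
  using J_carrier[of q] Si_carrier[of q] R_carrier[of q]
  by (auto simp: Lambda_bar_eq split_block_def Let_def simp del: index_mult_mat)

lemma minv_Lambda_t: "q \<in> U \<Longrightarrow> minv (Lambda_t M J Z q) = S q"
  unfolding Lambda_t_eq using minv_eqI[OF Si_carrier S_carrier Si_S] by blast

lemma minv_Lambda_nu: "q \<in> U \<Longrightarrow> minv (Lambda_nu M J Z q) = minv (R q)"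
  unfolding Lambda_nu_eq ..

lemma JsT_carrier: "q \<in> U \<Longrightarrow> (Js q)\<^sup>T \<in> carrier_mat m n"
  using Js_carrier by simp

lemma NT_carrier: "q \<in> U \<Longrightarrow> (N q)\<^sup>T \<in> carrier_mat n (n - m)"
  using N_carrier by simp

lemma J_Js_vec: "q \<in> U \<Longrightarrow> x \<in> carrier_vec m \<Longrightarrow> J q *\<^sub>v (Js q *\<^sub>v x) = x"
  using mult_vec_assoc_eq[OF J_carrier Js_carrier _ J_Js] by simp

lemma J_ZT_vec: "q \<in> U \<Longrightarrow> y \<in> carrier_vec (n - m) \<Longrightarrow> J q *\<^sub>v ((Z q)\<^sup>T *\<^sub>v y) = 0\<^sub>v m"
  using mult_vec_assoc_eq[OF J_carrier ZT_carrier _ JZT] zero_mat_mult_vec by simp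

lemma N_Js_vec: "q \<in> U \<Longrightarrow> x \<in> carrier_vec m \<Longrightarrow> N q *\<^sub>v (Js q *\<^sub>v x) = 0\<^sub>v (n - m)"
  using mult_vec_assoc_eq[OF N_carrier Js_carrier _ N_Js] zero_mat_mult_vec by simp

lemma Z_JT_vec: "q \<in> U \<Longrightarrow> x \<in> carrier_vec m \<Longrightarrow> Z q *\<^sub>v ((J q)\<^sup>T *\<^sub>v x) = 0\<^sub>v (n - m)"
  using mult_vec_assoc_eq[OF Z_carrier JT_carrier _ ZJT] zero_mat_mult_vec by simp

lemma JsT_JT_vec:
  assumes "q \<in> U" "x \<in> carrier_vec m"
  shows "(Js q)\<^sup>T *\<^sub>v ((J q)\<^sup>T *\<^sub>v x) = x"
  using mult_vec_assoc_eq[OF JsT_carrier JT_carrier assms(2)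
      transpose_mult[OF J_carrier Js_carrier, symmetric], OF assms(1) assms(1) assms(1) assms(1)]
    J_Js[OF assms(1)] assms(2) by simp

lemma JsT_NT_vec:
  assumes "q \<in> U" "y \<in> carrier_vec (n - m)"
  shows "(Js q)\<^sup>T *\<^sub>v ((N q)\<^sup>T *\<^sub>v y) = 0\<^sub>v m"
proof -
  have "(Js q)\<^sup>T *\<^sub>v ((N q)\<^sup>T *\<^sub>v y) = (N q * Js q)\<^sup>T *\<^sub>v y"
    by (rule mult_vec_assoc_eq[OF JsT_carrier NT_carrier assms(2)
          transpose_mult[OF N_carrier Js_carrier, symmetric], OF assms(1) assms(1) assms(1) assms(1)])
  also have "\<dots> = 0\<^sub>v m" unfolding N_Js[OF assms(1)] using assms(2) by auto
  finally show ?thesis .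
qed

lemma Z_NT_vec:
  assumes "q \<in> U" "y \<in> carrier_vec (n - m)"
  shows "Z q *\<^sub>v ((N q)\<^sup>T *\<^sub>v y) = y"
proof -
  have "Z q * (N q)\<^sup>T = 1\<^sub>m (n - m)"
    using transpose_mult[OF N_carrier ZT_carrier, OF assms(1) assms(1)] N_ZT[OF assms(1)] by simp
  then show ?thesis
    using mult_vec_assoc_eq[OF Z_carrier NT_carrier assms(2), OF assms(1) assms(1)] assms(2) by simp
qed

section \<open>Kernels, ranges and the decompositions of velocity and force\<close>

lemma kernel_J_iff: "q \<in> U \<Longrightarrow> v \<in> mat_kernel (J q) \<longleftrightarrow> v \<in> carrier_vec n \<and> J q *\<^sub>v v = 0\<^sub>v m"
  using mat_kernel[OF J_carrier] by blast

text \<open>\<open>S Js^T = J M^-1\<close> with \<open>S\<close> invertible, so the two matrices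
  have the same kernel. The description by \<open>Js^T\<close> is the one that fits the splitting of
  forces.\<close>

lemma kernel_JMi_iff:
  assumes q: "q \<in> U"
  shows "f \<in> mat_kernel (J q * Mi q) \<longleftrightarrow> f \<in> carrier_vec n \<and> (Js q)\<^sup>T *\<^sub>v f = 0\<^sub>v m"
proof -
  have JM: "J q * Mi q \<in> carrier_mat m n" using mult_carrier_mat[OF J_carrier[OF q] Mi_carrier[OF q]] .
  have MJ: "Mi q * (J q)\<^sup>T \<in> carrier_mat n m" using mult_carrier_mat[OF Mi_carrier[OF q] JT_carrier[OF q]] .
  have "(minv (S q))\<^sup>T = minv (S q)"
    using sym_pos_def_minv[OF S_spd[OF q]] unfolding sym_pos_def_def by blast
  then have JsT: "(Js q)\<^sup>T = minv (S q) * (J q * Mi q)"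
    unfolding Jsharp_def
    using transpose_mult[OF MJ Si_carrier[OF q]] transpose_mult[OF Mi_carrier JT_carrier, OF q q] Mi_sym[OF q]
    by simp
  have S_JsT: "S q * (Js q)\<^sup>T = J q * Mi q"
    unfolding JsT using assoc_mult_mat[OF S_carrier[OF q] Si_carrier[OF q] JM] S_Si[OF q]
      left_mult_one_mat[OF JM] by simp
  have "J q * Mi q *\<^sub>v f = 0\<^sub>v m \<longleftrightarrow> (Js q)\<^sup>T *\<^sub>v f = 0\<^sub>v m" if f: "f \<in> carrier_vec n"
  proof
    assume "J q * Mi q *\<^sub>v f = 0\<^sub>v m"
    then show "(Js q)\<^sup>T *\<^sub>v f = 0\<^sub>v m"
      using mult_vec_assoc_eq[OF Si_carrier[OF q] JM f JsT[symmetric]] mult_mat_zero_vec[OF Si_carrier[OF q]] by simp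
  next
    assume "(Js q)\<^sup>T *\<^sub>v f = 0\<^sub>v m"
    then show "J q * Mi q *\<^sub>v f = 0\<^sub>v m"
      using mult_vec_assoc_eq[OF S_carrier[OF q] JsT_carrier[OF q] f S_JsT] mult_mat_zero_vec[OF S_carrier[OF q]] by simp
  qed
  then show ?thesis using mat_kernel[OF JM] by blast
qed

text \<open>The kernel of \<open>J\<close> is the range of \<open>Z^T\<close>, so orthogonality to
  it in the metric \<open>M\<close> means \<open>Z M w = 0\<close>; and \<open>N\<close> is
  \<open>Z M\<close> up to the invertible factor \<open>R^-1\<close>.\<close>

lemma ker_perp_iff:
  assumes q: "q \<in> U"
  shows "w \<in> ker_perp (M q) (J q) \<longleftrightarrow> w \<in> carrier_vec n \<and> N q *\<^sub>v w = 0\<^sub>v (n - m)"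
proof -
  have ZM: "Z q * M q \<in> carrier_mat (n - m) n" using mult_carrier_mat[OF Z_carrier[OF q] M_carrier[OF q]] .
  have N: "minv (R q) * (Z q * M q) = N q"
    unfolding Nmat_def using assoc_mult_mat[OF Ri_carrier Z_carrier M_carrier, OF q q q] by simp
  have R_N: "R q * N q = Z q * M q"
    unfolding N[symmetric] using assoc_mult_mat[OF R_carrier[OF q] Ri_carrier[OF q] ZM] R_Ri[OF q]
      left_mult_one_mat[OF ZM] by simp
  have ZMT: "(Z q * M q)\<^sup>T = M q * (Z q)\<^sup>T"
    using transpose_mult[OF Z_carrier M_carrier, OF q q] M_sym[OF q] by simp
  have pair: "w \<bullet> (M q *\<^sub>v ((Z q)\<^sup>T *\<^sub>v y)) = y \<bullet> (Z q * M q *\<^sub>v w)"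
    if w: "w \<in> carrier_vec n" and y: "y \<in> carrier_vec (n - m)" for w y
  proof -
    have "M q *\<^sub>v ((Z q)\<^sup>T *\<^sub>v y) = (Z q * M q)\<^sup>T *\<^sub>v y"
      by (rule mult_vec_assoc_eq[OF M_carrier ZT_carrier y ZMT[symmetric]]) (rule q)+
    moreover have "(Z q * M q)\<^sup>T *\<^sub>v y \<in> carrier_vec n"
      by (rule mult_mat_vec_carrier[OF _ y]) (use ZM in simp)
    ultimately show ?thesis
      using transpose_vec_mult_scalar[OF ZM w y] comm_scalar_prod[OF w, of "(Z q * M q)\<^sup>T *\<^sub>v y"] by simp
  qed
  show ?thesis
  proof
    assume "w \<in> ker_perp (M q) (J q)"
    then have w: "w \<in> carrier_vec n" and perp: "\<And>s. s \<in> mat_kernel (J q) \<Longrightarrow> w \<bullet> (M q *\<^sub>v s) = 0"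
      using J_carrier[OF q] by (auto simp: ker_perp_def)
    let ?y = "Z q * M q *\<^sub>v w"
    have y: "?y \<in> carrier_vec (n - m)" by (rule mult_mat_vec_carrier[OF ZM w])
    \<comment> \<open>Orthogonality is tested against the kernel vector \<open>Z^T y\<close> with
      \<open>y = Z M w\<close> itself.\<close>
    have "?y \<bullet> ?y = 0"
      using perp[of "(Z q)\<^sup>T *\<^sub>v ?y"] pair[OF w y] kernel_J_iff[OF q] J_ZT_vec[OF q y]
        mult_mat_vec_carrier[OF ZT_carrier[OF q] y] by simp
    then have "?y = 0\<^sub>v (n - m)" by (rule scalar_prod_self_eq_0[OF y])
    then show "w \<in> carrier_vec n \<and> N q *\<^sub>v w = 0\<^sub>v (n - m)"
      using mult_vec_assoc_eq[OF Ri_carrier[OF q] ZM w N] mult_mat_zero_vec[OF Ri_carrier[OF q]] w by simp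
  next
    assume w: "w \<in> carrier_vec n \<and> N q *\<^sub>v w = 0\<^sub>v (n - m)"
    then have y: "Z q * M q *\<^sub>v w = 0\<^sub>v (n - m)"
      using mult_vec_assoc_eq[OF R_carrier[OF q] N_carrier[OF q] conjunct1[OF w] R_N] mult_mat_zero_vec[OF R_carrier[OF q]] by simp
    have "w \<bullet> (M q *\<^sub>v s) = 0" if s: "s \<in> mat_kernel (J q)" for s
    proof -
      have sc: "s \<in> carrier_vec n" and Js0: "J q *\<^sub>v s = 0\<^sub>v m" using s kernel_J_iff[OF q] by auto
      have Ns: "N q *\<^sub>v s \<in> carrier_vec (n - m)" by (rule mult_mat_vec_carrier[OF N_carrier[OF q] sc])
      have ZNs: "(Z q)\<^sup>T *\<^sub>v (N q *\<^sub>v s) \<in> carrier_vec n"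
        by (rule mult_mat_vec_carrier[OF ZT_carrier[OF q] Ns])
      have "Js q *\<^sub>v 0\<^sub>v m = 0\<^sub>v n" by (rule mult_mat_zero_vec[OF Js_carrier[OF q]])
      \<comment> \<open>With \<open>J s = 0\<close> the lifted task part of \<open>s\<close>
        vanishes, so \<open>s\<close> is in the range of \<open>Z^T\<close> and \<open>pair\<close>
        applies.\<close>
      then have "(Z q)\<^sup>T *\<^sub>v (N q *\<^sub>v s) = s"
        using velocity_split[OF q sc] ZNs by (simp add: Js0)
      then show ?thesis using pair[OF _ Ns, of w] w y Ns by simp
    qed
    then show "w \<in> ker_perp (M q) (J q)"
      using w J_carrier[OF q] by (simp add: ker_perp_def)
  qed
qed

text \<open>If \<open>Z f = 0\<close>, the null-space part of \<open>f\<close> in the splitting of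
  forces vanishes, and what remains exhibits the preimage \<open>Js^T f\<close>.\<close>

lemma range_JT_iff:
  assumes q: "q \<in> U"
  shows "f \<in> mat_range ((J q)\<^sup>T) \<longleftrightarrow> f \<in> carrier_vec n \<and> Z q *\<^sub>v f = 0\<^sub>v (n - m)"
proof
  assume "f \<in> mat_range ((J q)\<^sup>T)"
  then obtain x where x: "x \<in> carrier_vec m" "f = (J q)\<^sup>T *\<^sub>v x"
    using J_carrier[OF q] by (auto simp: mat_range_def)
  then show "f \<in> carrier_vec n \<and> Z q *\<^sub>v f = 0\<^sub>v (n - m)"
    using Z_JT_vec[OF q x(1)] mult_mat_vec_carrier[OF JT_carrier[OF q] x(1)] by simp
next
  assume f: "f \<in> carrier_vec n \<and> Z q *\<^sub>v f = 0\<^sub>v (n - m)"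
  let ?x = "(Js q)\<^sup>T *\<^sub>v f"
  have x: "?x \<in> carrier_vec m" by (rule mult_mat_vec_carrier[OF JsT_carrier[OF q]]) (use f in blast)
  have "(N q)\<^sup>T *\<^sub>v 0\<^sub>v (n - m) = 0\<^sub>v n" by (rule mult_mat_zero_vec[OF NT_carrier[OF q]])
  then have "(J q)\<^sup>T *\<^sub>v ?x = f"
    using force_split[OF q, of f] f mult_mat_vec_carrier[OF JT_carrier[OF q] x] by simp
  then show "f \<in> mat_range ((J q)\<^sup>T)"
    unfolding mat_range_def using x J_carrier[OF q] by (intro image_eqI[of _ _ ?x]) auto
qed

text \<open>\<open>J\<close> annihilates \<open>k\<close> and \<open>N\<close> annihilates
  \<open>v\<close>, so each of them sees one summand only. As both summands are recovered from the
  sum, this also yields uniqueness of the decomposition.\<close>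

lemma velocity_components:
  assumes q: "q \<in> U" and k: "k \<in> mat_kernel (J q)" and v: "v \<in> ker_perp (M q) (J q)"
  shows "J q *\<^sub>v (v + k) = J q *\<^sub>v v" "k = (Z q)\<^sup>T *\<^sub>v (N q *\<^sub>v (v + k))" "v = Js q *\<^sub>v (J q *\<^sub>v (v + k))"
proof -
  have k': "k \<in> carrier_vec n" "J q *\<^sub>v k = 0\<^sub>v m" using k kernel_J_iff[OF q] by auto
  have v': "v \<in> carrier_vec n" "N q *\<^sub>v v = 0\<^sub>v (n - m)" using v ker_perp_iff[OF q] by auto
  note Jv = mult_mat_vec_carrier[OF J_carrier[OF q] v'(1)] and Nk = mult_mat_vec_carrier[OF N_carrier[OF q] k'(1)]
  show J: "J q *\<^sub>v (v + k) = J q *\<^sub>v v"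
    using mult_add_distrib_mat_vec[OF J_carrier[OF q] v'(1) k'(1)] k'(2) Jv by simp
  have N: "N q *\<^sub>v (v + k) = N q *\<^sub>v k"
    using mult_add_distrib_mat_vec[OF N_carrier[OF q] v'(1) k'(1)] v'(2) Nk by simp
  have "Js q *\<^sub>v 0\<^sub>v m = 0\<^sub>v n" "(Z q)\<^sup>T *\<^sub>v 0\<^sub>v (n - m) = 0\<^sub>v n"
    by (rule mult_mat_zero_vec[OF Js_carrier[OF q]] mult_mat_zero_vec[OF ZT_carrier[OF q]])+
  then show "k = (Z q)\<^sup>T *\<^sub>v (N q *\<^sub>v (v + k))" "v = Js q *\<^sub>v (J q *\<^sub>v (v + k))"
    unfolding J N
    using velocity_split[OF q k'(1)] velocity_split[OF q v'(1)] k'(2) v'(2)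
      mult_mat_vec_carrier[OF Js_carrier[OF q] Jv] mult_mat_vec_carrier[OF ZT_carrier[OF q] Nk] by simp_all
qed

lemma force_components:
  assumes q: "q \<in> U" and k: "k \<in> mat_kernel (J q * Mi q)" and f: "f \<in> mat_range ((J q)\<^sup>T)"
  shows "k = (N q)\<^sup>T *\<^sub>v (Z q *\<^sub>v (k + f))" "f = (J q)\<^sup>T *\<^sub>v ((Js q)\<^sup>T *\<^sub>v (k + f))"
proof -
  have k': "k \<in> carrier_vec n" "(Js q)\<^sup>T *\<^sub>v k = 0\<^sub>v m" using k kernel_JMi_iff[OF q] by auto
  have f': "f \<in> carrier_vec n" "Z q *\<^sub>v f = 0\<^sub>v (n - m)" using f range_JT_iff[OF q] by auto
  note Jf = mult_mat_vec_carrier[OF JsT_carrier[OF q] f'(1)] and Zk = mult_mat_vec_carrier[OF Z_carrier[OF q] k'(1)]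
  have J: "(Js q)\<^sup>T *\<^sub>v (k + f) = (Js q)\<^sup>T *\<^sub>v f"
    using mult_add_distrib_mat_vec[OF JsT_carrier[OF q] k'(1) f'(1)] k'(2) Jf by simp
  have Z: "Z q *\<^sub>v (k + f) = Z q *\<^sub>v k"
    using mult_add_distrib_mat_vec[OF Z_carrier[OF q] k'(1) f'(1)] f'(2) Zk by simp
  have "(J q)\<^sup>T *\<^sub>v 0\<^sub>v m = 0\<^sub>v n" "(N q)\<^sup>T *\<^sub>v 0\<^sub>v (n - m) = 0\<^sub>v n"
    by (rule mult_mat_zero_vec[OF JT_carrier[OF q]] mult_mat_zero_vec[OF NT_carrier[OF q]])+
  then show "k = (N q)\<^sup>T *\<^sub>v (Z q *\<^sub>v (k + f))" "f = (J q)\<^sup>T *\<^sub>v ((Js q)\<^sup>T *\<^sub>v (k + f))"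
    unfolding J Z
    using force_split[OF q k'(1)] force_split[OF q f'(1)] k'(2) f'(2)
      mult_mat_vec_carrier[OF JT_carrier[OF q] Jf] mult_mat_vec_carrier[OF NT_carrier[OF q] Zk] by simp_all
qed

text \<open>The witnesses are the two parts in \<open>velocity_split\<close>;
  \<open>J Z^T = 0\<close> and \<open>N Js = 0\<close> place them in the required subspaces.\<close>

lemma velocity_decomposition:
  assumes q: "q \<in> U" and w: "w \<in> carrier_vec n"
  shows "\<exists>!(k, v). k \<in> mat_kernel (J q) \<and> v \<in> ker_perp (M q) (J q) \<and> w = v + k"
proof (rule ex1I[of _ "((Z q)\<^sup>T *\<^sub>v (N q *\<^sub>v w), Js q *\<^sub>v (J q *\<^sub>v w))"])
  have Jw: "J q *\<^sub>v w \<in> carrier_vec m" by (rule mult_mat_vec_carrier[OF J_carrier[OF q] w])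
  have Nw: "N q *\<^sub>v w \<in> carrier_vec (n - m)" by (rule mult_mat_vec_carrier[OF N_carrier[OF q] w])
  show "case ((Z q)\<^sup>T *\<^sub>v (N q *\<^sub>v w), Js q *\<^sub>v (J q *\<^sub>v w)) of
      (k, v) \<Rightarrow> k \<in> mat_kernel (J q) \<and> v \<in> ker_perp (M q) (J q) \<and> w = v + k"
    using J_ZT_vec[OF q Nw] N_Js_vec[OF q Jw] velocity_split[OF q w]
      mult_mat_vec_carrier[OF ZT_carrier[OF q] Nw] mult_mat_vec_carrier[OF Js_carrier[OF q] Jw]
    by (simp add: kernel_J_iff[OF q] ker_perp_iff[OF q])
qed (use velocity_components[OF q] in auto)

lemma force_decomposition:
  assumes q: "q \<in> U" and w: "w \<in> carrier_vec n"
  shows "\<exists>!(k, f). k \<in> mat_kernel (J q * Mi q) \<and> f \<in> mat_range ((J q)\<^sup>T) \<and> w = k + f"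
proof (rule ex1I[of _ "((N q)\<^sup>T *\<^sub>v (Z q *\<^sub>v w), (J q)\<^sup>T *\<^sub>v ((Js q)\<^sup>T *\<^sub>v w))"])
  have Jw: "(Js q)\<^sup>T *\<^sub>v w \<in> carrier_vec m" by (rule mult_mat_vec_carrier[OF JsT_carrier[OF q] w])
  have Zw: "Z q *\<^sub>v w \<in> carrier_vec (n - m)" by (rule mult_mat_vec_carrier[OF Z_carrier[OF q] w])
  note c = mult_mat_vec_carrier[OF NT_carrier[OF q] Zw] mult_mat_vec_carrier[OF JT_carrier[OF q] Jw]
  have "w = (N q)\<^sup>T *\<^sub>v (Z q *\<^sub>v w) + (J q)\<^sup>T *\<^sub>v ((Js q)\<^sup>T *\<^sub>v w)"
    using force_split[OF q w] comm_add_vec[OF c] by simp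
  then show "case ((N q)\<^sup>T *\<^sub>v (Z q *\<^sub>v w), (J q)\<^sup>T *\<^sub>v ((Js q)\<^sup>T *\<^sub>v w)) of
      (k, f) \<Rightarrow> k \<in> mat_kernel (J q * Mi q) \<and> f \<in> mat_range ((J q)\<^sup>T) \<and> w = k + f"
    using JsT_NT_vec[OF q Zw] Z_JT_vec[OF q Jw] c
    by (simp add: kernel_JMi_iff[OF q] range_JT_iff[OF q] del: assoc_mult_mat_vec)
qed (use force_components[OF q] in auto)

text \<open>With \<open>f = J^T \<sigma>\<close> the matrix \<open>J\<close> moves to the other side
  of the pairing, where it annihilates the null-space velocity.\<close>

lemma power_pairing:
  assumes q: "q \<in> U" and k: "k \<in> mat_kernel (J q)" and v: "v \<in> ker_perp (M q) (J q)"
    and kf: "kf \<in> mat_kernel (J q * Mi q)" and f: "f \<in> mat_range ((J q)\<^sup>T)"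
  shows "f \<bullet> v = ((Js q)\<^sup>T *\<^sub>v (kf + f)) \<bullet> (J q *\<^sub>v (v + k))"
proof -
  have v': "v \<in> carrier_vec n" using v ker_perp_iff[OF q] by blast
  have "kf + f \<in> carrier_vec n"
    using kf f kernel_JMi_iff[OF q] range_JT_iff[OF q] by simp
  then have "(Js q)\<^sup>T *\<^sub>v (kf + f) \<in> carrier_vec m" by (rule mult_mat_vec_carrier[OF JsT_carrier[OF q]])
  then have "((J q)\<^sup>T *\<^sub>v ((Js q)\<^sup>T *\<^sub>v (kf + f))) \<bullet> v = ((Js q)\<^sup>T *\<^sub>v (kf + f)) \<bullet> (J q *\<^sub>v v)"
    by (rule transpose_vec_mult_scalar[OF J_carrier[OF q] v'])
  then show ?thesis
    using force_components(2)[OF q kf f] velocity_components(1)[OF q k v] by simp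
qed

lemma kernel_J_basis:
  assumes q: "q \<in> U"
  shows "cols_basis ((Z q)\<^sup>T) (mat_kernel (J q))"
proof (rule cols_basis_kernelI[OF ZT_carrier[OF q] J_carrier[OF q] _ ZT_inj[OF q]])
  show "mat_kernel (J q) = (\<lambda>x. (Z q)\<^sup>T *\<^sub>v x) ` carrier_vec (n - m)"
  proof (intro equalityI subsetI)
    fix k assume k: "k \<in> mat_kernel (J q)"
    then have kc: "k \<in> carrier_vec n" "J q *\<^sub>v k = 0\<^sub>v m" using kernel_J_iff[OF q] by auto
    have Nk: "N q *\<^sub>v k \<in> carrier_vec (n - m)" by (rule mult_mat_vec_carrier[OF N_carrier[OF q] kc(1)])
    have "Js q *\<^sub>v 0\<^sub>v m = 0\<^sub>v n" by (rule mult_mat_zero_vec[OF Js_carrier[OF q]])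
    then have "(Z q)\<^sup>T *\<^sub>v (N q *\<^sub>v k) = k"
      using velocity_split[OF q kc(1)] kc(2) mult_mat_vec_carrier[OF ZT_carrier[OF q] Nk] by simp
    then show "k \<in> (\<lambda>x. (Z q)\<^sup>T *\<^sub>v x) ` carrier_vec (n - m)" using Nk by (intro image_eqI) simp_all
  next
    fix k assume "k \<in> (\<lambda>x. (Z q)\<^sup>T *\<^sub>v x) ` carrier_vec (n - m)"
    then obtain y where "y \<in> carrier_vec (n - m)" "k = (Z q)\<^sup>T *\<^sub>v y" by blast
    then show "k \<in> mat_kernel (J q)"
      using kernel_J_iff[OF q] J_ZT_vec[OF q] mult_mat_vec_carrier[OF ZT_carrier[OF q]] by simp
  qed
qed

lemma kernel_JMi_basis:
  assumes q: "q \<in> U"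
  shows "cols_basis ((N q)\<^sup>T) (mat_kernel (J q * Mi q))"
proof (rule cols_basis_kernelI[OF NT_carrier[OF q] mult_carrier_mat[OF J_carrier[OF q] Mi_carrier[OF q]]])
  show "mat_kernel (J q * Mi q) = (\<lambda>x. (N q)\<^sup>T *\<^sub>v x) ` carrier_vec (n - m)"
  proof (intro equalityI subsetI)
    fix k assume k: "k \<in> mat_kernel (J q * Mi q)"
    then have kc: "k \<in> carrier_vec n" "(Js q)\<^sup>T *\<^sub>v k = 0\<^sub>v m" using kernel_JMi_iff[OF q] by auto
    have Zk: "Z q *\<^sub>v k \<in> carrier_vec (n - m)" by (rule mult_mat_vec_carrier[OF Z_carrier[OF q] kc(1)])
    have "(J q)\<^sup>T *\<^sub>v 0\<^sub>v m = 0\<^sub>v n" by (rule mult_mat_zero_vec[OF JT_carrier[OF q]])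
    then have "(N q)\<^sup>T *\<^sub>v (Z q *\<^sub>v k) = k"
      using force_split[OF q kc(1)] kc(2) mult_mat_vec_carrier[OF NT_carrier[OF q] Zk] by simp
    then show "k \<in> (\<lambda>x. (N q)\<^sup>T *\<^sub>v x) ` carrier_vec (n - m)" using Zk by (intro image_eqI) simp_all
  next
    fix k assume "k \<in> (\<lambda>x. (N q)\<^sup>T *\<^sub>v x) ` carrier_vec (n - m)"
    then obtain y where "y \<in> carrier_vec (n - m)" "k = (N q)\<^sup>T *\<^sub>v y" by blast
    then show "k \<in> mat_kernel (J q * Mi q)"
      using kernel_JMi_iff[OF q] JsT_NT_vec[OF q] mult_mat_vec_carrier[OF NT_carrier[OF q]] by simp
  qed
  \<comment> \<open>\<open>Z\<close> is a left inverse of \<open>N^T\<close>.\<close>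
  show "x = 0\<^sub>v (n - m)" if "x \<in> carrier_vec (n - m)" "(N q)\<^sup>T *\<^sub>v x = 0\<^sub>v n" for x
    using Z_NT_vec[OF q that(1)] that(2) mult_mat_zero_vec[OF Z_carrier[OF q]] by simp
qed

text \<open>\<open>J\<close> is a left inverse of \<open>Js\<close> everywhere. On the orthogonal
  complement \<open>N w = 0\<close>, so the splitting of velocities makes it a right inverse
  there.\<close>

lemma bij_Js:
  assumes q: "q \<in> U"
  shows "bij_betw (\<lambda>x. Js q *\<^sub>v x) (carrier_vec m) (ker_perp (M q) (J q))"
proof (rule bij_betwI[where g = "\<lambda>w. J q *\<^sub>v w"])
  show "(\<lambda>x. Js q *\<^sub>v x) \<in> carrier_vec m \<rightarrow> ker_perp (M q) (J q)"
    using N_Js_vec[OF q] mult_mat_vec_carrier[OF Js_carrier[OF q]] by (simp add: ker_perp_iff[OF q])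
  show "(\<lambda>w. J q *\<^sub>v w) \<in> ker_perp (M q) (J q) \<rightarrow> carrier_vec m"
    using mult_mat_vec_carrier[OF J_carrier[OF q]] ker_perp_iff[OF q] by blast
  show "Js q *\<^sub>v (J q *\<^sub>v w) = w" if w: "w \<in> ker_perp (M q) (J q)" for w
  proof -
    have w': "w \<in> carrier_vec n" "N q *\<^sub>v w = 0\<^sub>v (n - m)" using w ker_perp_iff[OF q] by auto
    have "(Z q)\<^sup>T *\<^sub>v 0\<^sub>v (n - m) = 0\<^sub>v n" by (rule mult_mat_zero_vec[OF ZT_carrier[OF q]])
    then show ?thesis
      using velocity_split[OF q w'(1)] w'(2)
        mult_mat_vec_carrier[OF Js_carrier[OF q] mult_mat_vec_carrier[OF J_carrier[OF q] w'(1)]] by simp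
  qed
qed (rule J_Js_vec[OF q])

lemma bij_JT:
  assumes q: "q \<in> U"
  shows "bij_betw (\<lambda>x. (J q)\<^sup>T *\<^sub>v x) (carrier_vec m) (mat_range ((J q)\<^sup>T))"
  unfolding bij_betw_def
proof
  show "inj_on (\<lambda>x. (J q)\<^sup>T *\<^sub>v x) (carrier_vec m)"
    using JsT_JT_vec[OF q] by (metis inj_onI)
  show "(\<lambda>x. (J q)\<^sup>T *\<^sub>v x) ` carrier_vec m = mat_range ((J q)\<^sup>T)"
    using J_carrier[OF q] by (simp add: mat_range_def)
qed

section \<open>The transformed Hamiltonian\<close>

lemma Phi_eq: "q \<in> U \<Longrightarrow> Phi M J Z (q, p) = (q, (W q)\<^sup>T *\<^sub>v p)"
  by (simp add: Phi_def minv_Jb)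

lemma WT_carrier: "q \<in> U \<Longrightarrow> (W q)\<^sup>T \<in> carrier_mat n n"
  using W_carrier by simp

lemma JbT_carrier: "q \<in> U \<Longrightarrow> (Jb q)\<^sup>T \<in> carrier_mat n n"
  using Jb_carrier by simp

lemma bij_Phi: "bij_betw (Phi M J Z) (U \<times> carrier_vec n) (U \<times> carrier_vec n)"
proof (rule bij_betwI)
  show "Phi M J Z \<in> U \<times> carrier_vec n \<rightarrow> U \<times> carrier_vec n"
    using Phi_eq mult_mat_vec_carrier[OF WT_carrier] by auto
  show "(\<lambda>(q, e). (q, (Jb q)\<^sup>T *\<^sub>v e)) \<in> U \<times> carrier_vec n \<rightarrow> U \<times> carrier_vec n"
    using mult_mat_vec_carrier[OF JbT_carrier] by auto
qed (auto simp: Phi_eq Jb_W_transpose W_Jb_transpose simp del: assoc_mult_mat_vec)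

text \<open>Makes the abstract inverse in the definition of \<open>Hbar\<close> explicit, so that
  \<open>Hbar\<close> becomes \<open>Ham\<close> at the momentum \<open>Jb^T e\<close>.\<close>

lemma inv_into_Phi:
  assumes "q \<in> U" "e \<in> carrier_vec n"
  shows "inv_into (U \<times> carrier_vec n) (Phi M J Z) (q, e) = (q, (Jb q)\<^sup>T *\<^sub>v e)"
proof (rule inv_into_f_eq)
  show "inj_on (Phi M J Z) (U \<times> carrier_vec n)" using bij_Phi by (rule bij_betw_imp_inj_on)
  show "(q, (Jb q)\<^sup>T *\<^sub>v e) \<in> U \<times> carrier_vec n"
    using assms mult_mat_vec_carrier[OF JbT_carrier] by blast
  show "Phi M J Z (q, (Jb q)\<^sup>T *\<^sub>v e) = (q, e)"
    using Phi_eq[OF assms(1)] W_Jb_transpose[OF assms] by simp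
qed

lemma Hbar_Ham:
  "q \<in> U \<Longrightarrow> e \<in> carrier_vec n \<Longrightarrow> Hbar n U M V J Z (q, e) = Ham M V (q, (Jb q)\<^sup>T *\<^sub>v e)"
  unfolding Hbar_def by (simp add: inv_into_Phi)

lemma append_carrier_n:
  "x \<in> carrier_vec m \<Longrightarrow> y \<in> carrier_vec (n - m) \<Longrightarrow> x @\<^sub>v y \<in> carrier_vec n"
  using append_carrier_vec[of x m y "n - m"] mn by simp

text \<open>Block-diagonality in terms of vectors: at momentum \<open>Jb^T (x, y)\<close> the task
  velocity depends on \<open>x\<close> alone and the null-space velocity on \<open>y\<close>
  alone.\<close>

lemma Jb_Mi_JbT_mult:
  assumes q: "q \<in> U" and x: "x \<in> carrier_vec m" and y: "y \<in> carrier_vec (n - m)"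
  shows "Jb q *\<^sub>v (Mi q *\<^sub>v ((Jb q)\<^sup>T *\<^sub>v (x @\<^sub>v y))) = S q *\<^sub>v x @\<^sub>v minv (R q) *\<^sub>v y"
proof -
  note e = append_carrier_n[OF x y]
  have "Jb q *\<^sub>v (Mi q *\<^sub>v ((Jb q)\<^sup>T *\<^sub>v (x @\<^sub>v y))) = Jb q * Mi q * (Jb q)\<^sup>T *\<^sub>v (x @\<^sub>v y)"
    using assoc_mult_mat_vec[OF mult_carrier_mat[OF Jb_carrier Mi_carrier] JbT_carrier e, OF q q q]
      assoc_mult_mat_vec[OF Jb_carrier Mi_carrier mult_mat_vec_carrier[OF JbT_carrier e], OF q q q]
    by simp
  also have "\<dots> = S q *\<^sub>v x @\<^sub>v minv (R q) *\<^sub>v y"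
    unfolding Jb_Mi_Jb[OF q] by (rule mult_mat_vec_split[OF S_carrier[OF q] Ri_carrier[OF q] x y])
  finally show ?thesis .
qed

lemma Hbar_blocks:
  assumes q: "q \<in> U" and x: "x \<in> carrier_vec m" and y: "y \<in> carrier_vec (n - m)"
  shows "Hbar n U M V J Z (q, x @\<^sub>v y) =
    1 / 2 * (x \<bullet> (S q *\<^sub>v x)) + 1 / 2 * (y \<bullet> (minv (R q) *\<^sub>v y)) + V q"
proof -
  note e = append_carrier_n[OF x y]
  let ?p = "(Jb q)\<^sup>T *\<^sub>v (x @\<^sub>v y)"
  have p: "?p \<in> carrier_vec n" by (rule mult_mat_vec_carrier[OF JbT_carrier[OF q] e])
  have "?p \<bullet> (Mi q *\<^sub>v ?p) = (x @\<^sub>v y) \<bullet> (Jb q *\<^sub>v (Mi q *\<^sub>v ?p))"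
    by (rule transpose_vec_mult_scalar[OF Jb_carrier[OF q] mult_mat_vec_carrier[OF Mi_carrier[OF q] p] e])
  also have "\<dots> = x \<bullet> (S q *\<^sub>v x) + y \<bullet> (minv (R q) *\<^sub>v y)"
    unfolding Jb_Mi_JbT_mult[OF assms]
    by (rule scalar_prod_append[OF x y mult_mat_vec_carrier[OF S_carrier[OF q] x]
          mult_mat_vec_carrier[OF Ri_carrier[OF q] y]])
  finally show ?thesis unfolding Hbar_Ham[OF q e] by (simp add: Ham_def)
qed

section \<open>Differentiability of the coefficient matrices\<close>

lemma curve_diff_V: "q \<in> U \<Longrightarrow> curve_diff n U V q"
  by (rule smooth_vec_curve_diff[OF open_U _ smooth_V])

lemma curve_diff_M: "q \<in> U \<Longrightarrow> curve_diff_mat n n n U M q"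
  by (rule smooth_mat_curve_diff[OF open_U _ smooth_M])

lemma curve_diff_J: "q \<in> U \<Longrightarrow> curve_diff_mat m n n U J q"
  by (rule smooth_mat_curve_diff[OF open_U _ smooth_J])

lemma curve_diff_Z: "q \<in> U \<Longrightarrow> curve_diff_mat (n - m) n n U Z q"
  by (rule smooth_mat_curve_diff[OF open_U _ smooth_Z])

lemma curve_diff_Mi: "q \<in> U \<Longrightarrow> curve_diff_mat n n n U Mi q"
  using curve_diff_mat_minv[OF curve_diff_M] Mi_carrier M_Mi by blast

lemma curve_diff_S: "q \<in> U \<Longrightarrow> curve_diff_mat m m n U S q"
  by (intro curve_diff_mat_mult[of _ n] curve_diff_mat_transpose curve_diff_J curve_diff_Mi)

lemma curve_diff_R: "q \<in> U \<Longrightarrow> curve_diff_mat (n - m) (n - m) n U R q"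
  by (intro curve_diff_mat_mult[of _ n] curve_diff_mat_transpose curve_diff_Z curve_diff_M)

lemma curve_diff_Ri: "q \<in> U \<Longrightarrow> curve_diff_mat (n - m) (n - m) n U (\<lambda>q. minv (R q)) q"
  using curve_diff_mat_minv[OF curve_diff_R] Ri_carrier R_Ri by blast

lemma curve_diff_Si: "q \<in> U \<Longrightarrow> curve_diff_mat m m n U (\<lambda>q. minv (S q)) q"
  using curve_diff_mat_minv[OF curve_diff_S] Si_carrier S_Si by blast

lemma curve_diff_Js: "q \<in> U \<Longrightarrow> curve_diff_mat n m n U Js q"
  unfolding Jsharp_def
  by (rule curve_diff_mat_mult[OF curve_diff_mat_mult[OF curve_diff_Mi curve_diff_mat_transpose[OF curve_diff_J]] curve_diff_Si])

lemma curve_diff_N: "q \<in> U \<Longrightarrow> curve_diff_mat (n - m) n n U N q"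
  unfolding Nmat_def
  by (rule curve_diff_mat_mult[OF curve_diff_mat_mult[OF curve_diff_Ri curve_diff_Z] curve_diff_M])

lemma curve_diff_JsT: "q \<in> U \<Longrightarrow> curve_diff_mat m n n U (\<lambda>q. (Js q)\<^sup>T) q"
  by (rule curve_diff_mat_transpose[OF curve_diff_Js])

lemma At_carrier: "q \<in> U \<Longrightarrow> A_t M J Z q e \<in> carrier_mat m n"
  using JsT_carrier[of q] U_carrier[of q] by (simp add: A_t_def deriv_mat_vec_def)

lemma An_carrier: "q \<in> U \<Longrightarrow> A_n M J Z q e \<in> carrier_mat (n - m) n"
  using Z_carrier[of q] U_carrier[of q] by (simp add: A_n_def deriv_mat_vec_def)

lemma Phi_components:
  assumes q: "q \<in> U" and x: "x \<in> carrier_vec m" and y: "y \<in> carrier_vec (n - m)"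
  shows "(Js q)\<^sup>T *\<^sub>v ((Jb q)\<^sup>T *\<^sub>v (x @\<^sub>v y)) = x" "Z q *\<^sub>v ((Jb q)\<^sup>T *\<^sub>v (x @\<^sub>v y)) = y"
proof -
  let ?p = "(Jb q)\<^sup>T *\<^sub>v (x @\<^sub>v y)"
  note e = append_carrier_n[OF x y]
  have p: "?p \<in> carrier_vec n" by (rule mult_mat_vec_carrier[OF JbT_carrier[OF q] e])
  have "(Js q)\<^sup>T *\<^sub>v ?p @\<^sub>v Z q *\<^sub>v ?p = x @\<^sub>v y"
    using W_Jb_transpose[OF q e] W_transpose_mult[OF q p] by simp
  then show "(Js q)\<^sup>T *\<^sub>v ?p = x" "Z q *\<^sub>v ?p = y"
    using append_vec_eq[OF mult_mat_vec_carrier[OF JsT_carrier[OF q] p] x] by auto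
qed

text \<open>Here \<open>v\<close> is the velocity at the momentum \<open>Jb^T (x, y)\<close>. Its
  task and null-space components \<open>S x\<close> and \<open>R^-1 y\<close> will turn out to be
  the momentum gradients of \<open>Hbar\<close>, that is, the port outputs.\<close>

lemma velocity_from_momenta:
  assumes q: "q \<in> U" and x: "x \<in> carrier_vec m" and y: "y \<in> carrier_vec (n - m)"
  defines "v \<equiv> Mi q *\<^sub>v ((Jb q)\<^sup>T *\<^sub>v (x @\<^sub>v y))"
  shows "J q *\<^sub>v v = S q *\<^sub>v x" "N q *\<^sub>v v = minv (R q) *\<^sub>v y"
    "Js q *\<^sub>v (S q *\<^sub>v x) + (Z q)\<^sup>T *\<^sub>v (minv (R q) *\<^sub>v y) = v"
proof -
  have v: "v \<in> carrier_vec n"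
    unfolding v_def
    by (rule mult_mat_vec_carrier[OF Mi_carrier mult_mat_vec_carrier[OF JbT_carrier append_carrier_n[OF x y]]])
      (rule q)+
  have "J q *\<^sub>v v @\<^sub>v N q *\<^sub>v v = S q *\<^sub>v x @\<^sub>v minv (R q) *\<^sub>v y"
    using Jb_Mi_JbT_mult[OF q x y] Jb_mult[OF q v] by (simp add: v_def)
  then show *: "J q *\<^sub>v v = S q *\<^sub>v x" "N q *\<^sub>v v = minv (R q) *\<^sub>v y"
    using append_vec_eq[OF mult_mat_vec_carrier[OF J_carrier[OF q] v] mult_mat_vec_carrier[OF S_carrier[OF q] x]]
    by auto
  show "Js q *\<^sub>v (S q *\<^sub>v x) + (Z q)\<^sup>T *\<^sub>v (minv (R q) *\<^sub>v y) = v"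
    using velocity_split[OF q v] unfolding * .
qed

text \<open>
  Differentiating \<open>H(q, p) = Hbar(q, \<pi>\<^sub>e(q, p))\<close> at constant \<open>p\<close> relates the two gradients without
  any reference to derivatives of the extended Jacobian itself.
\<close>

lemma grad_Ham_position:
  assumes q: "q \<in> U" and x: "x \<in> carrier_vec m" and y: "y \<in> carrier_vec (n - m)"
  shows "grad (\<lambda>r. Ham M V (r, (Jb q)\<^sup>T *\<^sub>v (x @\<^sub>v y))) q =
    grad (\<lambda>r. Hbar n U M V J Z (r, x @\<^sub>v y)) q +
    ((A_t M J Z q (x @\<^sub>v y))\<^sup>T *\<^sub>v (S q *\<^sub>v x) + (A_n M J Z q (x @\<^sub>v y))\<^sup>T *\<^sub>v (minv (R q) *\<^sub>v y))"
proof (rule eq_vecI)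
  let ?e = "x @\<^sub>v y"
  let ?p = "(Jb q)\<^sup>T *\<^sub>v ?e"
  let ?At = "A_t M J Z q ?e" and ?An = "A_n M J Z q ?e"
  note qc = U_carrier[OF q]
  have p: "?p \<in> carrier_vec n"
    by (rule mult_mat_vec_carrier[OF JbT_carrier[OF q] append_carrier_n[OF x y]])
  have Sx: "S q *\<^sub>v x \<in> carrier_vec m" by (rule mult_mat_vec_carrier[OF S_carrier[OF q] x])
  have Ry: "minv (R q) *\<^sub>v y \<in> carrier_vec (n - m)" by (rule mult_mat_vec_carrier[OF Ri_carrier[OF q] y])
  have AtT: "?At\<^sup>T *\<^sub>v (S q *\<^sub>v x) \<in> carrier_vec n"
    by (rule mult_mat_vec_carrier[OF _ Sx]) (use At_carrier[OF q] in simp)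
  have AnT: "?An\<^sup>T *\<^sub>v (minv (R q) *\<^sub>v y) \<in> carrier_vec n"
    by (rule mult_mat_vec_carrier[OF _ Ry]) (use An_carrier[OF q] in simp)
  show "dim_vec (grad (\<lambda>r. Ham M V (r, ?p)) q) =
      dim_vec (grad (\<lambda>r. Hbar n U M V J Z (r, ?e)) q + (?At\<^sup>T *\<^sub>v (S q *\<^sub>v x) + ?An\<^sup>T *\<^sub>v (minv (R q) *\<^sub>v y)))"
    using carrier_vecD[OF AtT] carrier_vecD[OF AnT] carrier_vecD[OF qc] by (simp add: grad_def)
  fix i
  assume "i < dim_vec (grad (\<lambda>r. Hbar n U M V J Z (r, ?e)) q +
      (?At\<^sup>T *\<^sub>v (S q *\<^sub>v x) + ?An\<^sup>T *\<^sub>v (minv (R q) *\<^sub>v y)))"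
  then have i: "i < n" using carrier_vecD[OF AnT] by simp
  let ?u = "unit_vec n i :: real vec"
  have u: "?u \<in> carrier_vec n" by simp
  define c where "c s = q + s \<cdot>\<^sub>v ?u" for s
  have c0: "c 0 = q" using qc by (auto simp: c_def)
  then have c0U: "c 0 \<in> U" using q by simp
  have ev: "\<forall>\<^sub>F s in nhds 0. c s \<in> U"
    unfolding c_def by (rule open_vec_line[OF open_U q i])
  have dc: "has_vec_deriv c ?u 0"
    using has_vec_deriv_line[OF qc i] unfolding c_def .
  \<comment> \<open>The new momenta along the line while \<open>p\<close> is frozen: they vary with
    \<open>s\<close>, starting from \<open>x\<close> and \<open>y\<close>, and their initial
    velocities are the \<open>i\<close>-th columns of \<open>A_t\<close> and
    \<open>A_n\<close>.\<close>
  define X where "X s = (Js (c s))\<^sup>T *\<^sub>v ?p" for s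
  define Y where "Y s = Z (c s) *\<^sub>v ?p" for s
  have X0: "X 0 = x" and Y0: "Y 0 = y"
    unfolding X_def Y_def c0 by (rule Phi_components[OF q x y])+
  have At0: "deriv_mat_vec (\<lambda>r. (Js r)\<^sup>T) ?p q = ?At" and An0: "deriv_mat_vec Z ?p q = ?An"
    by (simp_all add: A_t_def A_n_def)
  have Atu: "?At *\<^sub>v ?u \<in> carrier_vec m" and Anu: "?An *\<^sub>v ?u \<in> carrier_vec (n - m)"
    using mult_mat_vec_carrier[OF At_carrier[OF q] u] mult_mat_vec_carrier[OF An_carrier[OF q] u] by blast+
  have dX: "has_vec_deriv_on m X (?At *\<^sub>v ?u) 0"
    using curve_diff_mat_mult_vec_chain[OF open_U curve_diff_JsT[OF c0U] dc ev has_vec_deriv_on_const[OF p]]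
    unfolding X_def[symmetric] c0 At0 mult_mat_zero_vec[OF JsT_carrier[OF q]] right_zero_vec[OF Atu] .
  have dY: "has_vec_deriv_on (n - m) Y (?An *\<^sub>v ?u) 0"
    using curve_diff_mat_mult_vec_chain[OF open_U curve_diff_Z[OF c0U] dc ev has_vec_deriv_on_const[OF p]]
    unfolding Y_def[symmetric] c0 An0 mult_mat_zero_vec[OF Z_carrier[OF q]] right_zero_vec[OF Anu] .
  \<comment> \<open>Only the existence of these derivatives is used: \<open>S'\<close>,
    \<open>R'\<close> and \<open>V'\<close> enter both gradients in the same way and cancel in the
    comparison.\<close>
  obtain S' where dS: "has_mat_deriv m m (\<lambda>s. S (c s)) S' 0"
    using curve_diff_mat_chain[OF open_U curve_diff_S[OF c0U] dc ev] by blast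
  obtain R' where dR: "has_mat_deriv (n - m) (n - m) (\<lambda>s. minv (R (c s))) R' 0"
    using curve_diff_mat_chain[OF open_U curve_diff_Ri[OF c0U] dc ev] by blast
  obtain V' where dV: "((\<lambda>s. V (c s)) has_real_derivative V') (at 0)"
    using has_curve_gradD[OF curve_diff_partial[OF open_U c0U curve_diff_V[OF c0U]] dc ev] by blast
  note symS = S_sym[OF c0U] and symR = Ri_sym[OF c0U]
  let ?D = "1 / 2 * (x \<bullet> (S' *\<^sub>v x)) + 1 / 2 * (y \<bullet> (R' *\<^sub>v y)) + V'"
  let ?a = "(?At *\<^sub>v ?u) \<bullet> (S q *\<^sub>v x)" and ?b = "(?An *\<^sub>v ?u) \<bullet> (minv (R q) *\<^sub>v y)"
  have "((\<lambda>s. 1 / 2 * (X s \<bullet> (S (c s) *\<^sub>v X s)) + 1 / 2 * (Y s \<bullet> (minv (R (c s)) *\<^sub>v Y s)) + V (c s))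
      has_real_derivative (1 / 2 * (X 0 \<bullet> (S' *\<^sub>v X 0)) + (?At *\<^sub>v ?u) \<bullet> (S (c 0) *\<^sub>v X 0)) +
        (1 / 2 * (Y 0 \<bullet> (R' *\<^sub>v Y 0)) + (?An *\<^sub>v ?u) \<bullet> (minv (R (c 0)) *\<^sub>v Y 0)) + V') (at 0)"
    by (rule DERIV_add[OF DERIV_add[OF DERIV_quadratic_form[OF dS symS dX]
            DERIV_quadratic_form[OF dR symR dY]] dV])
  moreover have "\<forall>\<^sub>F s in nhds 0. 1 / 2 * (X s \<bullet> (S (c s) *\<^sub>v X s)) +
      1 / 2 * (Y s \<bullet> (minv (R (c s)) *\<^sub>v Y s)) + V (c s) = Ham M V (c s, ?p)"
    using ev
  proof eventually_elim
    case (elim s)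
    have Xs: "X s \<in> carrier_vec m" unfolding X_def by (rule mult_mat_vec_carrier[OF JsT_carrier[OF elim] p])
    have Ys: "Y s \<in> carrier_vec (n - m)" unfolding Y_def by (rule mult_mat_vec_carrier[OF Z_carrier[OF elim] p])
    have "X s @\<^sub>v Y s = (W (c s))\<^sup>T *\<^sub>v ?p"
      using W_transpose_mult[OF elim p] by (simp add: X_def Y_def)
    then have "(Jb (c s))\<^sup>T *\<^sub>v (X s @\<^sub>v Y s) = ?p"
      using Jb_W_transpose[OF elim p] by simp
    then show ?case
      using Hbar_blocks[OF elim Xs Ys] Hbar_Ham[OF elim append_carrier_n[OF Xs Ys]] by simp
  qed
  ultimately have "((\<lambda>s. Ham M V (c s, ?p)) has_real_derivative
      (1 / 2 * (X 0 \<bullet> (S' *\<^sub>v X 0)) + (?At *\<^sub>v ?u) \<bullet> (S (c 0) *\<^sub>v X 0)) +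
        (1 / 2 * (Y 0 \<bullet> (R' *\<^sub>v Y 0)) + (?An *\<^sub>v ?u) \<bullet> (minv (R (c 0)) *\<^sub>v Y 0)) + V') (at 0)"
    by (rule DERIV_cong_eventually[THEN iffD1, rotated])
  then have "deriv (\<lambda>s. Ham M V (c s, ?p)) 0 = (1 / 2 * (x \<bullet> (S' *\<^sub>v x)) + ?a) + (1 / 2 * (y \<bullet> (R' *\<^sub>v y)) + ?b) + V'"
    unfolding X0 Y0 c0 by (rule DERIV_imp_deriv)
  then have LHS: "grad (\<lambda>r. Ham M V (r, ?p)) q $ i = ?D + (?a + ?b)"
    using i qc by (simp add: grad_def partial_deriv_def c_def)
  \<comment> \<open>Along the same line the momenta now stay at \<open>x\<close> and
    \<open>y\<close>, so only the coefficients and the potential vary.\<close>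
  have "((\<lambda>s. 1 / 2 * (x \<bullet> (S (c s) *\<^sub>v x)) + 1 / 2 * (y \<bullet> (minv (R (c s)) *\<^sub>v y)) + V (c s))
      has_real_derivative (1 / 2 * (x \<bullet> (S' *\<^sub>v x)) + 0\<^sub>v m \<bullet> (S (c 0) *\<^sub>v x)) +
        (1 / 2 * (y \<bullet> (R' *\<^sub>v y)) + 0\<^sub>v (n - m) \<bullet> (minv (R (c 0)) *\<^sub>v y)) + V') (at 0)"
    using DERIV_quadratic_form[OF dS symS has_vec_deriv_on_const[OF x]]
      DERIV_quadratic_form[OF dR symR has_vec_deriv_on_const[OF y]] dV
    by (intro DERIV_add)
  moreover have "\<forall>\<^sub>F s in nhds 0. 1 / 2 * (x \<bullet> (S (c s) *\<^sub>v x)) +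
      1 / 2 * (y \<bullet> (minv (R (c s)) *\<^sub>v y)) + V (c s) = Hbar n U M V J Z (c s, ?e)"
    using ev by eventually_elim (rule Hbar_blocks[OF _ x y, symmetric])
  ultimately have "((\<lambda>s. Hbar n U M V J Z (c s, ?e)) has_real_derivative
      (1 / 2 * (x \<bullet> (S' *\<^sub>v x)) + 0\<^sub>v m \<bullet> (S (c 0) *\<^sub>v x)) +
        (1 / 2 * (y \<bullet> (R' *\<^sub>v y)) + 0\<^sub>v (n - m) \<bullet> (minv (R (c 0)) *\<^sub>v y)) + V') (at 0)"
    by (rule DERIV_cong_eventually[THEN iffD1, rotated])
  then have "deriv (\<lambda>s. Hbar n U M V J Z (c s, ?e)) 0 = ?D"
    unfolding c0 scalar_prod_left_zero[OF Sx] scalar_prod_left_zero[OF Ry] add_0_right by (rule DERIV_imp_deriv)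
  then have RHS: "grad (\<lambda>r. Hbar n U M V J Z (r, ?e)) q $ i = ?D"
    using i qc by (simp add: grad_def partial_deriv_def c_def)
  \<comment> \<open>Moving the matrix to the other factor leaves a pairing with the unit vector,
    which selects component \<open>i\<close>.\<close>
  have "?a = (?At\<^sup>T *\<^sub>v (S q *\<^sub>v x)) $ i"
    using transpose_vec_mult_scalar[OF At_carrier[OF q] u Sx] comm_scalar_prod[OF Atu Sx]
      scalar_prod_right_unit[OF i, of "?At\<^sup>T *\<^sub>v (S q *\<^sub>v x)"] carrier_vecD[OF AtT] by simp
  moreover have "?b = (?An\<^sup>T *\<^sub>v (minv (R q) *\<^sub>v y)) $ i"
    using transpose_vec_mult_scalar[OF An_carrier[OF q] u Ry] comm_scalar_prod[OF Anu Ry]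
      scalar_prod_right_unit[OF i, of "?An\<^sup>T *\<^sub>v (minv (R q) *\<^sub>v y)"] carrier_vecD[OF AnT] by simp
  ultimately show "grad (\<lambda>r. Ham M V (r, ?p)) q $ i =
      (grad (\<lambda>r. Hbar n U M V J Z (r, ?e)) q +
        (?At\<^sup>T *\<^sub>v (S q *\<^sub>v x) + ?An\<^sup>T *\<^sub>v (minv (R q) *\<^sub>v y))) $ i"
    unfolding LHS using RHS i carrier_vecD[OF AtT] carrier_vecD[OF AnT] by simp
qed

section \<open>The structure matrix and the transformed vector field\<close>

lemma G11_carrier: "q \<in> U \<Longrightarrow> G11 M J Z q e \<in> carrier_mat m m"
  unfolding G11_def using mult_carrier_mat[OF JsT_carrier, of q "(A_t M J Z q e)\<^sup>T" m] At_carrier[of q e]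
  by (intro minus_carrier_mat) simp

lemma G12_carrier: "q \<in> U \<Longrightarrow> G12 M J Z q e \<in> carrier_mat m (n - m)"
  unfolding G12_def using mult_carrier_mat[OF JsT_carrier, of q "(A_n M J Z q e)\<^sup>T" "n - m"] An_carrier[of q e]
  by (intro minus_carrier_mat) simp

lemma G22_carrier: "q \<in> U \<Longrightarrow> G22 M J Z q e \<in> carrier_mat (n - m) (n - m)"
  unfolding G22_def using mult_carrier_mat[OF Z_carrier, of q "(A_n M J Z q e)\<^sup>T" "n - m"] An_carrier[of q e]
  by (intro minus_carrier_mat) simp

lemma G11_skew:
  assumes q: "q \<in> U"
  shows "G11 M J Z q e = - (G11 M J Z q e)\<^sup>T"
  unfolding G11_def by (rule skew_symmetric_diff[OF At_carrier[OF q] Js_carrier[OF q]])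

lemma G22_skew:
  assumes q: "q \<in> U"
  shows "G22 M J Z q e = - (G22 M J Z q e)\<^sup>T"
  using skew_symmetric_diff[OF An_carrier[OF q] ZT_carrier[OF q]] by (simp add: G22_def)

lemma struct_mat_mult:
  assumes q: "q \<in> U" and g: "g \<in> carrier_vec n" and a: "a \<in> carrier_vec m" and b: "b \<in> carrier_vec (n - m)"
  shows "struct_mat M J Z q e *\<^sub>v (g @\<^sub>v a @\<^sub>v b) =
    (Js q *\<^sub>v a + (Z q)\<^sup>T *\<^sub>v b)
    @\<^sub>v (- ((Js q)\<^sup>T *\<^sub>v g) + (G11 M J Z q e *\<^sub>v a + G12 M J Z q e *\<^sub>v b))
    @\<^sub>v (- (Z q *\<^sub>v g) + (- ((G12 M J Z q e)\<^sup>T *\<^sub>v a) + G22 M J Z q e *\<^sub>v b))"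
proof -
  let ?G11 = "G11 M J Z q e" and ?G12 = "G12 M J Z q e" and ?G22 = "G22 M J Z q e"
  let ?v = "g @\<^sub>v a @\<^sub>v b" and ?N = "n + (m + (n - m))"
  have dq: "dim_vec q = n" using U_carrier[OF q] by simp
  have v: "?v \<in> carrier_vec ?N" using g a b by simp
  note C = Js_carrier[OF q] ZT_carrier[OF q] uminus_carrier_mat[OF JsT_carrier[OF q]] G11_carrier[OF q, of e]
    G12_carrier[OF q, of e] uminus_carrier_mat[OF Z_carrier[OF q]] G22_carrier[OF q, of e]
  have G12T: "- ?G12\<^sup>T \<in> carrier_mat (n - m) m" using C(5) by simp
  let ?r1 = "0\<^sub>m n n @\<^sub>c Js q @\<^sub>c (Z q)\<^sup>T"
  let ?r2 = "- (Js q)\<^sup>T @\<^sub>c ?G11 @\<^sub>c ?G12"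
  let ?r3 = "- Z q @\<^sub>c - ?G12\<^sup>T @\<^sub>c ?G22"
  have r1: "?r1 \<in> carrier_mat n ?N" by (intro append_cols_carrier zero_carrier_mat C)
  have r2: "?r2 \<in> carrier_mat m ?N" by (intro append_cols_carrier C)
  have r3: "?r3 \<in> carrier_mat (n - m) ?N" by (intro append_cols_carrier C G12T)
  have "Js q *\<^sub>v a + (Z q)\<^sup>T *\<^sub>v b \<in> carrier_vec n"
    using mult_mat_vec_carrier[OF C(1) a] mult_mat_vec_carrier[OF C(2) b] by simp
  then have "?r1 *\<^sub>v ?v = Js q *\<^sub>v a + (Z q)\<^sup>T *\<^sub>v b"
    using append_cols3_mult_vec[OF zero_carrier_mat[of n n] C(1,2) g a b] zero_mat_mult_vec[OF g, of n] by simp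
  moreover have "?r2 *\<^sub>v ?v = - ((Js q)\<^sup>T *\<^sub>v g) + (?G11 *\<^sub>v a + ?G12 *\<^sub>v b)"
    using append_cols3_mult_vec[OF C(3,4,5) g a b] uminus_mult_mat_vec[of g "(Js q)\<^sup>T"]
      Js_carrier[OF q] g by simp
  moreover have "?r3 *\<^sub>v ?v = - (Z q *\<^sub>v g) + (- (?G12\<^sup>T *\<^sub>v a) + ?G22 *\<^sub>v b)"
    using append_cols3_mult_vec[OF C(6) G12T C(7) g a b] uminus_mult_mat_vec[of g "Z q"]
      uminus_mult_mat_vec[of a "?G12\<^sup>T"] Z_carrier[OF q] C(5) g a by simp
  moreover have "struct_mat M J Z q e *\<^sub>v ?v = ?r1 *\<^sub>v ?v @\<^sub>v ?r2 *\<^sub>v ?v @\<^sub>v ?r3 *\<^sub>v ?v"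
    unfolding struct_mat_def dq
    using mat_mult_append[OF r1 carrier_append_rows[OF r2 r3] v] mat_mult_append[OF r2 r3 v] by simp
  ultimately show ?thesis by simp
qed

lemma grad_carrier: "q \<in> U \<Longrightarrow> grad f q \<in> carrier_vec n"
  using U_carrier[of q] by (intro carrier_vecI) (simp add: grad_def)

text \<open>The port-Hamiltonian vector field is the image of the canonical one: \<open>h\<close> is
  the canonical \<open>q'\<close>, \<open>f\<close> is the canonical \<open>p'\<close>, and the
  right-hand side is what the product rule gives for the stacked curve. The momentum gradients of
  \<open>Hbar\<close> appear already evaluated as \<open>S x\<close> and
  \<open>R^-1 y\<close>.\<close>

lemma port_Hamiltonian_rhs:
  assumes q: "q \<in> U" and x: "x \<in> carrier_vec m" and y: "y \<in> carrier_vec (n - m)"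
    and \<tau>: "\<tau> \<in> carrier_vec n"
  defines "e \<equiv> x @\<^sub>v y"
  defines "p \<equiv> (Jb q)\<^sup>T *\<^sub>v e"
  defines "h \<equiv> Mi q *\<^sub>v p"
  defines "f \<equiv> - grad (\<lambda>r. Ham M V (r, p)) q + \<tau>"
  shows "struct_mat M J Z q e *\<^sub>v
      (grad (\<lambda>r. Hbar n U M V J Z (r, e)) q @\<^sub>v S q *\<^sub>v x @\<^sub>v minv (R q) *\<^sub>v y)
      + (0\<^sub>v n @\<^sub>v (Js q)\<^sup>T *\<^sub>v \<tau> @\<^sub>v 0\<^sub>v (n - m)) + (0\<^sub>v n @\<^sub>v 0\<^sub>v m @\<^sub>v Z q *\<^sub>v \<tau>) =
    h @\<^sub>v (A_t M J Z q e *\<^sub>v h + (Js q)\<^sup>T *\<^sub>v f) @\<^sub>v (A_n M J Z q e *\<^sub>v h + Z q *\<^sub>v f)"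
proof -
  let ?g = "grad (\<lambda>r. Hbar n U M V J Z (r, e)) q"
  let ?At = "A_t M J Z q e" and ?An = "A_n M J Z q e"
  define \<eta> where "\<eta> = S q *\<^sub>v x"
  define \<nu> where "\<nu> = minv (R q) *\<^sub>v y"
  have \<eta>: "\<eta> \<in> carrier_vec m" unfolding \<eta>_def by (rule mult_mat_vec_carrier[OF S_carrier[OF q] x])
  have \<nu>: "\<nu> \<in> carrier_vec (n - m)" unfolding \<nu>_def by (rule mult_mat_vec_carrier[OF Ri_carrier[OF q] y])
  have g: "?g \<in> carrier_vec n" by (rule grad_carrier[OF q])
  note At = At_carrier[OF q, of e] and An = An_carrier[OF q, of e]
  have AtT: "?At\<^sup>T \<in> carrier_mat n m" and AnT: "?An\<^sup>T \<in> carrier_mat n (n - m)" using At An by simp_all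
  note Js\<eta> = mult_mat_vec_carrier[OF Js_carrier[OF q] \<eta>] and ZT\<nu> = mult_mat_vec_carrier[OF ZT_carrier[OF q] \<nu>]
    and At\<eta> = mult_mat_vec_carrier[OF AtT \<eta>] and An\<nu> = mult_mat_vec_carrier[OF AnT \<nu>]
  have h: "h = Js q *\<^sub>v \<eta> + (Z q)\<^sup>T *\<^sub>v \<nu>"
    using velocity_from_momenta(3)[OF q x y] by (simp add: h_def p_def e_def \<eta>_def \<nu>_def)
  then have hc: "h \<in> carrier_vec n" using Js\<eta> ZT\<nu> by simp
  have gH: "grad (\<lambda>r. Ham M V (r, p)) q = ?g + (?At\<^sup>T *\<^sub>v \<eta> + ?An\<^sup>T *\<^sub>v \<nu>)"
    unfolding p_def e_def \<eta>_def \<nu>_def by (rule grad_Ham_position[OF q x y])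
  have G11: "G11 M J Z q e *\<^sub>v \<eta> = ?At *\<^sub>v (Js q *\<^sub>v \<eta>) - (Js q)\<^sup>T *\<^sub>v (?At\<^sup>T *\<^sub>v \<eta>)"
    unfolding G11_def
    using minus_mult_distrib_mat_vec[OF mult_carrier_mat[OF At Js_carrier[OF q]] mult_carrier_mat[OF JsT_carrier[OF q] AtT] \<eta>]
      assoc_mult_mat_vec[OF At Js_carrier[OF q] \<eta>] assoc_mult_mat_vec[OF JsT_carrier[OF q] AtT \<eta>] by simp
  have G12: "G12 M J Z q e *\<^sub>v \<nu> = ?At *\<^sub>v ((Z q)\<^sup>T *\<^sub>v \<nu>) - (Js q)\<^sup>T *\<^sub>v (?An\<^sup>T *\<^sub>v \<nu>)"
    unfolding G12_def
    using minus_mult_distrib_mat_vec[OF mult_carrier_mat[OF At ZT_carrier[OF q]] mult_carrier_mat[OF JsT_carrier[OF q] AnT] \<nu>]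
      assoc_mult_mat_vec[OF At ZT_carrier[OF q] \<nu>] assoc_mult_mat_vec[OF JsT_carrier[OF q] AnT \<nu>] by simp
  have G22: "G22 M J Z q e *\<^sub>v \<nu> = ?An *\<^sub>v ((Z q)\<^sup>T *\<^sub>v \<nu>) - Z q *\<^sub>v (?An\<^sup>T *\<^sub>v \<nu>)"
    unfolding G22_def
    using minus_mult_distrib_mat_vec[OF mult_carrier_mat[OF An ZT_carrier[OF q]] mult_carrier_mat[OF Z_carrier[OF q] AnT] \<nu>]
      assoc_mult_mat_vec[OF An ZT_carrier[OF q] \<nu>] assoc_mult_mat_vec[OF Z_carrier[OF q] AnT \<nu>] by simp
  \<comment> \<open>Transposition exchanges the roles of the two terms of \<open>G12\<close>;
    negated, this is the lower left block of \<open>A W - W^T A^T\<close>.\<close>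
  have "(G12 M J Z q e)\<^sup>T = Z q * ?At\<^sup>T - ?An * Js q"
    unfolding G12_def
    using transpose_minus[OF mult_carrier_mat[OF At ZT_carrier[OF q]] mult_carrier_mat[OF JsT_carrier[OF q] AnT]]
      transpose_mult[OF At ZT_carrier[OF q]] transpose_mult[OF JsT_carrier[OF q] AnT] by simp
  then have G12T: "(G12 M J Z q e)\<^sup>T *\<^sub>v \<eta> = Z q *\<^sub>v (?At\<^sup>T *\<^sub>v \<eta>) - ?An *\<^sub>v (Js q *\<^sub>v \<eta>)"
    using minus_mult_distrib_mat_vec[OF mult_carrier_mat[OF Z_carrier[OF q] AtT] mult_carrier_mat[OF An Js_carrier[OF q]] \<eta>]
      assoc_mult_mat_vec[OF Z_carrier[OF q] AtT \<eta>] assoc_mult_mat_vec[OF An Js_carrier[OF q] \<eta>] by simp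
  \<comment> \<open>Substituting the gradient identity into \<open>f\<close> produces the terms with
    \<open>A_t^T\<close> and \<open>A_n^T\<close>, the subtracted halves of the gyroscopic blocks.
    The halves with \<open>A_t\<close> and \<open>A_n\<close> in front come from
    \<open>linh\<close>.\<close>
  have lin: "A *\<^sub>v f = - (A *\<^sub>v ?g + (A *\<^sub>v (?At\<^sup>T *\<^sub>v \<eta>) + A *\<^sub>v (?An\<^sup>T *\<^sub>v \<nu>))) + A *\<^sub>v \<tau>"
    if A: "A \<in> carrier_mat k n" for A k
  proof -
    have s: "?At\<^sup>T *\<^sub>v \<eta> + ?An\<^sup>T *\<^sub>v \<nu> \<in> carrier_vec n" using At\<eta> An\<nu> by simp
    show ?thesis
      unfolding f_def gH
      using mult_mat_vec_residual[OF A _ \<tau>, of "?g + (?At\<^sup>T *\<^sub>v \<eta> + ?An\<^sup>T *\<^sub>v \<nu>)"] g s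
        mult_add_distrib_mat_vec[OF A g s] mult_add_distrib_mat_vec[OF A At\<eta> An\<nu>] by simp
  qed
  have linh: "A *\<^sub>v h = A *\<^sub>v (Js q *\<^sub>v \<eta>) + A *\<^sub>v ((Z q)\<^sup>T *\<^sub>v \<nu>)" if A: "A \<in> carrier_mat k n" for A k
    unfolding h by (rule mult_add_distrib_mat_vec[OF A Js\<eta> ZT\<nu>])
  let ?r2 = "- ((Js q)\<^sup>T *\<^sub>v ?g) + (G11 M J Z q e *\<^sub>v \<eta> + G12 M J Z q e *\<^sub>v \<nu>)"
  let ?r3 = "- (Z q *\<^sub>v ?g) + (- ((G12 M J Z q e)\<^sup>T *\<^sub>v \<eta>) + G22 M J Z q e *\<^sub>v \<nu>)"
  note c2 = mult_mat_vec_carrier[OF JsT_carrier[OF q]] and c3 = mult_mat_vec_carrier[OF Z_carrier[OF q]]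
  have r2: "?r2 + (Js q)\<^sup>T *\<^sub>v \<tau> = ?At *\<^sub>v h + (Js q)\<^sup>T *\<^sub>v f"
    unfolding G11 G12 lin[OF JsT_carrier[OF q]] linh[OF At]
    by (rule gyroscopic_sum_task[OF c2[OF g] mult_mat_vec_carrier[OF At Js\<eta>] mult_mat_vec_carrier[OF At ZT\<nu>]
          c2[OF At\<eta>] c2[OF An\<nu>] c2[OF \<tau>]])
  have r3: "?r3 + Z q *\<^sub>v \<tau> = ?An *\<^sub>v h + Z q *\<^sub>v f"
    unfolding G22 G12T lin[OF Z_carrier[OF q]] linh[OF An]
    by (rule gyroscopic_sum_null[OF c3[OF g] mult_mat_vec_carrier[OF An Js\<eta>] mult_mat_vec_carrier[OF An ZT\<nu>]
          c3[OF At\<eta>] c3[OF An\<nu>] c3[OF \<tau>]])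
  have G12Tc: "(G12 M J Z q e)\<^sup>T \<in> carrier_mat (n - m) m" using G12_carrier[OF q, of e] by simp
  have r2c: "?r2 \<in> carrier_vec m"
    using c2[OF g] mult_mat_vec_carrier[OF G11_carrier[OF q] \<eta>] mult_mat_vec_carrier[OF G12_carrier[OF q] \<nu>] by simp
  have r3c: "?r3 \<in> carrier_vec (n - m)"
    using c3[OF g] mult_mat_vec_carrier[OF G12Tc \<eta>] mult_mat_vec_carrier[OF G22_carrier[OF q] \<nu>] by simp
  have "struct_mat M J Z q e *\<^sub>v (?g @\<^sub>v \<eta> @\<^sub>v \<nu>) = h @\<^sub>v ?r2 @\<^sub>v ?r3"
    unfolding h by (rule struct_mat_mult[OF q g \<eta> \<nu>])
  moreover have "(h @\<^sub>v ?r2 @\<^sub>v ?r3) + (0\<^sub>v n @\<^sub>v (Js q)\<^sup>T *\<^sub>v \<tau> @\<^sub>v 0\<^sub>v (n - m)) =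
      h @\<^sub>v (?r2 + (Js q)\<^sup>T *\<^sub>v \<tau>) @\<^sub>v ?r3"
    using append_vec_add[OF hc zero_carrier_vec append_carrier_vec[OF r2c r3c]
        append_carrier_vec[OF c2[OF \<tau>] zero_carrier_vec]]
      append_vec_add[OF r2c c2[OF \<tau>] r3c zero_carrier_vec] hc r3c by simp
  moreover have "(h @\<^sub>v (?r2 + (Js q)\<^sup>T *\<^sub>v \<tau>) @\<^sub>v ?r3) + (0\<^sub>v n @\<^sub>v 0\<^sub>v m @\<^sub>v Z q *\<^sub>v \<tau>) =
      h @\<^sub>v (?r2 + (Js q)\<^sup>T *\<^sub>v \<tau>) @\<^sub>v (?r3 + Z q *\<^sub>v \<tau>)"
  proof -
    have r2c': "?r2 + (Js q)\<^sup>T *\<^sub>v \<tau> \<in> carrier_vec m" using r2c c2[OF \<tau>] by simp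
    show ?thesis
      using append_vec_add[OF hc zero_carrier_vec append_carrier_vec[OF r2c' r3c]
          append_carrier_vec[OF zero_carrier_vec c3[OF \<tau>]]]
        append_vec_add[OF r2c' zero_carrier_vec r3c c3[OF \<tau>]] hc r2c' by simp
  qed
  ultimately show ?thesis unfolding r2 r3 by (simp only: \<eta>_def[symmetric] \<nu>_def[symmetric])
qed

lemma grad_Ham_momentum:
  assumes q: "q \<in> U" and p: "p \<in> carrier_vec n"
  shows "grad (\<lambda>y. Ham M V (q, y)) p = Mi q *\<^sub>v p"
  by (rule grad_quadratic_form[OF Mi_carrier[OF q] Mi_sym[OF q] p]) (simp add: Ham_def)

lemma grad_Hbar_task:
  assumes q: "q \<in> U" and x: "x \<in> carrier_vec m" and y: "y \<in> carrier_vec (n - m)"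
  shows "grad (\<lambda>x. Hbar n U M V J Z (q, x @\<^sub>v y)) x = S q *\<^sub>v x"
  by (rule grad_quadratic_form[OF S_carrier[OF q] S_sym[OF q] x,
        where b = "1 / 2 * (y \<bullet> (minv (R q) *\<^sub>v y)) + V q"])
    (simp only: Hbar_blocks[OF q _ y] add.assoc)

lemma grad_Hbar_null:
  assumes q: "q \<in> U" and x: "x \<in> carrier_vec m" and y: "y \<in> carrier_vec (n - m)"
  shows "grad (\<lambda>y. Hbar n U M V J Z (q, x @\<^sub>v y)) y = minv (R q) *\<^sub>v y"
  by (rule grad_quadratic_form[OF Ri_carrier[OF q] Ri_sym[OF q] y,
        where b = "1 / 2 * (x \<bullet> (S q *\<^sub>v x)) + V q"])
    (simp only: Hbar_blocks[OF q x] add.assoc add.left_commute)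

end

section \<open>Trajectories\<close>

text \<open>The old and new momenta are tied pointwise by \<open>Phi\<close>, without
  differentiability of either, because each side of the equivalence asserts differentiability in its
  own coordinates only.\<close>

locale task_curve = task_system +
  fixes T :: "real set" and q p \<tau> \<pi> \<pi>\<^sub>\<nu> :: "real \<Rightarrow> real vec"
  assumes open_T: "open T"
    and curve: "\<And>t. t \<in> T \<Longrightarrow> q t \<in> U \<and> p t \<in> carrier_vec n \<and> \<tau> t \<in> carrier_vec n \<and>
      \<pi> t \<in> carrier_vec m \<and> \<pi>\<^sub>\<nu> t \<in> carrier_vec (n - m) \<and>
      Phi M J Z (q t, p t) = (q t, \<pi> t @\<^sub>v \<pi>\<^sub>\<nu> t)"
begin

lemma momenta:
  assumes t: "t \<in> T"
  shows "(Js (q t))\<^sup>T *\<^sub>v p t = \<pi> t" "Z (q t) *\<^sub>v p t = \<pi>\<^sub>\<nu> t"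
    "(Jb (q t))\<^sup>T *\<^sub>v (\<pi> t @\<^sub>v \<pi>\<^sub>\<nu> t) = p t"
    "(J (q t))\<^sup>T *\<^sub>v \<pi> t + (N (q t))\<^sup>T *\<^sub>v \<pi>\<^sub>\<nu> t = p t"
proof -
  note c = curve[OF t]
  have q: "q t \<in> U" and p: "p t \<in> carrier_vec n" and x: "\<pi> t \<in> carrier_vec m"
    and y: "\<pi>\<^sub>\<nu> t \<in> carrier_vec (n - m)" using c by auto
  have W: "(W (q t))\<^sup>T *\<^sub>v p t = \<pi> t @\<^sub>v \<pi>\<^sub>\<nu> t" using c Phi_eq[OF q] by simp
  then have "(Js (q t))\<^sup>T *\<^sub>v p t @\<^sub>v Z (q t) *\<^sub>v p t = \<pi> t @\<^sub>v \<pi>\<^sub>\<nu> t"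
    unfolding W_transpose_mult[OF q p] .
  then show "(Js (q t))\<^sup>T *\<^sub>v p t = \<pi> t" "Z (q t) *\<^sub>v p t = \<pi>\<^sub>\<nu> t"
    using append_vec_eq[OF mult_mat_vec_carrier[OF JsT_carrier[OF q] p] x] by auto
  show "(Jb (q t))\<^sup>T *\<^sub>v (\<pi> t @\<^sub>v \<pi>\<^sub>\<nu> t) = p t"
    using Jb_W_transpose[OF q p] unfolding W .
  then show "(J (q t))\<^sup>T *\<^sub>v \<pi> t + (N (q t))\<^sup>T *\<^sub>v \<pi>\<^sub>\<nu> t = p t"
    unfolding Jb_transpose_mult[OF q x y] .
qed

text \<open>The relations \<open>\<pi> = Js^T p\<close> and \<open>\<pi>\<^sub>\<nu> = Z p\<close>
  hold on all of the open set \<open>T\<close> and can therefore be differentiated at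
  \<open>t\<close>. Since \<open>p = Jb^T (\<pi>, \<pi>\<^sub>\<nu>)\<close>, the terms with
  \<open>p\<close> frozen are exactly \<open>A_t\<close> and \<open>A_n\<close>.\<close>

lemma momentum_deriv:
  assumes t: "t \<in> T" and q': "has_vec_deriv q q' t" and p': "has_vec_deriv_on n p p' t"
  shows "has_vec_deriv_on m \<pi> (A_t M J Z (q t) (\<pi> t @\<^sub>v \<pi>\<^sub>\<nu> t) *\<^sub>v q' + (Js (q t))\<^sup>T *\<^sub>v p') t"
    and "has_vec_deriv_on (n - m) \<pi>\<^sub>\<nu> (A_n M J Z (q t) (\<pi> t @\<^sub>v \<pi>\<^sub>\<nu> t) *\<^sub>v q' + Z (q t) *\<^sub>v p') t"
proof -
  have q: "q t \<in> U" using curve[OF t] by blast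
  have ev: "\<forall>\<^sub>F s in nhds t. q s \<in> U"
    by (rule eventually_in_open[OF open_T t]) (use curve in blast)
  show "has_vec_deriv_on m \<pi> (A_t M J Z (q t) (\<pi> t @\<^sub>v \<pi>\<^sub>\<nu> t) *\<^sub>v q' + (Js (q t))\<^sup>T *\<^sub>v p') t"
    unfolding A_t_def momenta(3)[OF t]
    by (rule has_vec_deriv_on_cong[OF curve_diff_mat_mult_vec_chain[OF open_U curve_diff_JsT[OF q] q' ev p']])
      (rule eventually_in_open[OF open_T t momenta(1)])
  show "has_vec_deriv_on (n - m) \<pi>\<^sub>\<nu> (A_n M J Z (q t) (\<pi> t @\<^sub>v \<pi>\<^sub>\<nu> t) *\<^sub>v q' + Z (q t) *\<^sub>v p') t"
    unfolding A_n_def momenta(3)[OF t]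
    by (rule has_vec_deriv_on_cong[OF curve_diff_mat_mult_vec_chain[OF open_U curve_diff_Z[OF q] q' ev p']])
      (rule eventually_in_open[OF open_T t momenta(2)])
qed

text \<open>\<open>p = J^T \<pi> + N^T \<pi>\<^sub>\<nu>\<close> is assembled from differentiable
  curves. The value of the derivative is left open here; the equivalence below determines it by
  uniqueness.\<close>

lemma momentum_differentiable:
  assumes t: "t \<in> T" and q': "has_vec_deriv q q' t"
    and x': "has_vec_deriv_on m \<pi> x' t" and y': "has_vec_deriv_on (n - m) \<pi>\<^sub>\<nu> y' t"
  shows "\<exists>p'. has_vec_deriv_on n p p' t"
proof -
  have q: "q t \<in> U" using curve[OF t] by blast
  have ev: "\<forall>\<^sub>F s in nhds t. q s \<in> U"
    by (rule eventually_in_open[OF open_T t]) (use curve in blast)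
  obtain a where a: "has_vec_deriv_on n (\<lambda>s. (J (q s))\<^sup>T *\<^sub>v \<pi> s) a t"
    using curve_diff_mat_mult_vec_chain[OF open_U curve_diff_mat_transpose[OF curve_diff_J[OF q]] q' ev x'] by blast
  obtain b where b: "has_vec_deriv_on n (\<lambda>s. (N (q s))\<^sup>T *\<^sub>v \<pi>\<^sub>\<nu> s) b t"
    using curve_diff_mat_mult_vec_chain[OF open_U curve_diff_mat_transpose[OF curve_diff_N[OF q]] q' ev y'] by blast
  have "has_vec_deriv_on n (\<lambda>s. (J (q s))\<^sup>T *\<^sub>v \<pi> s + (N (q s))\<^sup>T *\<^sub>v \<pi>\<^sub>\<nu> s) (a + b) t"
    by (rule has_vec_deriv_on_add[OF a b])
  from has_vec_deriv_on_cong[OF this eventually_in_open[OF open_T t momenta(4)]]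
  show ?thesis by blast
qed

lemma Hamiltonian_iff_port_Hamiltonian:
  assumes t: "t \<in> T"
  defines "h \<equiv> Mi (q t) *\<^sub>v p t" and "f \<equiv> - grad (\<lambda>x. Ham M V (x, p t)) (q t) + \<tau> t"
  defines "e \<equiv> \<pi> t @\<^sub>v \<pi>\<^sub>\<nu> t"
  shows "has_vec_deriv q h t \<and> has_vec_deriv p f t \<longleftrightarrow>
    has_vec_deriv (\<lambda>s. q s @\<^sub>v \<pi> s @\<^sub>v \<pi>\<^sub>\<nu> s)
      (h @\<^sub>v (A_t M J Z (q t) e *\<^sub>v h + (Js (q t))\<^sup>T *\<^sub>v f) @\<^sub>v (A_n M J Z (q t) e *\<^sub>v h + Z (q t) *\<^sub>v f)) t"
    (is "_ \<longleftrightarrow> has_vec_deriv _ (h @\<^sub>v ?x @\<^sub>v ?y) t")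
proof -
  have q: "q t \<in> U" and p: "p t \<in> carrier_vec n" and \<tau>: "\<tau> t \<in> carrier_vec n"
    using curve[OF t] by auto
  have evq: "\<forall>\<^sub>F s in nhds t. q s \<in> carrier_vec n"
    by (rule eventually_in_open[OF open_T t]) (use curve U_carrier in blast)
  have evp: "\<forall>\<^sub>F s in nhds t. p s \<in> carrier_vec n"
    by (rule eventually_in_open[OF open_T t]) (use curve in blast)
  have evx: "\<forall>\<^sub>F s in nhds t. \<pi> s \<in> carrier_vec m"
    by (rule eventually_in_open[OF open_T t]) (use curve in blast)
  have evy: "\<forall>\<^sub>F s in nhds t. \<pi>\<^sub>\<nu> s \<in> carrier_vec (n - m)"
    by (rule eventually_in_open[OF open_T t]) (use curve in blast)
  have evxy: "\<forall>\<^sub>F s in nhds t. \<pi> s @\<^sub>v \<pi>\<^sub>\<nu> s \<in> carrier_vec (m + (n - m))"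
    using evx evy by eventually_elim (rule append_carrier_vec)
  have h: "h \<in> carrier_vec n" unfolding h_def by (rule mult_mat_vec_carrier[OF Mi_carrier[OF q] p])
  have f: "f \<in> carrier_vec n" using grad_carrier[OF q] \<tau> by (simp add: f_def)
  have Ath: "A_t M J Z (q t) e *\<^sub>v h \<in> carrier_vec m" by (rule mult_mat_vec_carrier[OF At_carrier[OF q] h])
  have Anh: "A_n M J Z (q t) e *\<^sub>v h \<in> carrier_vec (n - m)" by (rule mult_mat_vec_carrier[OF An_carrier[OF q] h])
  have x: "?x \<in> carrier_vec m" using Ath mult_mat_vec_carrier[OF JsT_carrier[OF q] f] by simp
  have y: "?y \<in> carrier_vec (n - m)" using Anh mult_mat_vec_carrier[OF Z_carrier[OF q] f] by simp
  note d = momentum_deriv[OF t, folded e_def]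
  have "has_vec_deriv (\<lambda>s. q s @\<^sub>v \<pi> s @\<^sub>v \<pi>\<^sub>\<nu> s) (h @\<^sub>v ?x @\<^sub>v ?y) t \<longleftrightarrow>
      has_vec_deriv q h t \<and> has_vec_deriv_on m \<pi> ?x t \<and> has_vec_deriv_on (n - m) \<pi>\<^sub>\<nu> ?y t"
    unfolding has_vec_deriv_append_iff[OF evq evxy h append_carrier_vec[OF x y]]
      has_vec_deriv_append_iff[OF evx evy x y] has_vec_deriv_on_iff[OF evx] has_vec_deriv_on_iff[OF evy] ..
  \<comment> \<open>The position equation is common to both systems, so the momentum equations are
    compared under \<open>q' = h\<close>.\<close>
  moreover have "has_vec_deriv_on m \<pi> ?x t \<and> has_vec_deriv_on (n - m) \<pi>\<^sub>\<nu> ?y t \<longleftrightarrow> has_vec_deriv_on n p f t"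
    if dq: "has_vec_deriv q h t"
  proof
    assume xy: "has_vec_deriv_on m \<pi> ?x t \<and> has_vec_deriv_on (n - m) \<pi>\<^sub>\<nu> ?y t"
    then obtain p' where p': "has_vec_deriv_on n p p' t"
      using momentum_differentiable[OF t dq] by blast
    then have p'c: "p' \<in> carrier_vec n" unfolding has_vec_deriv_on_def by blast
    have "A_t M J Z (q t) e *\<^sub>v h + (Js (q t))\<^sup>T *\<^sub>v p' = ?x"
      by (rule has_vec_deriv_on_unique[OF d(1)[OF dq p'] conjunct1[OF xy]])
    then have 1: "(Js (q t))\<^sup>T *\<^sub>v p' = (Js (q t))\<^sup>T *\<^sub>v f"
      by (rule add_vec_left_cancel[OF Ath mult_mat_vec_carrier[OF JsT_carrier[OF q] p'c]
            mult_mat_vec_carrier[OF JsT_carrier[OF q] f]])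
    have "A_n M J Z (q t) e *\<^sub>v h + Z (q t) *\<^sub>v p' = ?y"
      by (rule has_vec_deriv_on_unique[OF d(2)[OF dq p'] conjunct2[OF xy]])
    then have 2: "Z (q t) *\<^sub>v p' = Z (q t) *\<^sub>v f"
      by (rule add_vec_left_cancel[OF Anh mult_mat_vec_carrier[OF Z_carrier[OF q] p'c]
            mult_mat_vec_carrier[OF Z_carrier[OF q] f]])
    \<comment> \<open>Equal images under \<open>Js^T\<close> and \<open>Z\<close> mean equal
      vectors, which is injectivity of \<open>W^T\<close>.\<close>
    have "p' = f" using force_split[OF q p'c] force_split[OF q f] unfolding 1 2 by simp
    then show "has_vec_deriv_on n p f t" using p' by simp
  qed (use d[OF dq] in blast)
  ultimately show ?thesis unfolding has_vec_deriv_on_iff[OF evp] by blast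
qed

lemma solution_iff:
  "ham_solution M V T q p \<tau> \<longleftrightarrow>
    ph_solution M J Z (Hbar n U M V J Z) T q \<pi> \<pi>\<^sub>\<nu> (\<lambda>t. (Js (q t))\<^sup>T *\<^sub>v \<tau> t) (\<lambda>t. Z (q t) *\<^sub>v \<tau> t)"
  unfolding ham_solution_def ph_solution_def
proof (rule ball_cong[OF refl])
  fix t assume t: "t \<in> T"
  have q: "q t \<in> U" and p: "p t \<in> carrier_vec n" and \<tau>: "\<tau> t \<in> carrier_vec n"
    and x: "\<pi> t \<in> carrier_vec m" and y: "\<pi>\<^sub>\<nu> t \<in> carrier_vec (n - m)"
    using curve[OF t] by auto
  show "(has_vec_deriv q (grad (\<lambda>y. Ham M V (q t, y)) (p t)) t \<and>
      has_vec_deriv p (- grad (\<lambda>x. Ham M V (x, p t)) (q t) + \<tau> t) t) \<longleftrightarrow>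
    has_vec_deriv (\<lambda>s. q s @\<^sub>v \<pi> s @\<^sub>v \<pi>\<^sub>\<nu> s)
       (struct_mat M J Z (q t) (\<pi> t @\<^sub>v \<pi>\<^sub>\<nu> t) *\<^sub>v
          (grad (\<lambda>x. Hbar n U M V J Z (x, \<pi> t @\<^sub>v \<pi>\<^sub>\<nu> t)) (q t)
           @\<^sub>v grad (\<lambda>x. Hbar n U M V J Z (q t, x @\<^sub>v \<pi>\<^sub>\<nu> t)) (\<pi> t)
           @\<^sub>v grad (\<lambda>x. Hbar n U M V J Z (q t, \<pi> t @\<^sub>v x)) (\<pi>\<^sub>\<nu> t))
        + (0\<^sub>v (dim_vec (q t)) @\<^sub>v (Js (q t))\<^sup>T *\<^sub>v \<tau> t @\<^sub>v 0\<^sub>v (dim_vec (\<pi>\<^sub>\<nu> t)))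
        + (0\<^sub>v (dim_vec (q t)) @\<^sub>v 0\<^sub>v (dim_vec (\<pi> t)) @\<^sub>v Z (q t) *\<^sub>v \<tau> t)) t"
    unfolding grad_Hbar_task[OF q x y] grad_Hbar_null[OF q x y] grad_Ham_momentum[OF q p]
      carrier_vecD[OF U_carrier[OF q]] carrier_vecD[OF x] carrier_vecD[OF y]
      port_Hamiltonian_rhs[OF q x y \<tau>] momenta(3)[OF t]
    by (rule Hamiltonian_iff_port_Hamiltonian[OF t])
qed

text \<open>The canonical position equation identifies the given derivative as
  \<open>M^-1 p\<close>; its components under \<open>J\<close> and \<open>N\<close> are then the
  momentum gradients of \<open>Hbar\<close>.\<close>

lemma outputs:
  assumes sol: "ham_solution M V T q p \<tau>" and t: "t \<in> T" and q': "has_vec_deriv q q' t"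
  shows "p t = M (q t) *\<^sub>v q'"
    "grad (\<lambda>x. Hbar n U M V J Z (q t, x @\<^sub>v \<pi>\<^sub>\<nu> t)) (\<pi> t) = J (q t) *\<^sub>v q'"
    "grad (\<lambda>x. Hbar n U M V J Z (q t, \<pi> t @\<^sub>v x)) (\<pi>\<^sub>\<nu> t) = N (q t) *\<^sub>v q'"
proof -
  have q: "q t \<in> U" and p: "p t \<in> carrier_vec n"
    and x: "\<pi> t \<in> carrier_vec m" and y: "\<pi>\<^sub>\<nu> t \<in> carrier_vec (n - m)"
    using curve[OF t] by auto
  have ev: "\<forall>\<^sub>F s in nhds t. q s \<in> carrier_vec n"
    by (rule eventually_in_open[OF open_T t]) (use curve U_carrier in blast)
  have "has_vec_deriv q (Mi (q t) *\<^sub>v p t) t"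
    using sol t unfolding ham_solution_def grad_Ham_momentum[OF q p, symmetric] by blast
  then have q'_eq: "q' = Mi (q t) *\<^sub>v p t"
    using has_vec_deriv_on_unique q' unfolding has_vec_deriv_on_iff[OF ev, symmetric] by blast
  show "p t = M (q t) *\<^sub>v q'"
    using mult_vec_assoc_eq[OF M_carrier Mi_carrier p M_Mi, OF q q q] p unfolding q'_eq by simp
  show "grad (\<lambda>x. Hbar n U M V J Z (q t, x @\<^sub>v \<pi>\<^sub>\<nu> t)) (\<pi> t) = J (q t) *\<^sub>v q'"
    unfolding grad_Hbar_task[OF q x y] q'_eq
    using velocity_from_momenta(1)[OF q x y] unfolding momenta(3)[OF t] by simp
  show "grad (\<lambda>x. Hbar n U M V J Z (q t, \<pi> t @\<^sub>v x)) (\<pi>\<^sub>\<nu> t) = N (q t) *\<^sub>v q'"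
    unfolding grad_Hbar_null[OF q x y] q'_eq
    using velocity_from_momenta(2)[OF q x y] unfolding momenta(3)[OF t] by simp
qed

end

text \<open>That the system takes the port-Hamiltonian form in the new variables is expressed as an
  equivalence of trajectories: a curve solves the canonical equations if and only if its image under
  \<open>Phi\<close> solves the transformed ones. The time set is any open set and the input any
  vector-valued function of time. The outputs are identified along canonical solutions through the
  derivative \<open>q'\<close>.\<close>

theorem proposition1:
  fixes n m :: nat
    and U :: "real vec set"
    and M J Z :: "real vec \<Rightarrow> real mat"
    and V :: "real vec \<Rightarrow> real"
  assumes "m \<le> n"
    and "open_vec n U"
    and "smooth_mat n n n U M" and "\<And>q. q \<in> U \<Longrightarrow> sym_pos_def n (M q)"
    and "smooth_vec n U V"
    and "smooth_mat m n n U J" and "\<And>q. q \<in> U \<Longrightarrow> vec_space.rank m (J q) = m"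
    and "smooth_mat (n - m) n n U Z" and "\<And>q. q \<in> U \<Longrightarrow> vec_space.rank (n - m) (Z q) = n - m"
    and "\<And>q. q \<in> U \<Longrightarrow> J q * (Z q)\<^sup>T = 0\<^sub>m m (n - m)"
  shows
    \<comment> \<open>the extended Jacobian, the block-diagonal inertia and the change of coordinates\<close>
    "(\<forall>q\<in>U. invertible_mat (Jbar M J Z q) \<and>
        Jsharp M J q @\<^sub>c (Z q)\<^sup>T = minv (Jbar M J Z q) \<and>
        Lambda_t M J Z q \<in> carrier_mat m m \<and> Lambda_nu M J Z q \<in> carrier_mat (n - m) (n - m) \<and>
        invertible_mat (Lambda_t M J Z q) \<and> invertible_mat (Lambda_nu M J Z q) \<and>
        Lambda_bar M J Z q =
          four_block_mat (Lambda_t M J Z q) (0\<^sub>m m (n - m)) (0\<^sub>m (n - m) m) (Lambda_nu M J Z q)) \<and>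
     bij_betw (Phi M J Z) (U \<times> carrier_vec n) (U \<times> carrier_vec n) \<and>
     \<comment> \<open>the transformed Hamiltonian and skew-symmetry\<close>
     (\<forall>q\<in>U. \<forall>\<pi>\<in>carrier_vec m. \<forall>\<pi>\<^sub>\<nu>\<in>carrier_vec (n - m).
        Hbar n U M V J Z (q, \<pi> @\<^sub>v \<pi>\<^sub>\<nu>) =
          1 / 2 * (\<pi> \<bullet> (minv (Lambda_t M J Z q) *\<^sub>v \<pi>))
          + 1 / 2 * (\<pi>\<^sub>\<nu> \<bullet> (minv (Lambda_nu M J Z q) *\<^sub>v \<pi>\<^sub>\<nu>)) + V q \<and>
        G11 M J Z q (\<pi> @\<^sub>v \<pi>\<^sub>\<nu>) = - (G11 M J Z q (\<pi> @\<^sub>v \<pi>\<^sub>\<nu>))\<^sup>T \<and>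
        G22 M J Z q (\<pi> @\<^sub>v \<pi>\<^sub>\<nu>) = - (G22 M J Z q (\<pi> @\<^sub>v \<pi>\<^sub>\<nu>))\<^sup>T) \<and>
     \<comment> \<open>the port-Hamiltonian form and its outputs\<close>
     (\<forall>T q p \<tau> \<pi> \<pi>\<^sub>\<nu>.
        open T \<and>
        (\<forall>t\<in>T. q t \<in> U \<and> p t \<in> carrier_vec n \<and> \<tau> t \<in> carrier_vec n \<and>
           \<pi> t \<in> carrier_vec m \<and> \<pi>\<^sub>\<nu> t \<in> carrier_vec (n - m) \<and>
           Phi M J Z (q t, p t) = (q t, \<pi> t @\<^sub>v \<pi>\<^sub>\<nu> t)) \<longrightarrow>
        (ham_solution M V T q p \<tau> \<longleftrightarrow>
           ph_solution M J Z (Hbar n U M V J Z) T q \<pi> \<pi>\<^sub>\<nu>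
             (\<lambda>t. (Jsharp M J (q t))\<^sup>T *\<^sub>v \<tau> t) (\<lambda>t. Z (q t) *\<^sub>v \<tau> t)) \<and>
        (ham_solution M V T q p \<tau> \<longrightarrow>
           (\<forall>t\<in>T. \<forall>q'. has_vec_deriv q q' t \<longrightarrow>
              p t = M (q t) *\<^sub>v q' \<and>
              grad (\<lambda>x. Hbar n U M V J Z (q t, x @\<^sub>v \<pi>\<^sub>\<nu> t)) (\<pi> t) = J (q t) *\<^sub>v q' \<and>
              grad (\<lambda>x. Hbar n U M V J Z (q t, \<pi> t @\<^sub>v x)) (\<pi>\<^sub>\<nu> t) = Nmat M Z (q t) *\<^sub>v q'))) \<and>
     \<comment> \<open>the decompositions of velocities and forces\<close>
     (\<forall>q\<in>U. \<forall>q'\<in>carrier_vec n. \<forall>\<tau>\<in>carrier_vec n.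
        (\<exists>!(\<nu>\<^sub>k, v). \<nu>\<^sub>k \<in> mat_kernel (J q) \<and> v \<in> ker_perp (M q) (J q) \<and> q' = v + \<nu>\<^sub>k) \<and>
        (\<exists>!(\<tau>\<^sub>k, \<tau>\<^sub>F). \<tau>\<^sub>k \<in> mat_kernel (J q * minv (M q)) \<and> \<tau>\<^sub>F \<in> mat_range ((J q)\<^sup>T) \<and> \<tau> = \<tau>\<^sub>k + \<tau>\<^sub>F) \<and>
        (\<forall>\<nu>\<^sub>k v \<tau>\<^sub>k \<tau>\<^sub>F.
           \<nu>\<^sub>k \<in> mat_kernel (J q) \<and> v \<in> ker_perp (M q) (J q) \<and> q' = v + \<nu>\<^sub>k \<and>
           \<tau>\<^sub>k \<in> mat_kernel (J q * minv (M q)) \<and> \<tau>\<^sub>F \<in> mat_range ((J q)\<^sup>T) \<and> \<tau> = \<tau>\<^sub>k + \<tau>\<^sub>F \<longrightarrow>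
           \<nu>\<^sub>k = (Z q)\<^sup>T *\<^sub>v (Nmat M Z q *\<^sub>v q') \<and>
           \<tau>\<^sub>k = (Nmat M Z q)\<^sup>T *\<^sub>v (Z q *\<^sub>v \<tau>) \<and>
           v = Jsharp M J q *\<^sub>v (J q *\<^sub>v q') \<and>
           \<tau>\<^sub>F = (J q)\<^sup>T *\<^sub>v ((Jsharp M J q)\<^sup>T *\<^sub>v \<tau>) \<and>
           \<tau>\<^sub>F \<bullet> v = ((Jsharp M J q)\<^sup>T *\<^sub>v \<tau>) \<bullet> (J q *\<^sub>v q'))) \<and>
     \<comment> \<open>bases of the null-space components, isomorphisms for the task components\<close>
     (\<forall>q\<in>U. cols_basis ((Z q)\<^sup>T) (mat_kernel (J q)) \<and>
        cols_basis ((Nmat M Z q)\<^sup>T) (mat_kernel (J q * minv (M q))) \<and>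
        bij_betw (\<lambda>\<eta>. Jsharp M J q *\<^sub>v \<eta>) (carrier_vec m) (ker_perp (M q) (J q)) \<and>
        bij_betw (\<lambda>\<sigma>. (J q)\<^sup>T *\<^sub>v \<sigma>) (carrier_vec m) (mat_range ((J q)\<^sup>T)))"
proof -
  interpret task_system n m U M J Z V
    by (rule task_system.intro) (rule assms; assumption)+
  have matrices: "invertible_mat (Jb q) \<and> W q = minv (Jb q) \<and>
      Lambda_t M J Z q \<in> carrier_mat m m \<and> Lambda_nu M J Z q \<in> carrier_mat (n - m) (n - m) \<and>
      invertible_mat (Lambda_t M J Z q) \<and> invertible_mat (Lambda_nu M J Z q) \<and>
      Lambda_bar M J Z q =
        four_block_mat (Lambda_t M J Z q) (0\<^sub>m m (n - m)) (0\<^sub>m (n - m) m) (Lambda_nu M J Z q)"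
    if q: "q \<in> U" for q
    unfolding Lambda_t_eq[OF q] Lambda_nu_eq[OF q] Lambda_bar_eq[OF q] minv_Jb[OF q]
    by (intro conjI refl Si_carrier R_carrier q
        invertible_matI[OF Jb_carrier[OF q] W_carrier[OF q] Jb_W[OF q] W_Jb[OF q]]
        invertible_matI[OF Si_carrier[OF q] S_carrier[OF q] Si_S[OF q] S_Si[OF q]]
        invertible_matI[OF R_carrier[OF q] Ri_carrier[OF q] R_Ri[OF q] Ri_R[OF q]])
  have Hamiltonian: "Hbar n U M V J Z (q, x @\<^sub>v y) =
        1 / 2 * (x \<bullet> (minv (Lambda_t M J Z q) *\<^sub>v x))
        + 1 / 2 * (y \<bullet> (minv (Lambda_nu M J Z q) *\<^sub>v y)) + V q \<and>
      G11 M J Z q (x @\<^sub>v y) = - (G11 M J Z q (x @\<^sub>v y))\<^sup>T \<and>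
      G22 M J Z q (x @\<^sub>v y) = - (G22 M J Z q (x @\<^sub>v y))\<^sup>T"
    if "q \<in> U" "x \<in> carrier_vec m" "y \<in> carrier_vec (n - m)" for q x y
    unfolding minv_Lambda_t[OF that(1)] minv_Lambda_nu[OF that(1)]
    by (intro conjI Hbar_blocks G11_skew G22_skew that)
  have dynamics: "(ham_solution M V T q p \<tau> \<longleftrightarrow>
        ph_solution M J Z (Hbar n U M V J Z) T q \<pi> \<pi>\<^sub>\<nu>
          (\<lambda>t. (Js (q t))\<^sup>T *\<^sub>v \<tau> t) (\<lambda>t. Z (q t) *\<^sub>v \<tau> t)) \<and>
      (ham_solution M V T q p \<tau> \<longrightarrow>
        (\<forall>t\<in>T. \<forall>q'. has_vec_deriv q q' t \<longrightarrow>
          p t = M (q t) *\<^sub>v q' \<and>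
          grad (\<lambda>x. Hbar n U M V J Z (q t, x @\<^sub>v \<pi>\<^sub>\<nu> t)) (\<pi> t) = J (q t) *\<^sub>v q' \<and>
          grad (\<lambda>x. Hbar n U M V J Z (q t, \<pi> t @\<^sub>v x)) (\<pi>\<^sub>\<nu> t) = N (q t) *\<^sub>v q'))"
    if "open T \<and> (\<forall>t\<in>T. q t \<in> U \<and> p t \<in> carrier_vec n \<and> \<tau> t \<in> carrier_vec n \<and>
      \<pi> t \<in> carrier_vec m \<and> \<pi>\<^sub>\<nu> t \<in> carrier_vec (n - m) \<and>
      Phi M J Z (q t, p t) = (q t, \<pi> t @\<^sub>v \<pi>\<^sub>\<nu> t))" for T q p \<tau> \<pi> \<pi>\<^sub>\<nu>
  proof -
    \<comment> \<open>The trajectory is universally quantified within the statement, so the facts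
      about curves are instantiated for each one separately.\<close>
    interpret task_curve n m U M J Z V T q p \<tau> \<pi> \<pi>\<^sub>\<nu>
      by unfold_locales (rule conjunct1[OF that], rule bspec[OF conjunct2[OF that]])
    show ?thesis
      by (intro conjI impI ballI allI solution_iff) (rule outputs; assumption)+
  qed
  have decompositions: "(\<exists>!(k, v). k \<in> mat_kernel (J q) \<and> v \<in> ker_perp (M q) (J q) \<and> q' = v + k) \<and>
      (\<exists>!(k, f). k \<in> mat_kernel (J q * Mi q) \<and> f \<in> mat_range ((J q)\<^sup>T) \<and> \<tau> = k + f) \<and>
      (\<forall>\<nu>\<^sub>k v \<tau>\<^sub>k \<tau>\<^sub>F.
        \<nu>\<^sub>k \<in> mat_kernel (J q) \<and> v \<in> ker_perp (M q) (J q) \<and> q' = v + \<nu>\<^sub>k \<and>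
        \<tau>\<^sub>k \<in> mat_kernel (J q * Mi q) \<and> \<tau>\<^sub>F \<in> mat_range ((J q)\<^sup>T) \<and> \<tau> = \<tau>\<^sub>k + \<tau>\<^sub>F \<longrightarrow>
        \<nu>\<^sub>k = (Z q)\<^sup>T *\<^sub>v (N q *\<^sub>v q') \<and>
        \<tau>\<^sub>k = (N q)\<^sup>T *\<^sub>v (Z q *\<^sub>v \<tau>) \<and>
        v = Js q *\<^sub>v (J q *\<^sub>v q') \<and>
        \<tau>\<^sub>F = (J q)\<^sup>T *\<^sub>v ((Js q)\<^sup>T *\<^sub>v \<tau>) \<and>
        \<tau>\<^sub>F \<bullet> v = ((Js q)\<^sup>T *\<^sub>v \<tau>) \<bullet> (J q *\<^sub>v q'))"
    if q: "q \<in> U" and "q' \<in> carrier_vec n" "\<tau> \<in> carrier_vec n" for q q' \<tau>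
  proof (intro conjI velocity_decomposition[OF q that(2)] force_decomposition[OF q that(3)] allI impI; elim conjE)
    fix \<nu>\<^sub>k v \<tau>\<^sub>k \<tau>\<^sub>F
    assume k: "\<nu>\<^sub>k \<in> mat_kernel (J q)" and v: "v \<in> ker_perp (M q) (J q)" and q': "q' = v + \<nu>\<^sub>k"
      and kf: "\<tau>\<^sub>k \<in> mat_kernel (J q * Mi q)" and f: "\<tau>\<^sub>F \<in> mat_range ((J q)\<^sup>T)" and \<tau>: "\<tau> = \<tau>\<^sub>k + \<tau>\<^sub>F"
    show "\<nu>\<^sub>k = (Z q)\<^sup>T *\<^sub>v (N q *\<^sub>v q')" "v = Js q *\<^sub>v (J q *\<^sub>v q')"
      unfolding q' by (rule velocity_components[OF q k v])+
    show "\<tau>\<^sub>k = (N q)\<^sup>T *\<^sub>v (Z q *\<^sub>v \<tau>)" "\<tau>\<^sub>F = (J q)\<^sup>T *\<^sub>v ((Js q)\<^sup>T *\<^sub>v \<tau>)"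
      unfolding \<tau> by (rule force_components[OF q kf f])+
    show "\<tau>\<^sub>F \<bullet> v = ((Js q)\<^sup>T *\<^sub>v \<tau>) \<bullet> (J q *\<^sub>v q')"
      unfolding q' \<tau> by (rule power_pairing[OF q k v kf f])
  qed
  show ?thesis
    apply (rule conjI, rule ballI, erule matrices)
    apply (rule conjI, rule bij_Phi)
    apply (rule conjI, intro ballI, rule Hamiltonian, assumption+)
    apply (rule conjI, intro allI impI, erule dynamics)
    apply (rule conjI, intro ballI, rule decompositions, assumption+)
    apply (intro ballI conjI)
    apply (erule kernel_J_basis kernel_JMi_basis bij_Js bij_JT)+
    done
qed

end
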